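(* Let $p$ be a prime number, let $G$ be a semi-extraspecial $p$-group, and write $|G:G'| = p^{2a}$ with $a$ a positive integer. Then $G$ possesses an automorphism of order $|G:G'|-1$ if and only if $G$ is isomorphic to a Sylow $p$-subgroup of $\mathrm{SU}_3(p^{2a})$.
   Context: All groups are finite. $G'$ denotes the derived subgroup of $G$ and $Z(G)$ its center. A $p$-group $E$ is called extraspecial if $|E'| = |Z(E)| = p$. A nontrivial $p$-group $G$ is called semi-extraspecial if $G/N$ is extraspecial for every maximal subgroup $N$ of $Z(G)$. It is known that for a semi-extraspecial $p$-group $G$ one has $G' = Z(G) = \Phi(G)$ (the Frattini subgroup), and that $|G:G'| = |G:Z(G)| = p^{2a}$ for some positive integer $a$. For a prime power $q$, $\mathrm{SU}_n(q^2)$ denotes the special unitary group of dimension $n$ over the field $\mathbb{F}_{q^2}$ with $q^2$ elements, that is, the subgroup of $\mathrm{GL}_n(q^2)$ consisting of the matrices $U$ of determinant $1$ with $U^{-1} = \overline{U}^{t}$, where $\overline{U}$ is obtained from $U$ by raising each entry to the $q$-th power. In particular $\mathrm{SU}_3(p^{2a})$ is defined over $\mathbb{F}_{p^{2a}}$, with $q = p^a$. *)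

theory Defs
  imports "HOL-Algebra.Algebra" "HOL-Analysis.Determinants" "HOL-Library.Numeral_Type"
begin

definition center :: "('a, 'b) monoid_scheme \<Rightarrow> 'a set" where
  "center G = {z \<in> carrier G. \<forall>x \<in> carrier G. z \<otimes>\<^bsub>G\<^esub> x = x \<otimes>\<^bsub>G\<^esub> z}"

abbreviation commutator_subgroup :: "('a, 'b) monoid_scheme \<Rightarrow> 'a set" where
  "commutator_subgroup G \<equiv> derived G (carrier G)"

definition maximal_subgroup :: "'a set \<Rightarrow> ('a, 'b) monoid_scheme \<Rightarrow> bool" where
  "maximal_subgroup M G \<longleftrightarrow> subgroup M G \<and> M \<noteq> carrier G \<and>
     (\<forall>K. subgroup K G \<and> M \<subseteq> K \<longrightarrow> K = M \<or> K = carrier G)"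

text \<open>Finiteness is implied: for prime \<open>p\<close> the order is nonzero, and the order of an
  infinite group is \<open>0\<close>.\<close>

definition p_group :: "nat \<Rightarrow> ('a, 'b) monoid_scheme \<Rightarrow> bool" where
  "p_group p G \<longleftrightarrow> group G \<and> (\<exists>n. order G = p ^ n)"

definition extraspecial :: "nat \<Rightarrow> ('a, 'b) monoid_scheme \<Rightarrow> bool" where
  "extraspecial p E \<longleftrightarrow> p_group p E \<and> card (commutator_subgroup E) = p \<and> card (center E) = p"

definition semi_extraspecial :: "nat \<Rightarrow> ('a, 'b) monoid_scheme \<Rightarrow> bool" where
  "semi_extraspecial p G \<longleftrightarrow> p_group p G \<and> carrier G \<noteq> {\<one>\<^bsub>G\<^esub>} \<and>
     (\<forall>N. maximal_subgroup N (G\<lparr>carrier := center G\<rparr>) \<longrightarrow> extraspecial p (G Mod N))"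

definition sylow_subgroup :: "nat \<Rightarrow> 'a set \<Rightarrow> ('a, 'b) monoid_scheme \<Rightarrow> bool" where
  "sylow_subgroup p P G \<longleftrightarrow> subgroup P G \<and> card P = p ^ multiplicity p (order G)"

text \<open>The special unitary group over the field \<open>'k\<close>, which is meant to have \<open>q\<^sup>2\<close> elements, so that
  \<open>x \<mapsto> x ^ q\<close> is the field automorphism of order 2. The dimension is the cardinality of \<open>'n\<close>.
  Since the determinant is 1, \<^const>\<open>matrix_inv\<close> is the genuine inverse.\<close>

definition SU :: "nat \<Rightarrow> (('k::field) ^ 'n ^ 'n) monoid" where
  "SU q = \<lparr>carrier = {U. det U = 1 \<and> matrix_inv U = transpose (map_matrix (\<lambda>x. x ^ q) U)},
           monoid.mult = (**), one = mat 1\<rparr>"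

end

theory Submission
  imports Defs "HOL-Number_Theory.Residues" "HOL-Computational_Algebra.Polynomial"
begin

text \<open>
  Write \<open>q = p\<^sup>a\<close> and let \<open>k\<close> be the field with \<open>q\<^sup>2\<close> elements. An automorphism \<open>\<phi>\<close> of order
  \<open>q\<^sup>2 - 1\<close> acts faithfully on \<open>G/Z\<close>, where it is a Singer cycle, so \<open>G/Z\<close> can be identified with
  \<open>k\<close> in such a way that \<open>\<phi>\<close> becomes multiplication by a generator \<open>\<zeta>\<close> of the unit group.
  Decomposing the commutator form \<open>B : k \<times> k \<rightarrow> Z\<close> into its components with
  \<open>B (w x, y) = B (x, w ^ p ^ i y)\<close>, equivariance and \<open>card Z < q\<^sup>2\<close> kill all components except
  \<open>i = a\<close>, so that \<open>B (x, y)\<close> depends only on \<open>x ^ q y\<close> modulo the subfield of order \<open>q\<close>.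
  Finally \<open>\<psi> = \<phi> ^ (q - 1)\<close> is trivial on \<open>Z\<close> and fixed-point-free on \<open>G/Z\<close>; hence
  \<open>\<psi>(g) g\<^sup>-\<^sup>1\<close> depends only on \<open>g Z\<close> and yields a canonical section \<open>k \<rightarrow> G\<close> whose cocycle is
  expressed by \<open>B\<close>. This determines \<open>G\<close> in every characteristic, including 2.

  Conversely, a Sylow \<open>p\<close>-subgroup of the unitary group fixes a nonzero isotropic vector, because
  the number of isotropic vectors is divisible by \<open>p\<close>, and the stabilizer of such a vector is, in a
  hyperbolic basis, the group of unitriangular matrices with rows \<open>(1, x, t)\<close>, \<open>(0, 1, x ^ q)\<close>,
  \<open>(0, 0, 1)\<close> and \<open>t + t ^ q = x ^ (q + 1)\<close>, which has the automorphism
  \<open>(x, t) \<mapsto> (\<zeta> x, \<zeta> ^ (q + 1) t)\<close>.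
\<close>

section \<open>Finite fields\<close>

text \<open>In odd characteristic one would halve the commutator form to normalise the extension;
  for p = 2 there is no half. Its place is taken by \<open>kappa\<close>, an element of trace -1
  over the subfield of order q (in odd characteristic -1/2 is another one), which comes out as the
  coefficient in the cocycle of the section. Faithfulness on G/Z is coprimality: an endomorphism
  that is trivial on G/Z has the identity as its p-th power, while q^2 - 1 is prime to p. The bound
  on the order of Z comes from a fixed noncentral x: each central element is a commutator of x with
  some y, depends only on the coset of y, and the cosets of 1 and of x give the same value. The
  index a stands out because \<zeta>^(p^i + 1) generates the whole field as a ring for every other
  i, whereas \<zeta>^(q + 1) lies in the subfield of order q. The primitive element is a parameter
  of the locales because it changes: an arbitrary one serves to set up the field, and the eigenvalue
  of the given automorphism then replaces it.\<close>

locale prim_field =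
  fixes p n :: nat and \<zeta> :: "'k :: {field, finite}"
  assumes prime_p: "Factorial_Ring.prime p"
    and card_k: "CARD('k) = p ^ n"
    and zeta_nz: "\<zeta> \<noteq> 0"
    and zeta_gen: "x \<noteq> 0 \<Longrightarrow> \<exists>i. x = \<zeta> ^ i"
begin

lemma p_gt_1: "p > 1"
  using prime_p prime_gt_1_nat by blast

lemma card_gt_1: "CARD('k) > 1"
proof -
  have "card {0, 1 :: 'k} \<le> CARD('k)"
    by (rule card_mono) auto
  then show ?thesis by simp
qed

lemma char_k: "CHAR('k) = p"
proof -
  have "CHAR('k) dvd p ^ n"
    using CHAR_dvd_CARD[where 'a = 'k] card_k by simp
  moreover have "Factorial_Ring.prime CHAR('k)"
    by (intro prime_CHAR_semidom finite_imp_CHAR_pos) simp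
  ultimately show ?thesis
    by (metis prime_p prime_dvd_power primes_dvd_imp_eq)
qed

lemma of_nat_p: "of_nat p = (0 :: 'k)"
  using char_k of_nat_CHAR by metis

lemma frob_add: "(x + y :: 'k) ^ p ^ m = x ^ p ^ m + y ^ p ^ m"
  using freshmans_dream'[where 'a = 'k] char_k prime_p by blast

lemma frob_sum: "(sum f A :: 'k) ^ p ^ m = (\<Sum>i\<in>A. f i ^ p ^ m)"
  using freshmans_dream_sum'[where 'a = 'k] char_k prime_p by blast

lemma frob_minus: "(- x :: 'k) ^ p ^ m = - (x ^ p ^ m)"
  using frob_add[of x "- x" m] p_gt_1 by (simp add: power_0_left eq_neg_iff_add_eq_0 add.commute)

lemma frob_diff: "(x - y :: 'k) ^ p ^ m = x ^ p ^ m - y ^ p ^ m"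
  using frob_add[of x "- y" m] frob_minus[of y m] by simp

text \<open>Multiplication by \<open>x\<close> permutes the nonzero elements, so their product stays
  the same although every factor gains an \<open>x\<close>.\<close>

lemma power_card_minus_1:
  fixes x :: 'k
  assumes "x \<noteq> 0"
  shows "x ^ (CARD('k) - 1) = 1"
proof -
  have "(\<Prod>y\<in>UNIV-{0}. x * y) = (\<Prod>y\<in>UNIV-{0}. y)"
    by (rule prod.reindex_bij_witness[of _ "\<lambda>y. y / x" "\<lambda>y. x * y"]) (use assms in auto)
  moreover have "(\<Prod>y\<in>UNIV-{0}. x * y) = x ^ (CARD('k) - 1) * \<Prod>(UNIV-{0})"
    by (simp add: prod.distrib)
  moreover have "\<Prod>(UNIV-{0::'k}) \<noteq> 0"
    by simp
  ultimately show ?thesis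
    by simp
qed

lemma power_card: "(x :: 'k) ^ p ^ n = x"
proof (cases "x = 0")
  case False
  have "x ^ CARD('k) = x ^ Suc (CARD('k) - 1)"
    using card_gt_1 by simp
  then show ?thesis
    using power_card_minus_1[OF False] card_k by (metis mult.right_neutral power_Suc)
next
  case True
  then show ?thesis
    using p_gt_1 by (simp add: power_0_left)
qed

text \<open>A smaller period \<open>r\<close> would leave at most \<open>r\<close> distinct powers
  of \<open>\<zeta>\<close>, too few for the \<open>p ^ n - 1\<close> nonzero elements.\<close>

lemma zeta_power_eq_1_iff: "\<zeta> ^ i = 1 \<longleftrightarrow> p ^ n - 1 dvd i"
proof
  assume "p ^ n - 1 dvd i"
  then show "\<zeta> ^ i = 1"
    using power_card_minus_1[OF zeta_nz] card_k by (auto simp: power_mult elim!: dvdE)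
next
  assume i: "\<zeta> ^ i = 1"
  define r where "r = i mod (p ^ n - 1)"
  have "\<zeta> ^ i = (\<zeta> ^ (p ^ n - 1)) ^ (i div (p ^ n - 1)) * \<zeta> ^ r"
    unfolding r_def by (metis mult_div_mod_eq power_add power_mult)
  then have r: "\<zeta> ^ r = 1"
    using i power_card_minus_1[OF zeta_nz] card_k by simp
  have "r < p ^ n - 1"
    using card_gt_1 card_k by (simp add: r_def)
  have "r = 0"
  proof (rule ccontr)
    assume "r \<noteq> 0"
    have "UNIV - {0} \<subseteq> (\<lambda>j. \<zeta> ^ j) ` {..<r}"
    proof
      fix x :: 'k assume "x \<in> UNIV - {0}"
      then obtain j where "x = \<zeta> ^ j"
        using zeta_gen by blast
      also have "\<dots> = (\<zeta> ^ r) ^ (j div r) * \<zeta> ^ (j mod r)"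
        by (metis mult_div_mod_eq power_add power_mult)
      finally show "x \<in> (\<lambda>j. \<zeta> ^ j) ` {..<r}"
        using r \<open>r \<noteq> 0\<close> by auto
    qed
    then have "card (UNIV - {0::'k}) \<le> r"
      by (metis card_lessThan finite_lessThan surj_card_le)
    then show False
      using \<open>r < p ^ n - 1\<close> card_k by simp
  qed
  then show "p ^ n - 1 dvd i"
    by (auto simp: r_def)
qed

text \<open>Substituting \<open>\<zeta> * u\<close> for \<open>u\<close> multiplies the sum by
  \<open>\<zeta> ^ m\<close>, which forces 0 unless \<open>\<zeta> ^ m = 1\<close>; in that case all
  summands are 1, and their number is -1 in the field. Both averaging arguments below rest on this
  orthogonality.\<close>

lemma sum_powers: "(\<Sum>u\<in>UNIV-{0::'k}. u ^ m) = (if p ^ n - 1 dvd m then - 1 else 0)"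
proof (cases "p ^ n - 1 dvd m")
  case True
  then have "u ^ m = 1" if "u \<noteq> 0" for u :: 'k
    using power_card_minus_1[OF that] card_k by (auto simp: power_mult elim!: dvdE)
  then have "(\<Sum>u\<in>UNIV-{0::'k}. u ^ m) = of_nat (card (UNIV - {0::'k}))"
    by simp
  also have "\<dots> = of_nat (CARD('k)) - 1"
    using card_gt_1 by (simp add: of_nat_diff)
  also have "\<dots> = - 1"
    using card_k of_nat_p card_gt_1 by (cases n) auto
  finally show ?thesis
    using True by simp
next
  case False
  have "\<zeta> ^ m * (\<Sum>u\<in>UNIV-{0::'k}. u ^ m) = (\<Sum>u\<in>UNIV-{0::'k}. (\<zeta> * u) ^ m)"
    by (simp add: sum_distrib_left power_mult_distrib)
  also have "\<dots> = (\<Sum>u\<in>UNIV-{0::'k}. u ^ m)"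
    by (rule sum.reindex_bij_witness[of _ "\<lambda>y. y / \<zeta>" "\<lambda>y. \<zeta> * y"]) (use zeta_nz in auto)
  finally have "(\<zeta> ^ m - 1) * (\<Sum>u\<in>UNIV-{0::'k}. u ^ m) = 0"
    by (simp add: algebra_simps)
  then show ?thesis
    using False zeta_power_eq_1_iff by auto
qed

text \<open>\<open>X ^ p - X\<close> has at most \<open>p\<close> roots, and the \<open>p\<close>
  distinct elements \<open>of_nat i\<close> with \<open>i < p\<close> are roots already. Being the
  image of a natural number is what lets such a scalar pass through a map known only to be
  additive.\<close>

lemma prime_subfield:
  assumes "(c :: 'k) ^ p = c"
  shows "\<exists>m. c = of_nat m"
proof -
  have inj: "inj_on (of_nat :: nat \<Rightarrow> 'k) {..<p}"
  proof (rule inj_onI)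
    fix i j :: nat assume ij: "i \<in> {..<p}" "j \<in> {..<p}" "of_nat i = (of_nat j :: 'k)"
    then have "[i = j] (mod p)"
      using char_k of_nat_eq_iff_cong_CHAR by metis
    then show "i = j"
      using ij cong_less_modulus_unique_nat by simp
  qed
  define P :: "'k poly" where "P = monom 1 p - monom 1 1"
  have P: "P \<noteq> 0" "degree P \<le> p"
  proof -
    have "poly.coeff P p = 1"
      using p_gt_1 by (simp add: P_def)
    then show "P \<noteq> 0" by auto
    show "degree P \<le> p"
      unfolding P_def using p_gt_1
      by (intro degree_diff_le) (auto simp: degree_monom_eq)
  qed
  have sub: "of_nat ` {..<p} \<subseteq> {x. poly P x = 0}"
  proof
    fix x :: 'k assume "x \<in> of_nat ` {..<p}"
    then obtain i where x: "x = of_nat i" by blast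
    have "(of_nat i :: 'k) ^ p = of_nat i"
    proof (induction i)
      case (Suc i)
      then show ?case
        using frob_add[of 1 "of_nat i" 1] by simp
    qed (use p_gt_1 in simp)
    then show "x \<in> {x. poly P x = 0}"
      by (simp add: P_def poly_monom x)
  qed
  have "card {x. poly P x = 0} \<le> p"
    using P card_poly_roots_bound[of P] by linarith
  then have "of_nat ` {..<p} = {x. poly P x = 0}"
    by (intro card_seteq sub) (auto simp: card_image[OF inj])
  moreover have "poly P c = 0"
    using assms by (simp add: P_def poly_monom)
  ultimately show ?thesis
    by blast
qed

end

text \<open>Cyclicity of the unit group is taken from HOL-Algebra, so the type \<open>'k\<close> is
  first wrapped as a ring record with carrier \<open>UNIV\<close>.\<close>

lemma ex_prim_field:
  assumes "Factorial_Ring.prime p" "CARD('k :: {field, finite}) = p ^ n"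
  shows "\<exists>\<zeta> :: 'k. prim_field p n \<zeta>"
proof -
  let ?R = "\<lparr>carrier = UNIV, monoid.mult = (*), one = 1, ring.zero = 0, add = (+)\<rparr> :: 'k ring"
  have "cring ?R"
  proof (rule cringI)
    show "abelian_group ?R"
      by (rule abelian_groupI) (auto simp: add_ac intro: exI[of _ "- x" for x] left_minus)
    show "Group.comm_monoid ?R"
      by (rule comm_monoidI) (auto simp: mult_ac)
  qed (simp add: distrib_right)
  then interpret cring ?R .
  have "x \<in> Units ?R \<longleftrightarrow> x \<noteq> 0" for x
  proof (cases "x = 0")
    case False
    then show ?thesis by (auto simp: Units_def intro!: exI[of _ "inverse x"])
  qed (simp add: Units_def)
  then interpret R: field ?R
    by (intro cring_fieldI) auto
  have pow: "x [^]\<^bsub>?R\<^esub> (i::nat) = x ^ i" for x i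
    by (induction i) auto
  have C: "carrier (Multiplicative_Group.mult_of ?R) = UNIV - {0}"
    by simp
  have "\<exists>\<zeta> \<in> UNIV - {0 :: 'k}. UNIV - {0} = {\<zeta> ^ i | i::nat. i \<in> UNIV}"
    using R.finite_field_mult_group_has_gen unfolding C pow by simp
  then obtain \<zeta> :: 'k where z: "\<zeta> \<noteq> 0" "UNIV - {0} = {\<zeta> ^ i | i::nat. i \<in> UNIV}"
    by auto
  have "\<exists>i. x = \<zeta> ^ i" if "x \<noteq> 0" for x
    using z(2) that by blast
  with z(1) have "prim_field p n \<zeta>"
    using assms by unfold_locales
  then show ?thesis ..
qed

section \<open>Additive maps of order p^n - 1\<close>

context prim_field
begin

lemma additive_of_nat_mult:
  assumes "additive (f :: 'k \<Rightarrow> 'k)"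
  shows "f (of_nat m * x) = of_nat m * f x"
  by (induction m) (auto simp: additive.zero[OF assms] additive.add[OF assms] distrib_right)

lemma frob_inj: "inj (\<lambda>x :: 'k. x ^ p)"
proof (rule injI)
  fix x y :: 'k assume "x ^ p = y ^ p"
  then have "(x - y) ^ p = 0"
    using frob_diff[of x y 1] by simp
  then show "x = y" by simp
qed

lemma map_poly_frob_mult:
  "map_poly (\<lambda>x. x ^ p) (f * g :: 'k poly) = map_poly (\<lambda>x. x ^ p) f * map_poly (\<lambda>x. x ^ p) g"
proof (rule poly_eqI)
  have p0: "(0 :: 'k) ^ p = 0"
    using p_gt_1 by simp
  fix i
  show "poly.coeff (map_poly (\<lambda>x. x ^ p) (f * g)) i
      = poly.coeff (map_poly (\<lambda>x. x ^ p) f * map_poly (\<lambda>x. x ^ p) g) i"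
    by (simp add: coeff_map_poly p0 coeff_mult power_mult_distrib frob_sum[where m = 1, simplified])
qed

text \<open>Frobenius on the coefficients replaces the root \<open>e\<close> of a linear factor by
  \<open>e ^ p\<close>. On the finite set \<open>S\<close> this map is injective, hence a
  permutation, so the product does not change.\<close>

lemma coeff_root_product:
  assumes "\<And>e. e \<in> S \<Longrightarrow> (e :: 'k) ^ p \<in> S"
  shows "poly.coeff (\<Prod>e\<in>S. [:- e, 1:]) i ^ p = poly.coeff (\<Prod>e\<in>S. [:- e, 1:]) i"
proof -
  have p0: "(0 :: 'k) ^ p = 0" and p1: "(1 :: 'k) ^ p = 1"
    using p_gt_1 by simp_all
  have map: "map_poly (\<lambda>x. x ^ p) (\<Prod>e\<in>A. [:- e, 1:]) = (\<Prod>e\<in>A. [:- (e ^ p), 1:])" for A :: "'k set"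
  proof (induction A rule: infinite_finite_induct)
    case (insert e A)
    have "map_poly (\<lambda>x. x ^ p) [:- e, 1:] = [:- (e ^ p), 1:]"
      using frob_minus[of e 1] by (simp add: map_poly_pCons p0)
    then show ?case
      by (simp only: prod.insert[OF insert(1,2)] map_poly_frob_mult insert(3))
  qed (simp_all add: map_poly_1 p1)
  have "(\<lambda>x. x ^ p) ` S = S"
    by (rule endo_inj_surj) (use assms frob_inj in \<open>auto intro: inj_on_subset\<close>)
  then have "(\<Prod>e\<in>S. [:- e, 1:]) = (\<Prod>e\<in>(\<lambda>x. x ^ p) ` S. [:- e, 1:])"
    by simp
  also have "\<dots> = (\<Prod>e\<in>S. [:- (e ^ p), 1:])"
    by (subst prod.reindex) (use frob_inj in \<open>auto intro: inj_on_subset\<close>)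
  finally have "(\<Prod>e\<in>S. [:- e, 1:]) = map_poly (\<lambda>x. x ^ p) (\<Prod>e\<in>S. [:- e, 1:])"
    unfolding map .
  then have "poly.coeff (\<Prod>e\<in>S. [:- e, 1:]) i = poly.coeff (map_poly (\<lambda>x. x ^ p) (\<Prod>e\<in>S. [:- e, 1:])) i"
    by simp
  then show ?thesis
    by (simp add: coeff_map_poly p0)
qed

lemma sum_inverse_powers:
  "(\<Sum>u\<in>UNIV-{0::'k}. inverse u ^ m) = (if p ^ n - 1 dvd m then - 1 else 0)"
  unfolding sum_powers[symmetric]
  by (rule sum.reindex_bij_witness[of _ inverse inverse]) auto

text \<open>
  \<open>T\<close> is diagonalised by additive maps \<open>\<pi>\<close> with \<open>\<pi> (T v) = z * \<pi> v\<close>. The set \<open>supp v\<close> of the \<open>z\<close>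
  seen by \<open>v\<close> is closed under \<open>z \<mapsto> z ^ p\<close>, so the polynomial with roots \<open>supp v\<close> has coefficients
  in the prime field and can be evaluated at \<open>T\<close>; this allows enlarging \<open>supp v\<close> until \<open>v\<close> has
  a regular orbit.
\<close>

lemma singer_cycle:
  fixes T :: "'k \<Rightarrow> 'k"
  assumes add: "additive T"
    and T_id: "T ^^ (p ^ n - 1) = id"
    and T_neq: "\<And>j. 0 < j \<Longrightarrow> j < p ^ n - 1 \<Longrightarrow> T ^^ j \<noteq> id"
    and N1: "p ^ n - 1 > 1"
  shows "\<exists>\<pi> (z :: 'k). bij \<pi> \<and> additive \<pi> \<and> (\<forall>v. \<pi> (T v) = z * \<pi> v) \<and> prim_field p n z"
proof -
  define N where "N = p ^ n - 1"
  have N_card: "N = card (UNIV - {0 :: 'k})"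
    using card_k by (simp add: N_def)
  define eig where "eig z \<pi> \<longleftrightarrow> additive \<pi> \<and> (\<forall>v. \<pi> (T v) = z * \<pi> v)" for z and \<pi> :: "'k \<Rightarrow> 'k"
  define supp where "supp v = {z. \<exists>\<pi>. eig z \<pi> \<and> \<pi> v \<noteq> 0}" for v
  have add_pow: "additive (T ^^ i)" for i
  proof (induction i)
    case (Suc i)
    then show ?case
      using add by (simp add: additive_def)
  qed (simp add: additive_def)
  have eig_pow: "\<pi> ((T ^^ i) v) = z ^ i * \<pi> v" if "eig z \<pi>" for z \<pi> i v
    using that by (induction i) (auto simp: eig_def)
  have supp_ne: "supp v \<noteq> {}" if "v \<noteq> 0" for v
  proof
    assume empty: "supp v = {}"
    \<comment> \<open>Twisted orbit sums: since \<open>inverse z ^ N\<close> and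
      \<open>T ^^ N\<close> are trivial, shifting the index by one only multiplies the sum by
      \<open>z\<close>, which makes \<open>\<pi> z\<close> an eigenfunctional.\<close>
    define \<pi> where "\<pi> z w = (\<Sum>i<N. inverse z ^ i * (T ^^ i) w)" for z w
    have eig: "eig z (\<pi> z)" if "z \<noteq> 0" for z
      unfolding eig_def
    proof (intro conjI allI)
      show "additive (\<pi> z)"
        using add_pow by (auto simp: additive_def \<pi>_def sum.distrib algebra_simps)
      fix w
      define g where "g i = inverse z ^ i * (T ^^ i) w" for i
      have zN: "inverse z ^ N = 1"
        using power_card_minus_1[of "inverse z"] that card_k by (simp add: N_def)
      have "\<pi> z (T w) = (\<Sum>i<N. z * g (Suc i))"
        using that unfolding \<pi>_def g_def by (intro sum.cong) (auto simp: funpow_swap1)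
      also have "\<dots> = z * (\<Sum>i<N. g (Suc i))"
        by (simp add: sum_distrib_left)
      also have "(\<Sum>i<N. g (Suc i)) = (\<Sum>i<Suc N. g i) - g 0"
        by (simp only: sum.lessThan_Suc_shift) simp
      also have "\<dots> = (\<Sum>i<N. g i)"
        using T_id zN by (simp add: g_def N_def)
      finally show "\<pi> z (T w) = z * \<pi> z w"
        by (simp add: \<pi>_def g_def)
    qed
    \<comment> \<open>Orthogonality in \<open>z\<close> kills all terms but \<open>i = 0\<close>, so
      the projections of \<open>v\<close> add up to \<open>- v\<close> and cannot all
      vanish.\<close>
    have "0 = (\<Sum>z\<in>UNIV-{0}. \<pi> z v)"
      using empty eig by (intro sum.neutral[symmetric]) (auto simp: supp_def)
    also have "\<dots> = (\<Sum>i<N. (\<Sum>z\<in>UNIV-{0}. inverse z ^ i) * (T ^^ i) v)"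
      unfolding \<pi>_def by (subst sum.swap) (simp add: sum_distrib_right)
    also have "\<dots> = (\<Sum>i\<in>{0}. (\<Sum>z\<in>UNIV-{0}. inverse z ^ i) * (T ^^ i) v)"
    proof (intro sum.mono_neutral_right ballI)
      fix i assume "i \<in> {..<N} - {0}"
      then show "(\<Sum>z\<in>UNIV-{0}. inverse z ^ i) * (T ^^ i) v = 0"
        by (auto simp: sum_inverse_powers N_def dest: dvd_imp_le)
    qed (use N1 in \<open>auto simp: N_def\<close>)
    also have "\<dots> = - v"
      by (subst sum_inverse_powers) simp
    finally show False
      using that by simp
  qed
  have supp_frob: "z ^ p \<in> supp v" if "z \<in> supp v" for z v
  proof -
    from that obtain \<pi> where \<pi>: "eig z \<pi>" "\<pi> v \<noteq> 0"
      by (auto simp: supp_def)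
    have "eig (z ^ p) (\<lambda>w. \<pi> w ^ p)"
      using \<pi>(1) frob_add[where m = 1] by (auto simp: eig_def additive_def power_mult_distrib)
    then show ?thesis
      using \<pi>(2) unfolding supp_def by auto
  qed
  obtain v where v_max: "\<And>w. card (supp w) \<le> card (supp v)"
  proof -
    have "finite (range (\<lambda>w. card (supp w)))" by simp
    then have "Max (range (\<lambda>w. card (supp w))) \<in> range (\<lambda>w. card (supp w))"
      by (intro Max_in) auto
    then obtain v where "Max (range (\<lambda>w. card (supp w))) = card (supp v)"
      by blast
    then have "card (supp w) \<le> card (supp v)" for w
      by (metis Max_ge \<open>finite (range (\<lambda>w. card (supp w)))\<close> rangeI)
    then show thesis using that by blast
  qed
  have supp_sub: "supp w \<subseteq> supp v" for w
  proof (rule ccontr)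
    assume "\<not> supp w \<subseteq> supp v"
    then obtain z where z: "z \<in> supp w" "z \<notin> supp v" by blast
    \<comment> \<open>Applying \<open>f\<close> to \<open>T\<close> removes from \<open>w\<close>
      whatever \<open>v\<close> sees already and keeps the component at \<open>z\<close>; hence
      \<open>v + w'\<close> sees \<open>z\<close> in addition to all of
      \<open>supp v\<close>.\<close>
    define f where "f = (\<Prod>e\<in>supp v. [:- e, 1:])"
    define w' where "w' = (\<Sum>i\<le>Polynomial.degree f. poly.coeff f i * (T ^^ i) w)"
    have eig_w': "\<pi> w' = poly f e * \<pi> w" if "eig e \<pi>" for e \<pi>
    proof -
      have ad: "additive \<pi>" using that by (simp add: eig_def)
      have coeff: "\<pi> (poly.coeff f i * x) = poly.coeff f i * \<pi> x" for i x
      proof -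
        have "poly.coeff f i ^ p = poly.coeff f i"
          unfolding f_def by (intro coeff_root_product supp_frob)
        then obtain m where "poly.coeff f i = of_nat m"
          using prime_subfield by blast
        then show ?thesis
          using additive_of_nat_mult[OF ad] by simp
      qed
      show ?thesis
        unfolding w'_def additive.sum[OF ad] coeff eig_pow[OF that] poly_altdef
        by (simp add: sum_distrib_right mult.assoc)
    qed
    have root: "poly f e = 0 \<longleftrightarrow> e \<in> supp v" for e
      by (auto simp: f_def poly_prod)
    have "insert z (supp v) \<subseteq> supp (v + w')"
    proof
      fix e assume "e \<in> insert z (supp v)"
      then consider "e = z" | "e \<in> supp v" by blast
      then show "e \<in> supp (v + w')"
      proof cases
        case 1
        obtain \<pi> where \<pi>: "eig z \<pi>" "\<pi> w \<noteq> 0" using z by (auto simp: supp_def)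
        have "\<pi> v = 0" using \<pi> z by (auto simp: supp_def)
        moreover have "\<pi> w' \<noteq> 0" using eig_w'[OF \<pi>(1)] \<pi>(2) root z by auto
        ultimately have "\<pi> (v + w') \<noteq> 0"
          using \<pi>(1) by (simp add: eig_def additive.add)
        then show ?thesis using \<pi>(1) 1 by (auto simp: supp_def)
      next
        case 2
        obtain \<pi> where \<pi>: "eig e \<pi>" "\<pi> v \<noteq> 0" using 2 by (auto simp: supp_def)
        have "\<pi> w' = 0" using eig_w'[OF \<pi>(1)] root 2 by auto
        then have "\<pi> (v + w') \<noteq> 0"
          using \<pi> by (simp add: eig_def additive.add)
        then show ?thesis using \<pi>(1) by (auto simp: supp_def)
      qed
    qed
    then have "card (insert z (supp v)) \<le> card (supp (v + w'))"
      by (intro card_mono) auto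
    also have "\<dots> \<le> card (supp v)" by (rule v_max)
    finally show False using z(2) by simp
  qed
  \<comment> \<open>If \<open>T ^^ j\<close> fixes \<open>v\<close>, then \<open>z ^ j = 1\<close>
    for all \<open>z\<close> in \<open>supp v\<close>; every support lies in \<open>supp v\<close>,
    so \<open>T ^^ j\<close> would be the identity.\<close>
  have regular: "(T ^^ j) v \<noteq> v" if "0 < j" "j < N" for j
  proof
    assume fixed: "(T ^^ j) v = v"
    have "(T ^^ j) w = w" for w
    proof -
      have "\<pi> ((T ^^ j) w - w) = 0" if "eig z \<pi>" for z \<pi>
      proof (cases "\<pi> w = 0")
        case True
        then show ?thesis
          using eig_pow[OF that] that by (simp add: eig_def additive.diff)
      next
        case False
        then have "z \<in> supp v" using that supp_sub by (auto simp: supp_def)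
        then obtain \<pi>' where \<pi>': "eig z \<pi>'" "\<pi>' v \<noteq> 0" by (auto simp: supp_def)
        then have "z ^ j = 1"
          using eig_pow[OF \<pi>'(1), of j v] fixed by simp
        then show ?thesis
          using eig_pow[OF that] that by (simp add: eig_def additive.diff)
      qed
      then have "supp ((T ^^ j) w - w) = {}" by (auto simp: supp_def)
      then show ?thesis using supp_ne[of "(T ^^ j) w - w"] by auto
    qed
    then have "T ^^ j = id" by auto
    then show False using T_neq that by (simp add: N_def)
  qed
  have v0: "v \<noteq> 0"
    using regular[of 1] N1 additive.zero[OF add] by (auto simp: N_def)
  have TN: "(T ^^ N) w = w" for w
    using T_id by (simp add: N_def)
  have inj: "inj_on (\<lambda>i. (T ^^ i) v) {..<N}"
  proof (rule linorder_inj_onI)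
    fix i j :: nat assume ij: "i < j" "i \<in> {..<N}" "j \<in> {..<N}"
    show "(T ^^ i) v \<noteq> (T ^^ j) v"
    proof
      assume "(T ^^ i) v = (T ^^ j) v"
      then have "(T ^^ (N - i)) ((T ^^ i) v) = (T ^^ (N - i)) ((T ^^ j) v)" by simp
      then have "(T ^^ (N - i + i)) v = (T ^^ (N - i + j)) v"
        by (simp only: funpow_add comp_def)
      then have "v = (T ^^ ((j - i) + N)) v"
        using ij TN by (simp add: add.commute)
      then have "v = (T ^^ (j - i)) v"
        by (simp only: funpow_add comp_def TN)
      moreover have "j - i < N" using ij by (simp add: less_imp_diff_less)
      ultimately show False using regular[of "j - i"] ij(1) by auto
    qed
  qed auto
  have nz: "(T ^^ i) v \<noteq> 0" if "i < N" for i
  proof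
    assume "(T ^^ i) v = 0"
    then have "(T ^^ (N - i)) ((T ^^ i) v) = 0"
      using additive.zero[OF add_pow] by simp
    then have "(T ^^ (N - i + i)) v = 0"
      by (simp only: funpow_add comp_def)
    then show False using that TN v0 by simp
  qed
  \<comment> \<open>The orbit of \<open>v\<close> consists of \<open>N\<close> distinct nonzero
    elements, which are all there are; any eigenfunctional that does not vanish at \<open>v\<close>
    is therefore injective.\<close>
  have "(\<lambda>i. (T ^^ i) v) ` {..<N} = UNIV - {0}"
    by (rule card_seteq) (use nz in \<open>auto simp: card_image[OF inj] N_card[symmetric]\<close>)
  then have trans: "\<exists>i. x = (T ^^ i) v" if "x \<noteq> 0" for x
    using that by blast
  obtain z \<pi> where \<pi>: "eig z \<pi>" "\<pi> v \<noteq> 0"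
    using supp_ne[OF v0] by (auto simp: supp_def)
  have "z ^ N = 1"
    using eig_pow[OF \<pi>(1), of N v] TN \<pi>(2) by simp
  then have z0: "z \<noteq> 0"
    using N1 by (auto simp: N_def power_0_left split: if_splits)
  have ad: "additive \<pi>" using \<pi>(1) by (simp add: eig_def)
  have ker: "x = 0" if "\<pi> x = 0" for x
  proof (rule ccontr)
    assume "x \<noteq> 0"
    then obtain i where "x = (T ^^ i) v"
      using trans by blast
    then show False
      using that eig_pow[OF \<pi>(1)] \<pi>(2) z0 by simp
  qed
  have "inj \<pi>"
    using ker additive.diff[OF ad] by (metis injI right_minus_eq)
  then have bij: "bij \<pi>"
    by (simp add: bij_def finite_UNIV_inj_surj)
  \<comment> \<open>Transitivity carries over to scalars: writing \<open>x * \<pi> v\<close> as the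
    value of \<open>\<pi>\<close> at some \<open>(T ^^ i) v\<close> gives
    \<open>x = z ^ i\<close>.\<close>
  have "prim_field p n z"
  proof
    fix x :: 'k assume "x \<noteq> 0"
    obtain y where y: "x * \<pi> v = \<pi> y"
      using bij by (metis bij_pointE)
    then have "y \<noteq> 0"
      using \<open>x \<noteq> 0\<close> \<pi>(2) additive.zero[OF ad] by auto
    then obtain i where "y = (T ^^ i) v"
      using trans by blast
    then show "\<exists>i. x = z ^ i"
      using y eig_pow[OF \<pi>(1)] \<pi>(2) by auto
  qed (use prime_p card_k z0 in auto)
  with bij ad \<pi>(1) show ?thesis
    unfolding eig_def by blast
qed

end

text \<open>A finite subring is a subfield, since inverses are powers. For \<open>t\<close> outside
  \<open>M\<close> the elements 1 and \<open>t\<close> are then independent over \<open>M\<close>,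
  and pairs from \<open>M\<close> embed into the field.\<close>

lemma (in prim_field) proper_subring_card:
  fixes M :: "'k set"
  assumes "1 \<in> M" "\<And>x y. x \<in> M \<Longrightarrow> y \<in> M \<Longrightarrow> x - y \<in> M" "\<And>x y. x \<in> M \<Longrightarrow> y \<in> M \<Longrightarrow> x * y \<in> M"
    and "M \<noteq> UNIV"
  shows "card M * card M \<le> p ^ n"
proof -
  obtain t where t: "t \<notin> M" using assms(4) by blast
  have pow: "x ^ i \<in> M" if "x \<in> M" for x i
    using that assms(1,3) by (induction i) auto
  have inv: "inverse x \<in> M" if "x \<in> M" for x
  proof (cases "x = 0")
    case False
    have "x * x ^ (p ^ n - 2) = x ^ (p ^ n - 1)"
      using card_gt_1 card_k by (metis Suc_diff_Suc Suc_1 power_Suc)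
    then have "inverse x = x ^ (p ^ n - 2)"
      using power_card_minus_1[OF False] card_k by (simp add: inverse_unique)
    then show ?thesis using pow[OF that] by simp
  qed (use that in simp)
  have "inj_on (\<lambda>(c, d). c + d * t) (M \<times> M)"
  proof (rule inj_onI, clarify)
    fix c d c' d' assume M: "c \<in> M" "d \<in> M" "c' \<in> M" "d' \<in> M" and eq: "c + d * t = c' + d' * t"
    have "d = d'"
    proof (rule ccontr)
      assume "d \<noteq> d'"
      then have "t = (c' - c) * inverse (d - d')"
        using eq by (simp add: field_simps)
      then show False using t assms(2,3) inv M by metis
    qed
    then show "c = c' \<and> d = d'" using eq by simp
  qed
  then have "card (M \<times> M) \<le> CARD('k)"
    by (metis card_image card_mono finite_class.finite_UNIV top_greatest)
  then show ?thesis by (simp add: card_cartesian_product card_k)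
qed

section \<open>The field with q^2 elements and biadditive forms on it\<close>

locale unitary_field = prim_field p "2 * a" \<zeta> for p a :: nat and \<zeta> :: "'k :: {field, finite}" +
  fixes q :: nat
  assumes a_pos: "a > 0" and q_def: "q = p ^ a"
begin

lemma q_gt_1: "q > 1"
  using one_less_power[OF p_gt_1 a_pos] by (simp add: q_def)

lemma q_squared: "p ^ (2 * a) = q * q"
  by (simp add: q_def power_add[symmetric] mult_2)

lemma q_squared_minus_1: "p ^ (2 * a) - 1 = (q + 1) * (q - 1)"
  unfolding q_squared by (cases q) auto

lemmas q_add = frob_add[of _ _ a, folded q_def]
  and q_minus = frob_minus[of _ a, folded q_def]
  and q_diff = frob_diff[of _ _ a, folded q_def]

lemma q_q: "((x :: 'k) ^ q) ^ q = x"
  using power_card[of x] q_squared by (simp add: power_mult)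

text \<open>From \<open>c ^ (q - 1) = 1\<close> it follows that \<open>q + 1\<close> divides the
  exponent of \<open>c\<close> as a power of \<open>\<zeta>\<close>. So every nonzero
  \<open>c\<close> in the subfield of order \<open>q\<close> is a norm, namely that of
  \<open>\<zeta> ^ j\<close>.\<close>

lemma norm_surj:
  fixes c :: 'k
  assumes "c ^ q = c" "c \<noteq> 0"
  obtains j where "c = (\<zeta> ^ (q + 1)) ^ j"
proof -
  obtain i where i: "c = \<zeta> ^ i" using zeta_gen assms(2) by blast
  have "c ^ (q - 1) * c = c"
    using assms(1) q_gt_1 by (metis Suc_diff_1 less_trans power_Suc2 zero_less_one)
  then have "c ^ (q - 1) = 1"
    using assms(2) by simp
  then have "\<zeta> ^ (i * (q - 1)) = 1"
    by (simp add: i power_mult)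
  then have "(q + 1) * (q - 1) dvd i * (q - 1)"
    using zeta_power_eq_1_iff q_squared_minus_1 by simp
  then have "q + 1 dvd i"
    using q_gt_1 dvd_times_right_cancel_iff[of "q - 1" "q + 1" i] by simp
  then obtain j where "i = (q + 1) * j" ..
  then show ?thesis using that[of j] i unfolding power_mult[symmetric] by simp
qed

text \<open>The multipliers of \<open>K\<close> form a subring \<open>M\<close> that contains
  \<open>\<eta>\<close>. If \<open>M\<close> were proper it would have at most \<open>q - 1\<close>
  nonzero elements, so two of the first \<open>q\<close> powers of \<open>\<eta>\<close> would agree
  and \<open>\<eta> ^ d = 1\<close> with \<open>0 < d < q\<close>. But
  \<open>(p ^ j + 1) * d\<close> is smaller than the order \<open>(q + 1) * (q - 1)\<close> of
  \<open>\<zeta>\<close>; this estimate is where \<open>j < a\<close> enters.\<close>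

lemma subspace_trivial:
  fixes K :: "'k set"
  assumes diff: "\<And>x y. x \<in> K \<Longrightarrow> y \<in> K \<Longrightarrow> x - y \<in> K"
    and mul: "\<And>x. x \<in> K \<Longrightarrow> \<zeta> ^ (p ^ j + 1) * x \<in> K"
    and j: "j < a" and x: "x \<in> K" "x \<noteq> 0"
  shows "K = UNIV"
proof -
  define M where "M = {c. \<forall>y\<in>K. c * y \<in> K}"
  have M1: "1 \<in> M" by (simp add: M_def)
  have Md: "c - d \<in> M" if "c \<in> M" "d \<in> M" for c d
    using that diff by (auto simp: M_def left_diff_distrib)
  have Mm: "c * d \<in> M" if "c \<in> M" "d \<in> M" for c d
    using that by (auto simp: M_def mult.assoc)
  define \<eta> where "\<eta> = \<zeta> ^ (p ^ j + 1)"
  have pow: "\<eta> ^ i \<in> M" for i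
  proof (induction i)
    case (Suc i)
    moreover have "\<eta> \<in> M" using mul by (simp add: M_def \<eta>_def)
    ultimately show ?case using Mm by simp
  qed (simp add: M1)
  have "M = UNIV"
  proof (rule ccontr)
    assume "M \<noteq> UNIV"
    then have "card M * card M \<le> q * q"
      using proper_subring_card[OF M1 Md Mm] q_squared by simp
    then have "card M \<le> q"
      using power2_nat_le_eq_le by (metis power2_eq_square)
    have "0 \<in> M" using Md[OF M1 M1] by simp
    then have "card (M - {0}) = card M - 1" by simp
    then have "card (M - {0}) < card {..<q}"
      using \<open>card M \<le> q\<close> q_gt_1 by simp
    moreover have "(\<lambda>i. \<eta> ^ i) ` {..<q} \<subseteq> M - {0}"
      using pow zeta_nz by (auto simp: \<eta>_def)
    ultimately have "\<not> inj_on (\<lambda>i. \<eta> ^ i) {..<q}"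
      by (meson card_inj_on_le finite leD)
    then obtain s t where st: "s < t" "t < q" "\<eta> ^ s = \<eta> ^ t"
      by (metis lessThan_iff linorder_inj_onI linear)
    define d where "d = t - s"
    have "\<eta> ^ s * \<eta> ^ d = \<eta> ^ s * 1"
      unfolding d_def power_add[symmetric] using st by simp
    then have "\<zeta> ^ ((p ^ j + 1) * d) = 1"
      using zeta_nz unfolding power_mult \<eta>_def by simp
    then have "(q + 1) * (q - 1) dvd (p ^ j + 1) * d"
      using zeta_power_eq_1_iff q_squared_minus_1 by simp
    then have "(q + 1) * (q - 1) \<le> (p ^ j + 1) * d"
      using st by (intro dvd_imp_le) (auto simp: d_def)
    moreover have "(p ^ j + 1) * d < (q + 1) * (q - 1)"
    proof (rule mult_less_le_imp_less)
      show "p ^ j + 1 < q + 1"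
        using j p_gt_1 by (simp add: q_def)
    qed (use st in \<open>auto simp: d_def\<close>)
    ultimately show False by simp
  qed
  then have "y / x * x \<in> K" for y
    using x(1) unfolding M_def by blast
  then show ?thesis using x(2) by auto
qed

text \<open>
  \<open>C i\<close> is, up to sign, the component of \<open>B\<close> satisfying \<open>C i (w * x) y = C i x (w ^ p ^ i * y)\<close>. The kernel
  of \<open>C i 1\<close> is stable under \<open>\<zeta> ^ (p ^ i + 1)\<close>, which lies in no proper subfield unless \<open>i = a\<close>;
  so \<open>C i\<close> vanishes, or else \<open>C i 1\<close> embeds the field into \<open>S\<close>.
\<close>

lemma biadditive_adjoint:
  fixes B :: "'k \<Rightarrow> 'k \<Rightarrow> 'k"
  assumes addl: "\<And>y. additive (\<lambda>x. B x y)" and addr: "\<And>x. additive (B x)"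
    and S: "\<And>x y. B x y \<in> S" "0 \<in> S" "\<And>x y. x \<in> S \<Longrightarrow> y \<in> S \<Longrightarrow> x + y \<in> S" "card S < p ^ (2 * a)"
    and \<Phi>: "\<And>x y. x \<in> S \<Longrightarrow> y \<in> S \<Longrightarrow> \<Phi> (x + y) = \<Phi> x + \<Phi> y" "\<And>x y. \<Phi> (B x y) = B (\<zeta> * x) (\<zeta> * y)"
  shows "B (w * x) y = B x (w ^ q * y)"
proof -
  \<comment> \<open>Averaging over the units: the substitution of \<open>u * w\<close> for
    \<open>u\<close> moves a scalar \<open>w\<close> from the first argument to the second, as
    \<open>w ^ p ^ i\<close>.\<close>
  define C where "C i x y = (\<Sum>u\<in>UNIV-{0}. B (u * x) (inverse u ^ p ^ i * y))" for i x y
  have C_move: "C i (w * x) y = C i x (w ^ p ^ i * y)" if "w \<noteq> 0" for i w x y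
    unfolding C_def
    by (rule sum.reindex_bij_witness[of _ "\<lambda>v. v / w" "\<lambda>u. u * w"])
       (use that in \<open>auto simp: power_mult_distrib mult_ac field_simps\<close>)
  \<comment> \<open>\<open>\<Phi>\<close> is additive on \<open>S\<close> only, so all partial sums
    must be known to lie in \<open>S\<close> before \<open>\<Phi>\<close> may be applied
    termwise.\<close>
  have sum_S: "(\<Sum>u\<in>A. B (f u) (g u)) \<in> S" for A :: "'k set" and f g
    by (induction A rule: infinite_finite_induct) (use S in auto)
  have C_S: "C i x y \<in> S" for i x y
    using sum_S by (simp add: C_def)
  have \<Phi>_0: "\<Phi> 0 = 0"
    using \<Phi>(2)[of 0 0] additive.zero[OF addr] by simp
  have \<Phi>_sum: "\<Phi> (\<Sum>u\<in>A. B (f u) (g u)) = (\<Sum>u\<in>A. \<Phi> (B (f u) (g u)))" for A :: "'k set" and f g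
    by (induction A rule: infinite_finite_induct) (use S(1) sum_S \<Phi>(1) \<Phi>_0 in auto)
  have C_add: "additive (C i x)" for i x
    using addr by (auto simp: additive_def C_def distrib_left sum.distrib)
  have C_\<Phi>: "\<Phi> (C i x y) = C i (\<zeta> * x) (\<zeta> * y)" for i x y
    unfolding C_def \<Phi>_sum \<Phi>(2) by (simp add: mult_ac)
  have C_0: "C i x y = 0" if i: "i < 2 * a" "i \<noteq> a" and "x \<noteq> 0" for i x y
  proof -
    define K where "K = {y. C i 1 y = 0}"
    have diff: "x - y \<in> K" if "x \<in> K" "y \<in> K" for x y
      using that by (simp add: K_def additive.diff[OF C_add])
    have mul1: "\<zeta> ^ (p ^ i + 1) * y \<in> K" if "y \<in> K" for y
    proof -
      have "C i 1 (\<zeta> ^ (p ^ i + 1) * y) = C i (\<zeta> * 1) (\<zeta> * y)"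
        by (subst C_move[OF zeta_nz]) (simp add: mult_ac)
      also have "\<dots> = \<Phi> (C i 1 y)" by (simp add: C_\<Phi>)
      also have "\<dots> = 0" using that \<Phi>_0 by (simp add: K_def)
      finally show ?thesis by (simp add: K_def)
    qed
    have pow: "(\<zeta> ^ (p ^ i + 1)) ^ m * y \<in> K" if "y \<in> K" for y m
      using that by (induction m) (use mul1 in \<open>simp_all add: mult.assoc\<close>)
    \<comment> \<open>For \<open>i > a\<close> the multiplier is raised to the power
      \<open>p ^ (2 * a - i)\<close>. As \<open>x ^ p ^ (2 * a) = x\<close>, this exchanges the two
      summands of the exponent and leads to \<open>j = 2 * a - i\<close>.\<close>
    obtain j where j: "j < a" "\<And>y. y \<in> K \<Longrightarrow> \<zeta> ^ (p ^ j + 1) * y \<in> K"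
    proof (cases "i < a")
      case True
      then show ?thesis using that mul1 by blast
    next
      case False
      have "(\<zeta> ^ (p ^ i + 1)) ^ p ^ (2 * a - i) = \<zeta> ^ p ^ (i + (2 * a - i)) * \<zeta> ^ p ^ (2 * a - i)"
        by (simp add: power_add power_mult_distrib flip: power_mult)
      also have "\<dots> = \<zeta> ^ (p ^ (2 * a - i) + 1)"
        using i power_card[of \<zeta>] by (simp add: mult_ac)
      finally show ?thesis
        using that[of "2 * a - i"] pow[of _ "p ^ (2 * a - i)"] i False by auto
    qed
    have "K = UNIV"
    proof (rule ccontr)
      assume "K \<noteq> UNIV"
      then have ker: "y = 0" if "y \<in> K" for y
        using subspace_trivial[OF diff j(2) j(1) that] by blast
      have "inj (C i 1)"
      proof (rule injI)
        fix y z assume "C i 1 y = C i 1 z"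
        then have "y - z \<in> K"
          by (simp add: K_def additive.diff[OF C_add])
        then show "y = z" using ker[of "y - z"] by simp
      qed
      then have "CARD('k) \<le> card S"
        using C_S by (intro card_inj_on_le) auto
      then show False using S(4) card_k by simp
    qed
    then have "C i 1 (x ^ p ^ i * y) = 0" by (auto simp: K_def)
    then show ?thesis using C_move[OF \<open>x \<noteq> 0\<close>, of i 1 y] by simp
  qed
  \<comment> \<open>Summation over \<open>i\<close> collects the conjugates of
    \<open>inverse u\<close> into their trace, which lies in the prime field and so moves across
    \<open>B\<close>. What remains is the scalar \<open>tr (inverse u) * u\<close> summed over
    \<open>u\<close>, which is -1.\<close>
  have C_sum: "(\<Sum>i<2*a. C i x y) = - B x y" for x y
  proof -
    define tr where "tr v = (\<Sum>i<2*a. v ^ p ^ i)" for v :: 'k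
    have tr_fix: "tr v ^ p = tr v" for v
    proof -
      have "tr v ^ p = (\<Sum>i<2*a. v ^ p ^ Suc i)"
        unfolding tr_def by (simp add: frob_sum[where m = 1, simplified] mult.commute flip: power_mult)
      also have "\<dots> = (\<Sum>i<Suc (2*a). v ^ p ^ i) - v ^ p ^ 0"
        by (simp only: sum.lessThan_Suc_shift) simp
      also have "\<dots> = tr v"
        using power_card[of v] by (simp add: tr_def)
      finally show ?thesis .
    qed
    have tr_move: "B x (tr v * y) = B (tr v * x) y" for v x y
    proof -
      obtain m where "tr v = of_nat m"
        using prime_subfield[OF tr_fix] by blast
      then show ?thesis
        using additive_of_nat_mult[OF addr] additive_of_nat_mult[OF addl] by simp
    qed
    have tr_sum: "(\<Sum>u\<in>UNIV-{0}. tr (inverse u) * u) = - 1"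
    proof -
      \<comment> \<open>The sum runs over the powers with exponent \<open>p ^ i - 1\<close>, which
        is below \<open>p ^ (2 * a) - 1\<close>; orthogonality leaves only
        \<open>i = 0\<close>.\<close>
      have inner: "(\<Sum>u\<in>UNIV-{0::'k}. inverse u ^ p ^ i * u) = (if i = 0 then - 1 else 0)"
        if "i < 2 * a" for i
      proof -
        have pi: "0 < p ^ i" using p_gt_1 by simp
        have "inverse u ^ p ^ i * u = inverse u ^ (p ^ i - 1)" if "u \<noteq> 0" for u :: 'k
        proof -
          have "inverse u ^ p ^ i = inverse u ^ (p ^ i - 1) * inverse u"
            using pi by (metis Suc_diff_1 power_Suc2)
          then show ?thesis using that by simp
        qed
        then have "(\<Sum>u\<in>UNIV-{0::'k}. inverse u ^ p ^ i * u) = (\<Sum>u\<in>UNIV-{0::'k}. inverse u ^ (p ^ i - 1))"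
          by (intro sum.cong) auto
        also have "\<dots> = (if i = 0 then - 1 else 0)"
        proof (cases "i = 0")
          case False
          then have "1 < p ^ i" using one_less_power[OF p_gt_1] by simp
          moreover have "p ^ i < p ^ (2 * a)" using that p_gt_1 by simp
          ultimately have "\<not> p ^ (2 * a) - 1 dvd p ^ i - 1"
            by (auto dest!: dvd_imp_le)
          then show ?thesis using False by (simp add: sum_inverse_powers)
        qed (simp add: sum_inverse_powers[of 0, simplified])
        finally show ?thesis .
      qed
      have "(\<Sum>u\<in>UNIV-{0}. tr (inverse u) * u) = (\<Sum>i<2*a. \<Sum>u\<in>UNIV-{0}. inverse u ^ p ^ i * u)"
        unfolding tr_def sum_distrib_right by (rule sum.swap)
      also have "\<dots> = (\<Sum>i<2*a. if i = 0 then - 1 else 0)"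
        by (intro sum.cong inner) auto
      also have "\<dots> = - 1"
        using a_pos by (simp add: sum.delta)
      finally show ?thesis .
    qed
    have "(\<Sum>i<2*a. C i x y) = (\<Sum>u\<in>UNIV-{0}. \<Sum>i<2*a. B (u * x) (inverse u ^ p ^ i * y))"
      unfolding C_def by (rule sum.swap)
    also have "\<dots> = (\<Sum>u\<in>UNIV-{0}. B (u * x) (tr (inverse u) * y))"
      by (simp add: tr_def sum_distrib_right additive.sum[OF addr])
    also have "\<dots> = (\<Sum>u\<in>UNIV-{0}. B (tr (inverse u) * u * x) y)"
      by (simp add: tr_move mult.assoc)
    also have "\<dots> = B (\<Sum>u\<in>UNIV-{0}. tr (inverse u) * u * x) y"
      by (simp add: additive.sum[OF addl])
    also have "(\<Sum>u\<in>UNIV-{0}. tr (inverse u) * u * x) = - x"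
      using tr_sum by (simp flip: sum_distrib_right)
    also have "B (- x) y = - B x y"
      by (rule additive.minus[OF addl])
    finally show ?thesis .
  qed
  have B_C: "B x y = - C a x y" if "x \<noteq> 0" for x y
  proof -
    have "(\<Sum>i<2*a. C i x y) = (\<Sum>i\<in>{a}. C i x y)"
      by (intro sum.mono_neutral_right) (use a_pos C_0 that in auto)
    then show ?thesis using C_sum[of x y] by (simp add: minus_equation_iff[of "B x y"])
  qed
  show ?thesis
  proof (cases "w = 0 \<or> x = 0")
    case True
    then show ?thesis
      using additive.zero[OF addl] additive.zero[OF addr] q_gt_1 by (auto simp: power_0_left)
  next
    case False
    then show ?thesis
      using B_C[of "w * x" y] B_C[of x "w ^ q * y"] C_move[of w a x y] by (simp add: q_def)
  qed
qed

text \<open>As \<open>B\<close> is alternating, \<open>B 1\<close> vanishes on norms, hence on the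
  subfield of order \<open>q\<close>. A zero \<open>y\<close> outside the subfield would bring its
  multiples by the subfield with it; 1 and \<open>y\<close> span the field over the subfield, so
  \<open>B 1\<close>, and then \<open>B\<close>, would be zero.\<close>

lemma alternating_kernel:
  fixes B :: "'k \<Rightarrow> 'k \<Rightarrow> 'k"
  assumes addr: "\<And>x. additive (B x)"
    and alt: "\<And>x. B x x = 0"
    and adj: "\<And>w x y. B (w * x) y = B x (w ^ q * y)"
    and nz: "B x0 y0 \<noteq> 0"
    and \<Phi>: "\<And>x y. \<Phi> (B x y) = B (\<zeta> * x) (\<zeta> * y)"
  shows "B 1 y = 0 \<longleftrightarrow> y ^ q = y"
proof
  have norm: "B 1 (w ^ q * w) = 0" for w
    using adj[of w 1 w] alt[of w] by simp
  show fixed: "B 1 y = 0" if y: "y ^ q = y" for y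
  proof (cases "y = 0")
    case False
    then obtain j where "y = (\<zeta> ^ (q + 1)) ^ j"
      using norm_surj[OF y False] by metis
    then have "y = (\<zeta> ^ j) ^ q * \<zeta> ^ j"
      by (simp add: mult.commute power_add power_mult_distrib flip: power_mult)
    then show ?thesis using norm by simp
  qed (use additive.zero[OF addr] in simp)
  assume y: "B 1 y = 0"
  show "y ^ q = y"
  proof (rule ccontr)
    assume yq: "y ^ q \<noteq> y"
    \<comment> \<open>\<open>\<Phi>\<close> sends 0 to 0, so a zero of \<open>B\<close> stays one
      when both arguments are multiplied by \<open>\<zeta>\<close>.\<close>
    have power_B: "B (\<zeta> ^ i) (\<zeta> ^ i * y) = 0" for i
    proof (induction i)
      case (Suc i)
      then show ?case
        using \<Phi>[of "\<zeta> ^ i" "\<zeta> ^ i * y"] \<Phi>[of 1 0] additive.zero[OF addr] by (simp add: mult.assoc)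
    qed (use y in simp)
    have mult_B: "B 1 (c * y) = 0" if c: "c ^ q = c" for c
    proof (cases "c = 0")
      case False
      then obtain j where "c = (\<zeta> ^ (q + 1)) ^ j"
        using norm_surj[OF c False] by metis
      then have "c = (\<zeta> ^ j) ^ q * \<zeta> ^ j"
        by (simp add: mult.commute power_add power_mult_distrib flip: power_mult)
      then have "B 1 (c * y) = B (\<zeta> ^ j) (\<zeta> ^ j * y)"
        using adj[of "\<zeta> ^ j" 1 "\<zeta> ^ j * y"] by (simp add: mult.assoc)
      then show ?thesis using power_B by simp
    qed (use additive.zero[OF addr] in simp)
    have "B 1 x = 0" for x
    proof -
      \<comment> \<open>The coordinates of \<open>x\<close> in the basis 1, \<open>y\<close> over
        the subfield: \<open>c = x - d * y\<close> is fixed by the \<open>q\<close>-th power exactly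
        if \<open>d * (y - y ^ q) = x - x ^ q\<close>, for a fixed \<open>d\<close>.\<close>
      define d where "d = (x - x ^ q) / (y - y ^ q)"
      define c where "c = x - d * y"
      have "d ^ q = (x ^ q - x) / (y ^ q - y)"
        by (simp add: d_def power_divide q_diff q_q)
      then have d: "d ^ q = d"
        unfolding d_def by (metis minus_diff_eq minus_divide_divide)
      have "d * (y - y ^ q) = x - x ^ q"
        using yq by (simp add: d_def)
      then have "c ^ q = c"
        by (simp add: c_def q_diff power_mult_distrib d algebra_simps)
      then have "B 1 (c + d * y) = 0"
        using fixed mult_B[OF d] by (simp add: additive.add[OF addr])
      then show ?thesis by (simp add: c_def)
    qed
    then show False
      using nz adj[of x0 1 y0] by simp
  qed
qed

end

section \<open>Semi-extraspecial groups\<close>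

text \<open>An orbit has as length a power of \<open>p\<close>, which is divisible by
  \<open>p\<close> unless the orbit is a single fixed point. It is applied to conjugation on a
  group, to conjugation on a normal subgroup, and to unitary matrices acting on isotropic
  vectors.\<close>

lemma p_group_fixed_points:
  assumes "group G" and order: "Coset.order G = p ^ n" and p: "Factorial_Ring.prime p" and fin: "finite E"
    and closed: "\<And>g x. g \<in> carrier G \<Longrightarrow> x \<in> E \<Longrightarrow> act g x \<in> E"
    and one: "\<And>x. x \<in> E \<Longrightarrow> act \<one>\<^bsub>G\<^esub> x = x"
    and mult: "\<And>g h x. g \<in> carrier G \<Longrightarrow> h \<in> carrier G \<Longrightarrow> x \<in> E \<Longrightarrow> act (g \<otimes>\<^bsub>G\<^esub> h) x = act g (act h x)"
  shows "[card {x \<in> E. \<forall>g\<in>carrier G. act g x = x} = card E] (mod p)"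
proof -
  interpret G: group G by fact
  define \<phi> where "\<phi> g = restrict (act g) E" for g
  have bij: "bij_betw (act g) E E" if g: "g \<in> carrier G" for g
  proof (rule bij_betw_byWitness[where f' = "act (inv\<^bsub>G\<^esub> g)"])
    show "\<forall>x\<in>E. act (inv\<^bsub>G\<^esub> g) (act g x) = x"
      using mult[symmetric] g one by simp
    show "\<forall>x\<in>E. act g (act (inv\<^bsub>G\<^esub> g) x) = x"
      using mult[symmetric] g one by simp
  qed (use g closed in auto)
  then have Bij: "\<phi> g \<in> Bij E" if "g \<in> carrier G" for g
    using that by (auto simp: \<phi>_def Bij_def)
  have "\<phi> \<in> hom G (BijGroup E)"
  proof (rule homI)
    fix g h assume gh: "g \<in> carrier G" "h \<in> carrier G"
    show "\<phi> (g \<otimes>\<^bsub>G\<^esub> h) = \<phi> g \<otimes>\<^bsub>BijGroup E\<^esub> \<phi> h"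
      using gh Bij closed mult by (auto simp: BijGroup_def compose_def \<phi>_def fun_eq_iff restrict_def)
  qed (use Bij in \<open>auto simp: BijGroup_def\<close>)
  then interpret A: group_action G E \<phi>
    by (simp add: group_action_def group_hom_def group_hom_axioms_def group_BijGroup)
  define F where "F = {x \<in> E. \<forall>g\<in>carrier G. act g x = x}"
  let ?O = "orbits G E \<phi>" and ?S = "(\<lambda>x. {x}) ` F"
  have orbit: "orbit G \<phi> x = (\<lambda>g. act g x) ` carrier G" if "x \<in> E" for x
    using that by (auto simp: orbit_def \<phi>_def)
  have S: "?S = {Ob \<in> ?O. card Ob = 1}"
  proof (intro equalityI subsetI)
    fix Ob assume "Ob \<in> ?S"
    then obtain x where x: "Ob = {x}" "x \<in> F" by blast
    have "orbit G \<phi> x = {x}"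
      using x(2) orbit[of x] by (auto simp: F_def image_iff)
    then show "Ob \<in> {Ob \<in> ?O. card Ob = 1}"
      using x by (auto simp: orbits_def F_def)
  next
    fix Ob assume "Ob \<in> {Ob \<in> ?O. card Ob = 1}"
    then obtain x where x: "x \<in> E" "Ob = orbit G \<phi> x" "card Ob = 1"
      by (auto simp: orbits_def)
    then obtain y where "(\<lambda>g. act g x) ` carrier G = {y}"
      using orbit card_1_singletonE by metis
    moreover have "x \<in> (\<lambda>g. act g x) ` carrier G"
      using one[OF x(1)] by force
    ultimately have Ob: "(\<lambda>g. act g x) ` carrier G = {x}" by simp
    then have "x \<in> F" using x(1) by (auto simp: F_def)
    then show "Ob \<in> ?S" using Ob x(2) orbit[OF x(1)] by simp
  qed
  have finO: "finite ?O"
  proof -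
    have "?O = orbit G \<phi> ` E" by (auto simp: orbits_def)
    then show ?thesis using fin by simp
  qed
  have "card E = (\<Sum>Ob\<in>?O. card Ob)"
    using A.disjoint_sum[OF fin, of "\<lambda>_. 1 :: nat"] by simp
  also have "\<dots> = (\<Sum>Ob\<in>?O - ?S. card Ob) + (\<Sum>Ob\<in>?S. card Ob)"
    by (rule sum.subset_diff) (use S finO in auto)
  also have "(\<Sum>Ob\<in>?S. card Ob) = card F"
    by (subst sum.reindex) (auto simp: inj_on_def)
  finally have "card E = (\<Sum>Ob\<in>?O - ?S. card Ob) + card F" .
  moreover have "p dvd (\<Sum>Ob\<in>?O - ?S. card Ob)"
  proof (rule dvd_sum)
    fix Ob assume Ob: "Ob \<in> ?O - ?S"
    then obtain x where x: "x \<in> E" "Ob = orbit G \<phi> x" by (auto simp: orbits_def)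
    have "card Ob dvd p ^ n"
      using A.orbit_stabilizer_theorem[OF x(1)] x(2) order by (metis dvd_triv_left)
    then obtain k where "card Ob = p ^ k" using p divides_primepow_nat by blast
    moreover have "card Ob \<noteq> 1" using Ob S by blast
    ultimately show "p dvd card Ob" by (cases k) auto
  qed
  ultimately show ?thesis
    unfolding F_def[symmetric] by (auto simp: cong_def elim!: dvdE)
qed

section \<open>Commutators, centres and p-groups\<close>

definition (in monoid) comm :: "'a \<Rightarrow> 'a \<Rightarrow> 'a" where
  "comm x y = x \<otimes> y \<otimes> inv x \<otimes> inv y"

context group
begin

lemma comm_closed [simp]: "x \<in> carrier G \<Longrightarrow> y \<in> carrier G \<Longrightarrow> comm x y \<in> carrier G"
  by (simp add: comm_def)

lemma comm_swap: "x \<in> carrier G \<Longrightarrow> y \<in> carrier G \<Longrightarrow> x \<otimes> y = comm x y \<otimes> y \<otimes> x"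
  by (simp add: comm_def m_assoc)

lemma comm_eq_one_iff:
  "x \<in> carrier G \<Longrightarrow> y \<in> carrier G \<Longrightarrow> comm x y = \<one> \<longleftrightarrow> x \<otimes> y = y \<otimes> x"
  using comm_swap[of x y] by (metis comm_closed l_one m_assoc m_closed r_cancel one_closed)

lemma center_iff: "z \<in> center G \<longleftrightarrow> z \<in> carrier G \<and> (\<forall>x\<in>carrier G. z \<otimes> x = x \<otimes> z)"
  by (simp add: center_def)

lemma center_carrier: "z \<in> center G \<Longrightarrow> z \<in> carrier G"
  by (simp add: center_def)

lemma center_commutes: "z \<in> center G \<Longrightarrow> x \<in> carrier G \<Longrightarrow> z \<otimes> x = x \<otimes> z"
  by (simp add: center_def)

lemma subgroup_center: "subgroup (center G) G"
proof (rule subgroupI)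
  show "center G \<subseteq> carrier G" "center G \<noteq> {}"
    by (auto simp: center_def)
  show "inv z \<in> center G" if "z \<in> center G" for z
    using that by (auto simp: center_def) (metis inv_closed inv_inv inv_mult_group)
  show "z \<otimes> w \<in> center G" if "z \<in> center G" "w \<in> center G" for z w
  proof -
    note zc = that
    have zw: "z \<in> carrier G" "w \<in> carrier G"
      using that by (simp_all add: center_carrier)
    have "z \<otimes> w \<otimes> x = x \<otimes> (z \<otimes> w)" if x: "x \<in> carrier G" for x
    proof -
      have "z \<otimes> w \<otimes> x = z \<otimes> (w \<otimes> x)"
        using zw x by (simp add: m_assoc)
      also have "\<dots> = z \<otimes> x \<otimes> w"
        using zw x center_commutes[OF zc(2) x] by (simp add: m_assoc)
      also have "\<dots> = x \<otimes> (z \<otimes> w)"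
        using zw x center_commutes[OF zc(1) x] by (simp add: m_assoc)
      finally show ?thesis .
    qed
    then show ?thesis using zw by (simp add: center_iff)
  qed
qed

lemma conj_eq_iff:
  assumes "g \<in> carrier G" "x \<in> carrier G"
  shows "g \<otimes> x \<otimes> inv g = x \<longleftrightarrow> x \<otimes> g = g \<otimes> x"
  using assms by (metis inv_solve_right' m_closed)

lemma normal_if_central:
  assumes "subgroup N G" "N \<subseteq> center G"
  shows "N \<lhd> G"
proof (rule normal_invI[OF assms(1)])
  fix x h assume "x \<in> carrier G" "h \<in> N"
  then show "x \<otimes> h \<otimes> inv x \<in> N"
    using assms(2) conj_eq_iff[of x h] center_commutes[of h x] center_carrier[of h] by auto
qed

text \<open>The fixed points of conjugation form the centre, so the order of the centre is divisible
  by \<open>p\<close>.\<close>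

lemma center_p_group_nontrivial:
  assumes "Coset.order G = p ^ n" "Factorial_Ring.prime p" "carrier G \<noteq> {\<one>}"
  shows "center G \<noteq> {\<one>}"
proof
  assume triv: "center G = {\<one>}"
  have fin: "finite (carrier G)"
    using assms(1,2) order_gt_0_iff_finite by (simp add: prime_gt_0_nat)
  have n: "n > 0"
  proof (rule ccontr)
    assume "\<not> n > 0"
    then have "card (carrier G) = 1" using assms(1) by (simp add: Coset.order_def)
    then show False using assms(3) by (metis card_1_singletonE one_closed singletonD)
  qed
  have "[card {x \<in> carrier G. \<forall>g\<in>carrier G. g \<otimes> x \<otimes> inv g = x} = card (carrier G)] (mod p)"
    by (rule p_group_fixed_points[OF is_group assms(1,2) fin]) (auto simp: inv_mult_group m_assoc)
  moreover have "{x \<in> carrier G. \<forall>g\<in>carrier G. g \<otimes> x \<otimes> inv g = x} = center G"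
    by (auto simp: center_def conj_eq_iff)
  ultimately have "[1 = p ^ n] (mod p)"
    using assms(1) triv by (simp add: Coset.order_def)
  then have "p dvd 1"
    using n by (metis cong_dvd_iff dvd_power dvd_refl)
  then show False using assms(2) by simp
qed

text \<open>The number of fixed points of conjugation on \<open>N\<close> is divisible by
  \<open>p\<close> and positive because of the identity, so it is all of \<open>p\<close>.\<close>

lemma normal_order_p_central:
  assumes "Coset.order G = p ^ n" "Factorial_Ring.prime p" "N \<lhd> G" "card N = p"
  shows "N \<subseteq> center G"
proof -
  interpret N: normal N G by fact
  have fin: "finite N" using assms(2,4) by (metis card.infinite not_prime_0)
  let ?F = "{x \<in> N. \<forall>g\<in>carrier G. g \<otimes> x \<otimes> inv g = x}"
  have "[card ?F = card N] (mod p)"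
    by (rule p_group_fixed_points[OF is_group assms(1,2) fin])
       (use N.inv_op_closed2 N.subset in \<open>auto simp: inv_mult_group m_assoc subset_iff\<close>)
  then have "p dvd card ?F"
    using assms(4) by (simp add: cong_def mod_eq_0_iff_dvd)
  moreover have "\<one> \<in> ?F" by simp
  then have "card ?F > 0" using fin by (metis (no_types, lifting) card_gt_0_iff empty_iff finite_Collect_conjI mem_Collect_eq finite_subset subsetI)
  ultimately have "card N \<le> card ?F"
    using assms(4) by (simp add: dvd_imp_le)
  then have "?F = N" by (intro card_seteq fin) auto
  show ?thesis
  proof
    fix x assume x: "x \<in> N"
    then have xc: "x \<in> carrier G" using N.subset by blast
    have "\<forall>g\<in>carrier G. g \<otimes> x \<otimes> inv g = x"
      using x \<open>?F = N\<close> by blast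
    then show "x \<in> center G"
      using xc by (simp add: conj_eq_iff center_iff)
  qed
qed

lemma ex_maximal_subgroup:
  assumes "finite (carrier G)" "subgroup H G" "H \<noteq> carrier G"
  shows "\<exists>N. maximal_subgroup N G \<and> H \<subseteq> N"
proof -
  let ?A = "{N. subgroup N G \<and> N \<noteq> carrier G \<and> H \<subseteq> N}"
  have "?A \<subseteq> Pow (carrier G)" by (auto dest: subgroup.subset)
  then have fin: "finite ?A" using assms(1) finite_subset by blast
  have "?A \<noteq> {}" using assms(2,3) by blast
  from finite_has_maximal[OF fin this]
  obtain N where N: "N \<in> ?A" "\<forall>K\<in>?A. N \<subseteq> K \<longrightarrow> N = K"
    by (elim bexE)
  have "maximal_subgroup N G"
    unfolding maximal_subgroup_def
  proof (intro conjI allI impI)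
    fix K assume K: "subgroup K G \<and> N \<subseteq> K"
    show "K = N \<or> K = carrier G"
    proof (cases "K = carrier G")
      case False
      then have "K \<in> ?A" using K N(1) by auto
      then show ?thesis using bspec[OF N(2) \<open>K \<in> ?A\<close>] K by blast
    qed simp
  qed (use N(1) in auto)
  then show ?thesis using N(1) by blast
qed

lemma normal_center: "center G \<lhd> G"
  by (rule normal_if_central[OF subgroup_center]) simp

lemma comm_inv:
  assumes "x \<in> carrier G" "y \<in> carrier G"
  shows "inv (comm x y) = comm y x"
  using assms by (simp add: comm_def inv_mult_group m_assoc)

lemma comm_conj:
  assumes "x \<in> carrier G" "y \<in> carrier G"
  shows "x \<otimes> y \<otimes> inv x = comm x y \<otimes> y"
  using assms by (simp add: comm_def m_assoc)

lemma commutator_subgroup_eq: "commutator_subgroup G = generate G (\<Union>x\<in>carrier G. \<Union>y\<in>carrier G. {comm x y})"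
  by (simp add: derived_def comm_def)

lemma comm_in_commutator_subgroup: "x \<in> carrier G \<Longrightarrow> y \<in> carrier G \<Longrightarrow> comm x y \<in> commutator_subgroup G"
  unfolding commutator_subgroup_eq by (intro generate.incl) auto

lemma commutator_subgroup_subset:
  assumes "subgroup H G" "\<And>x y. x \<in> carrier G \<Longrightarrow> y \<in> carrier G \<Longrightarrow> comm x y \<in> H"
  shows "commutator_subgroup G \<subseteq> H"
  unfolding commutator_subgroup_eq by (rule generate_subgroup_incl) (use assms in auto)

end

section \<open>Groups of class two: the commutator is bimultiplicative\<close>

locale class2_group = group +
  assumes comm_central: "x \<in> carrier G \<Longrightarrow> y \<in> carrier G \<Longrightarrow> comm x y \<in> center G"
begin

lemma comm_mult_left:
  assumes "x \<in> carrier G" "y \<in> carrier G" "z \<in> carrier G"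
  shows "comm (x \<otimes> y) z = comm x z \<otimes> comm y z"
proof -
  have "comm (x \<otimes> y) z = x \<otimes> (y \<otimes> z \<otimes> inv y) \<otimes> inv x \<otimes> inv z"
    using assms by (simp add: comm_def m_assoc inv_mult_group)
  also have "\<dots> = x \<otimes> comm y z \<otimes> z \<otimes> inv x \<otimes> inv z"
    using assms by (subst comm_conj[of y z]) (simp_all add: m_assoc)
  also have "x \<otimes> comm y z = comm y z \<otimes> x"
    using center_commutes[OF comm_central[of y z], of x] assms by simp
  also have "comm y z \<otimes> x \<otimes> z \<otimes> inv x \<otimes> inv z = comm y z \<otimes> comm x z"
    using assms by (simp add: comm_def m_assoc)
  also have "\<dots> = comm x z \<otimes> comm y z"
    using center_commutes[OF comm_central[of y z], of "comm x z"] assms by simp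
  finally show ?thesis .
qed

lemma comm_mult_right:
  assumes "x \<in> carrier G" "y \<in> carrier G" "z \<in> carrier G"
  shows "comm x (y \<otimes> z) = comm x y \<otimes> comm x z"
proof -
  have "comm x (y \<otimes> z) = inv (comm (y \<otimes> z) x)"
    using assms by (simp add: comm_inv)
  also have "\<dots> = inv (comm z x) \<otimes> inv (comm y x)"
    using assms by (simp add: comm_mult_left inv_mult_group)
  also have "\<dots> = comm x z \<otimes> comm x y"
    using assms by (simp add: comm_inv)
  also have "\<dots> = comm x y \<otimes> comm x z"
    using center_commutes[OF comm_central[of x z], of "comm x y"] assms by simp
  finally show ?thesis .
qed

lemma comm_self [simp]: "x \<in> carrier G \<Longrightarrow> comm x x = \<one>"
  by (simp add: comm_eq_one_iff)

lemma comm_one [simp]: "x \<in> carrier G \<Longrightarrow> comm x \<one> = \<one>" "x \<in> carrier G \<Longrightarrow> comm \<one> x = \<one>"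
  by (simp_all add: comm_eq_one_iff)

lemma comm_pow_left:
  assumes "x \<in> carrier G" "y \<in> carrier G"
  shows "comm (x [^] (n::nat)) y = comm x y [^] n"
  using assms by (induction n) (auto simp: comm_mult_left)

lemma comm_center:
  assumes "z \<in> center G" "y \<in> carrier G"
  shows "comm z y = \<one>" "comm y z = \<one>"
  using assms center_commutes[OF assms] center_carrier[OF assms(1)] by (simp_all add: comm_eq_one_iff)

end

lemma (in group) card_subgroup_dvd:
  assumes "subgroup H G" "subgroup K G" "H \<subseteq> K"
  shows "card H dvd card K"
proof -
  interpret K: group "G\<lparr>carrier := K\<rparr>" by (rule subgroup_imp_group) fact
  have "subgroup H (G\<lparr>carrier := K\<rparr>)" by (rule subgroup_incl) fact+
  from K.lagrange[OF this] have "card (rcosets\<^bsub>G\<lparr>carrier := K\<rparr>\<^esub> H) * card H = card K"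
    by (simp add: Coset.order_def)
  then show ?thesis by (rule dvdI[OF trans[OF sym mult.commute]])
qed

section \<open>Structure of semi-extraspecial groups\<close>

locale semi_extraspecial_group = group +
  fixes p :: nat
  assumes prime_p: "Factorial_Ring.prime p" and semi_extraspecial: "semi_extraspecial p G"
begin

lemma ex_order: "\<exists>n. Coset.order G = p ^ n"
  using semi_extraspecial by (auto simp: semi_extraspecial_def p_group_def)

lemma finite_carrier: "finite (carrier G)"
  using ex_order order_gt_0_iff_finite prime_p by (auto simp: prime_gt_0_nat)

lemma center_nontrivial: "center G \<noteq> {\<one>}"
  using ex_order center_p_group_nontrivial[OF _ prime_p] semi_extraspecial by (auto simp: semi_extraspecial_def)

context
  fixes N assumes N: "maximal_subgroup N (G\<lparr>carrier := center G\<rparr>)"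
begin

lemma N_subgroup: "subgroup N G"
  using N incl_subgroup[OF subgroup_center] by (simp add: maximal_subgroup_def)

lemma N_center: "N \<subseteq> center G"
  using N subgroup.subset[of N "G\<lparr>carrier := center G\<rparr>"] by (auto simp: maximal_subgroup_def)

lemma N_normal: "N \<lhd> G"
  by (rule normal_if_central[OF N_subgroup N_center])

interpretation N: normal N G by (rule N_normal)

interpretation E: group "G Mod N" by (rule N.factorgroup_is_group)

interpretation h: group_hom G "G Mod N" "\<lambda>a. N #> a"
  by unfold_locales (rule N.r_coset_hom_Mod)

lemma E_extraspecial: "extraspecial p (G Mod N)"
  using N semi_extraspecial by (simp add: semi_extraspecial_def)

lemma carrier_E: "carrier (G Mod N) = (\<lambda>a. N #> a) ` carrier G"
  by (auto simp: FactGroup_def RCOSETS_def)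

lemma coset_eq_iff:
  assumes "x \<in> carrier G" "y \<in> carrier G"
  shows "N #> (x \<otimes> y) = N #> (y \<otimes> x) \<longleftrightarrow> comm x y \<in> N"
proof -
  have "N #> (x \<otimes> y) = (N #> comm x y) #> (y \<otimes> x)"
    using assms comm_swap[of x y] N.subset by (simp add: coset_mult_assoc m_assoc)
  moreover have "(N #> c) #> d = N #> d \<longleftrightarrow> c \<in> N" if "c \<in> carrier G" "d \<in> carrier G" for c d
  proof
    assume "c \<in> N"
    then show "(N #> c) #> d = N #> d"
      using coset_join2[OF that(1) N_subgroup] by simp
  next
    assume "(N #> c) #> d = N #> d"
    then have "c \<otimes> d \<in> N #> d"
      using that rcos_self[OF _ N_subgroup, of "c \<otimes> d"] N.subset by (simp add: coset_mult_assoc)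
    then have "c \<otimes> d \<otimes> inv d \<in> N"
      using that N.rcos_module_imp[OF is_group] by blast
    then show "c \<in> N" using that by (simp add: m_assoc)
  qed
  ultimately show ?thesis using assms by (metis comm_closed m_closed)
qed

text \<open>The image of the centre lies in a group of prime order \<open>p\<close>, and it is not
  trivial because \<open>N\<close> is a proper subgroup of the centre.\<close>

lemma image_center: "center (G Mod N) = (\<lambda>a. N #> a) ` center G"
proof -
  let ?I = "(\<lambda>a. N #> a) ` center G"
  have sub: "?I \<subseteq> center (G Mod N)"
  proof
    fix U assume "U \<in> ?I"
    then obtain z where z: "z \<in> center G" "U = N #> z" by blast
    have "U \<otimes>\<^bsub>G Mod N\<^esub> Y = Y \<otimes>\<^bsub>G Mod N\<^esub> U" if Y: "Y \<in> carrier (G Mod N)" for Y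
    proof -
      obtain y where y: "Y = N #> y" "y \<in> carrier G" using Y unfolding carrier_E by (rule imageE)
      show ?thesis
        using h.hom_mult[OF center_carrier[OF z(1)] y(2)] h.hom_mult[OF y(2) center_carrier[OF z(1)]]
          center_commutes[OF z(1) y(2)] y z by simp
    qed
    then show "U \<in> center (G Mod N)"
      using z center_carrier by (auto simp: E.center_iff carrier_E)
  qed
  have dvd: "card ?I dvd p"
    using E.card_subgroup_dvd[OF h.subgroup_img_is_subgroup[OF subgroup_center] E.subgroup_center sub]
      E_extraspecial by (simp add: extraspecial_def)
  have "card ?I \<noteq> 1"
  proof
    assume "card ?I = 1"
    then obtain U where U: "?I = {U}" by (rule card_1_singletonE)
    have "\<one> \<in> center G" by (simp add: center_iff)
    then have "U = N #> \<one>" using U by blast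
    then have eq: "N #> z = N" if "z \<in> center G" for z
      using that U N.subset by (metis coset_mult_one imageI singletonD)
    have "center G \<subseteq> N"
      using coset_join1[OF eq center_carrier N_subgroup] by blast
    then show False using N N_center by (auto simp: maximal_subgroup_def)
  qed
  then have "card ?I = p"
    using dvd prime_p by (metis prime_nat_iff)
  then show ?thesis
    using sub E_extraspecial prime_p
    by (metis card_subset_eq card.infinite extraspecial_def not_prime_0)
qed

lemma central_if_image_central:
  assumes x: "x \<in> carrier G" and "N #> x \<in> center (G Mod N)"
  shows "x \<in> center G"
proof -
  obtain z where z: "N #> x = N #> z" "z \<in> center G"
    using assms(2) unfolding image_center by (rule imageE)
  then have "x \<in> N #> z" using rcos_self[OF x N_subgroup] z(1) by simp
  then obtain m where "m \<in> N" "x = m \<otimes> z" by (auto simp: r_coset_def)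
  then show ?thesis
    using N_center z(2) subgroup.m_closed[OF subgroup_center] by blast
qed

text \<open>This is the nondegeneracy of the commutator form, and the way in which the extraspecial
  quotients are used: for a noncentral \<open>x\<close> the commutators with \<open>x\<close> lie in
  no maximal subgroup of the centre.\<close>

lemma central_if_comm_in:
  assumes x: "x \<in> carrier G" and "\<And>y. y \<in> carrier G \<Longrightarrow> comm x y \<in> N"
  shows "x \<in> center G"
proof (rule central_if_image_central[OF x])
  have "(N #> x) \<otimes>\<^bsub>G Mod N\<^esub> Y = Y \<otimes>\<^bsub>G Mod N\<^esub> (N #> x)" if Y: "Y \<in> carrier (G Mod N)" for Y
  proof -
    obtain y where y: "Y = N #> y" "y \<in> carrier G" using Y unfolding carrier_E by (rule imageE)
    show ?thesis
      using h.hom_mult[OF x y(2)] h.hom_mult[OF y(2) x] coset_eq_iff[OF x y(2)] assms(2)[OF y(2)] y(1)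
      by simp
  qed
  then show "N #> x \<in> center (G Mod N)"
    using x by (auto simp: E.center_iff carrier_E)
qed

lemma derived_E:
  "commutator_subgroup (G Mod N) = (\<lambda>a. N #> a) ` commutator_subgroup G"
  using h.derived_img[of "carrier G"] carrier_E by simp

text \<open>The derived subgroup of the quotient is normal of order \<open>p\<close> in a
  \<open>p\<close>-group, hence central there, and centrality lifts along the quotient map.\<close>

lemma comm_in_center:
  assumes "x \<in> carrier G" "y \<in> carrier G"
  shows "comm x y \<in> center G"
proof (rule central_if_image_central)
  obtain n where "Coset.order (G Mod N) = p ^ n"
    using E_extraspecial by (auto simp: extraspecial_def p_group_def)
  then have "commutator_subgroup (G Mod N) \<subseteq> center (G Mod N)"
    using E.normal_order_p_central[OF _ prime_p E.derived_self_is_normal] E_extraspecial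
    by (simp add: extraspecial_def)
  then show "N #> comm x y \<in> center (G Mod N)"
    using imageI[OF comm_in_commutator_subgroup[OF assms], of "\<lambda>a. N #> a"] unfolding derived_E
    by (rule subsetD)
qed (use assms in simp)

lemma commutator_subgroup_not_sub: "\<not> commutator_subgroup G \<subseteq> N"
proof
  assume sub: "commutator_subgroup G \<subseteq> N"
  have "N #> x = N" if "x \<in> commutator_subgroup G" for x
    using that sub coset_join2[OF _ N_subgroup] N.subset by blast
  then have "commutator_subgroup (G Mod N) \<subseteq> {N}"
    unfolding derived_E by blast
  then have "card (commutator_subgroup (G Mod N)) \<le> 1"
    using card_mono[of "{N}"] by simp
  then show False
    using E_extraspecial prime_gt_1_nat[OF prime_p] by (simp add: extraspecial_def)
qed

lemma pow_p_in_N: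
  assumes z: "z \<in> center G"
  shows "z [^] p \<in> N"
proof -
  let ?C = "(G Mod N)\<lparr>carrier := center (G Mod N)\<rparr>"
  interpret C: group ?C by (rule E.subgroup_imp_group[OF E.subgroup_center])
  have zc: "z \<in> carrier G" using z by (rule center_carrier)
  have "N #> z \<in> carrier ?C" using z image_center by simp
  then have "(N #> z) [^]\<^bsub>?C\<^esub> Coset.order ?C = \<one>\<^bsub>?C\<^esub>"
    by (rule C.pow_order_eq_1)
  moreover have "Coset.order ?C = p"
    using E_extraspecial by (simp add: Coset.order_def extraspecial_def)
  ultimately have "(N #> z) [^]\<^bsub>G Mod N\<^esub> p = N"
    by (simp add: nat_pow_def)
  then have "N #> (z [^] p) = N"
    using h.hom_nat_pow[OF zc, of p] by simp
  then show ?thesis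
    using coset_join1 N_subgroup zc by blast
qed

end

lemma ex_maximal_center:
  assumes "subgroup H G" "H \<subset> center G"
  shows "\<exists>N. maximal_subgroup N (G\<lparr>carrier := center G\<rparr>) \<and> H \<subseteq> N"
proof -
  interpret Z: group "G\<lparr>carrier := center G\<rparr>"
    by (rule subgroup_imp_group[OF subgroup_center])
  have "finite (center G)"
    using finite_carrier by (rule finite_subset[rotated]) (auto simp: center_carrier)
  then show ?thesis
    using Z.ex_maximal_subgroup[of H] subgroup_incl[OF assms(1) subgroup_center] assms(2) by auto
qed

lemma ex_max: "\<exists>N. maximal_subgroup N (G\<lparr>carrier := center G\<rparr>)"
proof -
  have "{\<one>} \<subset> center G"
    using center_nontrivial subgroup.one_closed[OF subgroup_center] by blast
  then show ?thesis
    using ex_maximal_center[OF triv_subgroup] by blast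
qed

end

sublocale semi_extraspecial_group \<subseteq> class2_group
  by unfold_locales (use ex_max comm_in_center in blast)

context semi_extraspecial_group
begin

lemma commutator_subgroup_eq_center: "commutator_subgroup G = center G"
proof (rule ccontr)
  assume neq: "commutator_subgroup G \<noteq> center G"
  have "commutator_subgroup G \<subseteq> center G"
    by (rule commutator_subgroup_subset[OF subgroup_center comm_central])
  with neq have "commutator_subgroup G \<subset> center G" by blast
  then obtain N where "maximal_subgroup N (G\<lparr>carrier := center G\<rparr>)" "commutator_subgroup G \<subseteq> N"
    using ex_maximal_center[OF derived_is_subgroup] by blast
  then show False using commutator_subgroup_not_sub by blast
qed

text \<open>The commutators with \<open>x\<close> form a subgroup of the centre. If it were proper,
  it would lie in a maximal one, and \<open>x\<close> would be central.\<close>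

lemma ex_comm_eq:
  assumes x: "x \<in> carrier G" "x \<notin> center G" and z: "z \<in> center G"
  shows "\<exists>y\<in>carrier G. comm x y = z"
proof (rule ccontr)
  assume no: "\<not> ?thesis"
  let ?I = "comm x ` carrier G"
  have "subgroup ?I G"
  proof (rule subgroupI)
    show "?I \<subseteq> carrier G" "?I \<noteq> {}" using x by auto
    show "inv c \<in> ?I" if "c \<in> ?I" for c
    proof -
      obtain y where y: "c = comm x y" "y \<in> carrier G" using \<open>c \<in> ?I\<close> by blast
      have "comm x (inv y) \<otimes> comm x y = comm x (inv y \<otimes> y)"
        by (rule comm_mult_right[symmetric]) (use x y in auto)
      then have "comm x (inv y) = inv c"
        using x y inv_equality by simp
      then show ?thesis using y by (metis image_eqI inv_closed)
    qed
    show "c \<otimes> d \<in> ?I" if "c \<in> ?I" "d \<in> ?I" for c d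
      using that comm_mult_right[OF x(1)] by (auto simp: image_iff) (metis m_closed)
  qed
  moreover have "?I \<subset> center G"
  proof
    show "?I \<subseteq> center G" using comm_central[OF x(1)] by auto
    have "z \<notin> ?I" using no by auto
    then show "?I \<noteq> center G" using z by auto
  qed
  ultimately obtain N where N: "maximal_subgroup N (G\<lparr>carrier := center G\<rparr>)" "?I \<subseteq> N"
    using ex_maximal_center by blast
  then show False
    using central_if_comm_in[OF N(1) x(1)] x(2) by (auto simp: image_subset_iff)
qed

text \<open>A commutator with \<open>x [^] p\<close> is the \<open>p\<close>-th power of a central
  element, hence in \<open>N\<close> because the centre of the quotient has order \<open>p\<close>;
  nondegeneracy does the rest.\<close>

lemma pow_p_central:
  assumes x: "x \<in> carrier G"
  shows "x [^] p \<in> center G"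
proof -
  obtain N where N: "maximal_subgroup N (G\<lparr>carrier := center G\<rparr>)" using ex_max by blast
  show ?thesis
    by (rule central_if_comm_in[OF N])
       (use x comm_pow_left pow_p_in_N[OF N] comm_central in auto)
qed

lemma center_nonabelian: "\<exists>x\<in>carrier G. x \<notin> center G"
proof (rule ccontr)
  assume "\<not> ?thesis"
  then have "comm x y = \<one>" if "x \<in> carrier G" "y \<in> carrier G" for x y
    using comm_center(1) that by blast
  then have "commutator_subgroup G \<subseteq> {\<one>}"
    by (intro commutator_subgroup_subset triv_subgroup) auto
  then show False
    using center_nontrivial subgroup.one_closed[OF subgroup_center] commutator_subgroup_eq_center by blast
qed

text \<open>Write \<open>z\<close> as a commutator \<open>comm x y\<close>; then
  \<open>z [^] p\<close> is the commutator of the central element \<open>x [^] p\<close> with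
  \<open>y\<close>.\<close>

lemma center_pow_p:
  assumes z: "z \<in> center G"
  shows "z [^] p = \<one>"
proof -
  obtain x where x: "x \<in> carrier G" "x \<notin> center G" using center_nonabelian by blast
  then obtain y where "y \<in> carrier G" "comm x y = z" using ex_comm_eq z by blast
  then show ?thesis
    using comm_pow_left[OF x(1), of y p] comm_center(1)[OF pow_p_central[OF x(1)]] by simp
qed

end

section \<open>Coordinates on \<open>G/Z\<close>\<close>

text \<open>The sets \<open>\<Gamma>\<close> with \<open>P \<Gamma>\<close> are the graphs of partial embeddings; a maximal one is total.\<close>

lemma (in prim_field) elementary_abelian_embedding:
  assumes V: "comm_group V" and fin: "finite (carrier V)"
    and exp: "\<And>v. v \<in> carrier V \<Longrightarrow> v [^]\<^bsub>V\<^esub> p = \<one>\<^bsub>V\<^esub>"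
    and card: "card (carrier V) \<le> p ^ n"
  shows "\<exists>f :: 'v \<Rightarrow> 'k. inj_on f (carrier V) \<and> (\<forall>v\<in>carrier V. \<forall>w\<in>carrier V. f (v \<otimes>\<^bsub>V\<^esub> w) = f v + f w)"
proof -
  interpret V: comm_group V by fact
  define P where "P \<Gamma> \<longleftrightarrow> \<Gamma> \<subseteq> carrier V \<times> (UNIV :: 'k set) \<and> (\<one>\<^bsub>V\<^esub>, 0) \<in> \<Gamma>
    \<and> (\<forall>(v, x)\<in>\<Gamma>. \<forall>(w, y)\<in>\<Gamma>. (v \<otimes>\<^bsub>V\<^esub> w, x + y) \<in> \<Gamma>)
    \<and> (\<forall>(v, x)\<in>\<Gamma>. v = \<one>\<^bsub>V\<^esub> \<longleftrightarrow> x = 0)" for \<Gamma>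
  have fin_all: "finite {\<Gamma>. P \<Gamma>}"
    by (rule finite_subset[of _ "Pow (carrier V \<times> UNIV)"]) (use fin in \<open>auto simp: P_def\<close>)
  have "P {(\<one>\<^bsub>V\<^esub>, 0)}" by (auto simp: P_def)
  then have "{\<Gamma>. P \<Gamma>} \<noteq> {}" by blast
  from finite_has_maximal[OF fin_all this]
  obtain \<Gamma> where \<Gamma>: "P \<Gamma>" and max: "\<And>\<Delta>. P \<Delta> \<Longrightarrow> \<Gamma> \<subseteq> \<Delta> \<Longrightarrow> \<Gamma> = \<Delta>"
    by auto
  have sub: "v \<in> carrier V" if "(v, x) \<in> \<Gamma>" for v x
    using \<Gamma> that by (auto simp: P_def)
  have one: "(\<one>\<^bsub>V\<^esub>, 0) \<in> \<Gamma>" using \<Gamma> by (simp add: P_def)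
  have mult: "(v \<otimes>\<^bsub>V\<^esub> w, x + y) \<in> \<Gamma>" if "(v, x) \<in> \<Gamma>" "(w, y) \<in> \<Gamma>" for v w x y
    using \<Gamma> that by (auto simp: P_def)
  have iff: "v = \<one>\<^bsub>V\<^esub> \<longleftrightarrow> x = 0" if "(v, x) \<in> \<Gamma>" for v x
    using \<Gamma> that by (auto simp: P_def)
  have pow: "(v [^]\<^bsub>V\<^esub> i, of_nat i * x) \<in> \<Gamma>" if "(v, x) \<in> \<Gamma>" for v x and i :: nat
  proof (induction i)
    case (Suc i)
    then show ?case using mult[OF Suc that] by (simp add: algebra_simps)
  qed (use one in simp)
  have pow_dvd: "v [^]\<^bsub>V\<^esub> i = \<one>\<^bsub>V\<^esub>" if "v \<in> carrier V" "p dvd i" for v and i :: nat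
    using that exp by (auto elim!: dvdE simp flip: V.nat_pow_pow)
  have of_nat_dvd: "of_nat i = (0 :: 'k)" if "p dvd i" for i
    using that of_nat_p by (auto elim!: dvdE)
  have inv: "(inv\<^bsub>V\<^esub> v, - x) \<in> \<Gamma>" if "(v, x) \<in> \<Gamma>" for v x
  proof -
    have "v [^]\<^bsub>V\<^esub> (p - 1) \<otimes>\<^bsub>V\<^esub> v = v [^]\<^bsub>V\<^esub> Suc (p - 1)"
      by simp
    then have "v [^]\<^bsub>V\<^esub> (p - 1) \<otimes>\<^bsub>V\<^esub> v = \<one>\<^bsub>V\<^esub>"
      using exp[OF sub[OF that]] p_gt_1 by simp
    then have "inv\<^bsub>V\<^esub> v = v [^]\<^bsub>V\<^esub> (p - 1)"
      using sub[OF that] V.inv_equality by simp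
    moreover have "of_nat (p - 1) * x = - x"
      using p_gt_1 of_nat_p by (simp add: of_nat_diff algebra_simps)
    ultimately show ?thesis using pow[OF that, of "p - 1"] by simp
  qed
  have eq_iff: "v = w \<longleftrightarrow> x = y" if "(v, x) \<in> \<Gamma>" "(w, y) \<in> \<Gamma>" for v w x y
  proof -
    have "(v \<otimes>\<^bsub>V\<^esub> inv\<^bsub>V\<^esub> w, x + - y) \<in> \<Gamma>"
      using mult[OF that(1) inv[OF that(2)]] .
    then have "v \<otimes>\<^bsub>V\<^esub> inv\<^bsub>V\<^esub> w = \<one>\<^bsub>V\<^esub> \<longleftrightarrow> x = y"
      using iff by fastforce
    moreover have "v \<otimes>\<^bsub>V\<^esub> inv\<^bsub>V\<^esub> w = \<one>\<^bsub>V\<^esub> \<longleftrightarrow> v = w"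
      using sub[OF that(1)] sub[OF that(2)] by (metis V.inv_solve_right' V.l_one V.one_closed)
    ultimately show ?thesis by simp
  qed
  have full: "fst ` \<Gamma> = carrier V"
  proof (rule ccontr)
    assume "fst ` \<Gamma> \<noteq> carrier V"
    moreover have subV: "fst ` \<Gamma> \<subseteq> carrier V" using sub by auto
    ultimately obtain v where v: "v \<in> carrier V" "v \<notin> fst ` \<Gamma>" by blast
    \<comment> \<open>As the graph of an injection with proper domain, \<open>\<Gamma>\<close> has
      fewer values than the field has elements; any missing value \<open>x\<close> may become the
      image of \<open>v\<close>.\<close>
    have "card (snd ` \<Gamma>) = card (fst ` \<Gamma>)"
    proof -
      have "inj_on fst \<Gamma>" "inj_on snd \<Gamma>"
        using eq_iff by (auto simp: inj_on_def)
      then show ?thesis by (simp add: card_image)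
    qed
    also have "\<dots> < card (carrier V)"
      using subV v fin by (intro psubset_card_mono) auto
    also have "\<dots> \<le> CARD('k)" using card card_k by simp
    finally have "snd ` \<Gamma> \<noteq> UNIV" by auto
    then obtain x where x: "x \<notin> snd ` \<Gamma>" by blast
    define \<Delta> where "\<Delta> = {(u \<otimes>\<^bsub>V\<^esub> v [^]\<^bsub>V\<^esub> i, y + of_nat i * x) | u y i. (u, y) \<in> \<Gamma> \<and> (i :: nat) \<in> UNIV}"
    have \<Delta>_I: "(u \<otimes>\<^bsub>V\<^esub> v [^]\<^bsub>V\<^esub> i, y + of_nat i * x) \<in> \<Delta>" if "(u, y) \<in> \<Gamma>" for u y and i :: nat
      unfolding \<Delta>_def using that by (intro CollectI exI conjI) auto
    \<comment> \<open>A multiplier prime to \<open>p\<close> could be inverted modulo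
      \<open>p\<close>, which would put \<open>v\<close> into the domain or \<open>x\<close> into
      the range. The disjunction treats both sides at once.\<close>
    have coprime: "p dvd i" if i: "(v [^]\<^bsub>V\<^esub> i, y) \<in> \<Gamma> \<or> (u, of_nat i * x) \<in> \<Gamma>" for i y u
    proof (rule ccontr)
      assume "\<not> p dvd i"
      then have "coprime i p"
        using prime_p prime_imp_coprime coprime_commute by blast
      then obtain j where "[i * j = 1] (mod p)"
        using cong_solve_coprime_nat by auto
      then have j: "(i * j) mod p = 1"
        using p_gt_1 by (simp add: cong_def)
      define m where "m = i * j div p"
      have ij: "i * j = m * p + 1"
        using j by (metis m_def div_mult_mod_eq)
      have "v [^]\<^bsub>V\<^esub> (i * j) = v"
        unfolding ij using v by (simp add: V.nat_pow_mult[symmetric] pow_dvd)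
      then have 1: "(v [^]\<^bsub>V\<^esub> i) [^]\<^bsub>V\<^esub> j = v"
        using v by (simp add: V.nat_pow_pow)
      have "of_nat (i * j) * x = x"
        unfolding ij by (simp add: of_nat_p)
      then have 2: "of_nat j * (of_nat i * x) = x"
        by (simp add: mult_ac)
      from i show False
      proof
        assume "(v [^]\<^bsub>V\<^esub> i, y) \<in> \<Gamma>"
        from pow[OF this, of j] show False using v(2) 1 by (metis fst_conv imageI)
      next
        assume "(u, of_nat i * x) \<in> \<Gamma>"
        from pow[OF this, of j] show False using x 2 by (metis snd_conv imageI)
      qed
    qed
    have "P \<Delta>"
      unfolding P_def
    proof (intro conjI ballI, goal_cases)
      case 1
      then show ?case using sub v(1) by (auto simp: \<Delta>_def)
    next
      case 2
      show ?case using \<Delta>_I[OF one, of 0] by simp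
    next
      case (3 s)
      have "(w \<otimes>\<^bsub>V\<^esub> w', y + y') \<in> \<Delta>" if ww: "(w, y) \<in> \<Delta>" "(w', y') \<in> \<Delta>" for w w' y y'
      proof -
        obtain u z i where 1: "w = u \<otimes>\<^bsub>V\<^esub> v [^]\<^bsub>V\<^esub> (i::nat)" "y = z + of_nat i * x" "(u, z) \<in> \<Gamma>"
          using ww(1) by (auto simp: \<Delta>_def)
        obtain u' z' i' where 2: "w' = u' \<otimes>\<^bsub>V\<^esub> v [^]\<^bsub>V\<^esub> (i'::nat)" "y' = z' + of_nat i' * x" "(u', z') \<in> \<Gamma>"
          using ww(2) by (auto simp: \<Delta>_def)
        have "w \<otimes>\<^bsub>V\<^esub> w' = (u \<otimes>\<^bsub>V\<^esub> u') \<otimes>\<^bsub>V\<^esub> v [^]\<^bsub>V\<^esub> (i + i')"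
          using 1 2 sub[OF 1(3)] sub[OF 2(3)] v(1)
          by (simp add: V.nat_pow_mult[symmetric] V.m_ac)
        moreover have "y + y' = (z + z') + of_nat (i + i') * x"
          using 1 2 by (simp add: algebra_simps)
        ultimately show ?thesis using \<Delta>_I[OF mult[OF 1(3) 2(3)], of "i + i'"] by simp
      qed
      then show ?case using 3 by auto
    next
      case (4 s)
      have "w = \<one>\<^bsub>V\<^esub> \<longleftrightarrow> y = 0" if wy: "(w, y) \<in> \<Delta>" for w y
      proof -
        obtain u z i where 1: "w = u \<otimes>\<^bsub>V\<^esub> v [^]\<^bsub>V\<^esub> (i::nat)" "y = z + of_nat i * x" "(u, z) \<in> \<Gamma>"
          using wy by (auto simp: \<Delta>_def)
        have uc: "u \<in> carrier V" using sub[OF 1(3)] .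
        show ?thesis
        proof (cases "p dvd i")
          case True
          then show ?thesis
            using 1 iff[OF 1(3)] uc pow_dvd[OF v(1) True] of_nat_dvd[OF True] by simp
        next
          case False
          have "w \<noteq> \<one>\<^bsub>V\<^esub>"
          proof
            assume "w = \<one>\<^bsub>V\<^esub>"
            then have "v [^]\<^bsub>V\<^esub> i \<otimes>\<^bsub>V\<^esub> u = \<one>\<^bsub>V\<^esub>"
              using 1(1) uc v(1) by (simp add: V.m_comm)
            then have "inv\<^bsub>V\<^esub> u = v [^]\<^bsub>V\<^esub> i"
              using uc v(1) by (simp add: V.inv_equality)
            then show False using inv[OF 1(3)] coprime False by metis
          qed
          moreover have "y \<noteq> 0"
          proof
            assume "y = 0"
            then have "- z = of_nat i * x"
              using 1(2) by (simp add: neg_eq_iff_add_eq_0)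
            then show False using inv[OF 1(3)] coprime False by metis
          qed
          ultimately show ?thesis by simp
        qed
      qed
      then show ?case using 4 by auto
    qed
    moreover have "\<Gamma> \<subseteq> \<Delta>"
    proof
      fix s assume s: "s \<in> \<Gamma>"
      obtain u y where uy: "s = (u, y)" by force
      show "s \<in> \<Delta>" using \<Delta>_I[of u y 0] s uy sub by simp
    qed
    ultimately have "\<Gamma> = \<Delta>" by (rule max)
    then have "(v, x) \<in> \<Gamma>" using \<Delta>_I[OF one, of 1] v(1) by simp
    then show False using v(2) by (metis fst_conv imageI)
  qed
  define f where "f v = (SOME x. (v, x) \<in> \<Gamma>)" for v
  have f: "(v, f v) \<in> \<Gamma>" if "v \<in> carrier V" for v
  proof -
    have "\<exists>x. (v, x) \<in> \<Gamma>" using full that by force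
    then show ?thesis unfolding f_def by (rule someI_ex)
  qed
  have "inj_on f (carrier V)"
    using f eq_iff by (metis inj_onI)
  moreover have "f (v \<otimes>\<^bsub>V\<^esub> w) = f v + f w" if "v \<in> carrier V" "w \<in> carrier V" for v w
    using eq_iff[OF f[OF V.m_closed[OF that]] mult[OF f[OF that(1)] f[OF that(2)]]] by simp
  ultimately show ?thesis by blast
qed

text \<open>Modulo commutators and \<open>p\<close>-th powers the quotient is elementary abelian.
  The clause on cardinalities makes \<open>\<pi>\<close> surjective as soon as the index is
  \<open>p ^ n\<close>.\<close>

lemma (in prim_field) quotient_embedding:
  assumes G: "group G" and fin: "finite (carrier G)" and N: "N \<lhd> G"
    and comm: "\<And>x y. x \<in> carrier G \<Longrightarrow> y \<in> carrier G \<Longrightarrow> monoid.comm G x y \<in> N"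
    and pow: "\<And>x. x \<in> carrier G \<Longrightarrow> x [^]\<^bsub>G\<^esub> p \<in> N"
    and card: "card (rcosets\<^bsub>G\<^esub> N) \<le> p ^ n"
  shows "\<exists>\<pi> :: 'g \<Rightarrow> 'k. (\<forall>x\<in>carrier G. \<forall>y\<in>carrier G. \<pi> (x \<otimes>\<^bsub>G\<^esub> y) = \<pi> x + \<pi> y)
    \<and> (\<forall>x\<in>carrier G. \<pi> x = 0 \<longleftrightarrow> x \<in> N) \<and> card (\<pi> ` carrier G) = card (rcosets\<^bsub>G\<^esub> N)"
proof -
  interpret N: normal N G by fact
  interpret Q: group "G Mod N" by (rule N.factorgroup_is_group)
  let ?h = "\<lambda>a. N #>\<^bsub>G\<^esub> a"
  interpret h: group_hom G "G Mod N" ?h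
    by unfold_locales (rule N.r_coset_hom_Mod)
  have sub: "subgroup N G" by (rule N.subgroup_axioms)
  have carrier: "carrier (G Mod N) = ?h ` carrier G"
    by (auto simp: FactGroup_def RCOSETS_def)
  have coset1: "N #>\<^bsub>G\<^esub> x = N \<longleftrightarrow> x \<in> N" if "x \<in> carrier G" for x
    using N.coset_join1[OF _ that sub] N.coset_join2[OF that sub] by blast
  have comm_Q: "comm_group (G Mod N)"
  proof (rule Q.group_comm_groupI)
    fix U W assume "U \<in> carrier (G Mod N)" "W \<in> carrier (G Mod N)"
    then obtain x y where xy: "x \<in> carrier G" "y \<in> carrier G" "U = ?h x" "W = ?h y"
      unfolding carrier by blast
    have "?h (x \<otimes>\<^bsub>G\<^esub> y) = (?h (N.comm x y)) #>\<^bsub>G\<^esub> (y \<otimes>\<^bsub>G\<^esub> x)"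
      using xy N.comm_swap[of x y] N.subset by (simp add: N.coset_mult_assoc N.m_assoc)
    also have "\<dots> = ?h (y \<otimes>\<^bsub>G\<^esub> x)"
      using coset1[of "N.comm x y"] comm xy by simp
    finally show "U \<otimes>\<^bsub>G Mod N\<^esub> W = W \<otimes>\<^bsub>G Mod N\<^esub> U"
      using xy h.hom_mult by metis
  qed
  have card': "card (carrier (G Mod N)) = card (rcosets\<^bsub>G\<^esub> N)"
    by (simp add: FactGroup_def)
  have exp: "U [^]\<^bsub>G Mod N\<^esub> p = \<one>\<^bsub>G Mod N\<^esub>" if "U \<in> carrier (G Mod N)" for U
  proof -
    obtain x where x: "x \<in> carrier G" "U = ?h x" using \<open>U \<in> _\<close> carrier by blast
    have "U [^]\<^bsub>G Mod N\<^esub> p = ?h (x [^]\<^bsub>G\<^esub> p)"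
      using x h.hom_nat_pow by simp
    also have "\<dots> = N" using x pow coset1 by simp
    finally show ?thesis by simp
  qed
  have "finite (carrier (G Mod N))" unfolding carrier using fin by simp
  from elementary_abelian_embedding[OF comm_Q this exp] card card'
  obtain f :: "'g set \<Rightarrow> 'k" where f: "inj_on f (carrier (G Mod N))"
    "\<And>v w. v \<in> carrier (G Mod N) \<Longrightarrow> w \<in> carrier (G Mod N) \<Longrightarrow> f (v \<otimes>\<^bsub>G Mod N\<^esub> w) = f v + f w"
    by auto
  define \<pi> where "\<pi> x = f (?h x)" for x
  have add: "\<pi> (x \<otimes>\<^bsub>G\<^esub> y) = \<pi> x + \<pi> y" if "x \<in> carrier G" "y \<in> carrier G" for x y
    using f(2)[of "?h x" "?h y"] h.hom_mult[OF that] that carrier by (simp add: \<pi>_def)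
  have "\<pi> \<one>\<^bsub>G\<^esub> = \<pi> \<one>\<^bsub>G\<^esub> + \<pi> \<one>\<^bsub>G\<^esub>"
    using add[OF monoid.one_closed[OF N.is_monoid] monoid.one_closed[OF N.is_monoid]] N.r_one[OF monoid.one_closed[OF N.is_monoid]] by metis
  then have "\<pi> \<one>\<^bsub>G\<^esub> = 0"
    by (metis add_cancel_right_right)
  moreover have "N \<in> ?h ` carrier G"
    using Q.one_closed unfolding carrier by simp
  ultimately have "\<pi> x = 0 \<longleftrightarrow> x \<in> N" if "x \<in> carrier G" for x
    using inj_on_eq_iff[OF f(1), of "?h x" "?h \<one>\<^bsub>G\<^esub>"] that carrier coset1[OF that] coset1[of "\<one>\<^bsub>G\<^esub>"]
    by (simp add: \<pi>_def)
  moreover have "card (\<pi> ` carrier G) = card (rcosets\<^bsub>G\<^esub> N)"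
    using card_image[OF f(1)] card' unfolding carrier by (simp add: \<pi>_def image_image)
  ultimately show ?thesis using add by blast
qed

text \<open>The product is that of the matrices \<open>heis_matrix\<close>; \<open>x * y ^ q\<close>
  is what the middle row contributes to the corner entry.\<close>

definition heis :: "nat \<Rightarrow> ('k::field \<times> 'k) monoid" where
  "heis q = \<lparr>carrier = {(x, t). t + t ^ q = x ^ (q + 1)},
             monoid.mult = (\<lambda>(x, t) (y, s). (x + y, t + s + x * y ^ q)), one = (0, 0)\<rparr>"

context group
begin

lemma inv_mult_cancel:
  assumes "x \<in> carrier G" "y \<in> carrier G"
  shows "inv x \<otimes> (x \<otimes> y) = y" "x \<otimes> (inv x \<otimes> y) = y"
  using assms by (simp_all add: m_assoc[symmetric])

lemma hom_funpow:
  assumes "\<phi> \<in> hom G G"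
  shows "\<phi> ^^ i \<in> hom G G"
proof (induction i)
  case (Suc i)
  show ?case
    using Group.hom_compose[OF Suc assms] by (simp add: comp_def)
qed (simp add: hom_def)

lemma hom_comm:
  assumes "\<phi> \<in> hom G G" "x \<in> carrier G" "y \<in> carrier G"
  shows "\<phi> (comm x y) = comm (\<phi> x) (\<phi> y)"
proof -
  interpret h: group_hom G G \<phi> by unfold_locales fact
  show ?thesis using assms(2,3) by (simp add: comm_def)
qed

end

lemma (in class2_group) comm_mult_center:
  assumes "x \<in> carrier G" "y \<in> carrier G" "c \<in> center G" "d \<in> center G"
  shows "comm (x \<otimes> c) (y \<otimes> d) = comm x y"
  using assms center_carrier[OF assms(3)] center_carrier[OF assms(4)]
  by (simp add: comm_mult_left comm_mult_right comm_center)

section \<open>Endomorphisms and their action on the central quotient\<close>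

context semi_extraspecial_group
begin

text \<open>Every central element is a commutator, so its image is one too, and commutators are
  central.\<close>

lemma hom_center:
  assumes \<phi>: "\<phi> \<in> hom G G" "z \<in> center G"
  shows "\<phi> z \<in> center G"
proof -
  obtain x where x: "x \<in> carrier G" "x \<notin> center G" using center_nonabelian by blast
  then obtain y where y: "y \<in> carrier G" "comm x y = z" using ex_comm_eq \<phi>(2) by blast
  then have "\<phi> z = comm (\<phi> x) (\<phi> y)"
    using hom_comm[OF \<phi>(1) x(1) y(1)] by simp
  then show ?thesis
    using comm_central hom_in_carrier[OF \<phi>(1)] x(1) y(1) by simp
qed

lemma coset_split:
  assumes "x \<in> carrier G" "y \<in> carrier G" "inv x \<otimes> y \<in> center G"
  shows "\<exists>c. c \<in> center G \<and> y = x \<otimes> c"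
proof (intro exI conjI)
  show "y = x \<otimes> (inv x \<otimes> y)" using assms by (simp add: m_assoc[symmetric])
qed fact

text \<open>An endomorphism that is trivial on \<open>G/Z\<close> is trivial on \<open>Z = G'\<close>, so that it
  multiplies each element by a central element of order dividing \<open>p\<close>.\<close>

lemma hom_pow_p_id:
  assumes \<phi>: "\<phi> \<in> hom G G" and triv: "\<And>x. x \<in> carrier G \<Longrightarrow> inv x \<otimes> \<phi> x \<in> center G"
    and x: "x \<in> carrier G"
  shows "(\<phi> ^^ p) x = x"
proof -
  have closed: "\<phi> g \<in> carrier G" if "g \<in> carrier G" for g
    using hom_in_carrier[OF \<phi> that] .
  have fix_center: "\<phi> z = z" if "z \<in> center G" for z
  proof -
    obtain g where g: "g \<in> carrier G" "g \<notin> center G" using center_nonabelian by blast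
    then obtain h where h: "h \<in> carrier G" "comm g h = z" using ex_comm_eq \<open>z \<in> center G\<close> by blast
    obtain c where c: "c \<in> center G" "\<phi> g = g \<otimes> c" using coset_split[OF g(1) closed[OF g(1)] triv[OF g(1)]] by blast
    obtain d where d: "d \<in> center G" "\<phi> h = h \<otimes> d" using coset_split[OF h(1) closed[OF h(1)] triv[OF h(1)]] by blast
    show ?thesis
      using hom_comm[OF \<phi> g(1) h(1)] c d comm_mult_center[OF g(1) h(1)] h(2) by simp
  qed
  obtain c where c: "c \<in> center G" "\<phi> x = x \<otimes> c" using coset_split[OF x closed[OF x] triv[OF x]] by blast
  note cc = center_carrier[OF c(1)]
  have "(\<phi> ^^ i) x = x \<otimes> c [^] i" for i
  proof (induction i)
    case (Suc i)
    have ci: "c [^] i \<in> center G"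
      using c(1) by (induction i) (auto intro: subgroup.m_closed[OF subgroup_center] subgroup.one_closed[OF subgroup_center])
    have "(\<phi> ^^ Suc i) x = \<phi> x \<otimes> \<phi> (c [^] i)"
      using Suc hom_mult[OF \<phi>] x cc by simp
    then show ?case
      using fix_center[OF ci] c x cc center_commutes[OF c(1), of "c [^] i"] by (simp add: m_assoc)
  qed (use x in simp)
  then show ?thesis using center_pow_p[OF c(1)] x by simp
qed

text \<open>\<open>\<phi>\<close> induces an additive map \<open>T\<close> in the coordinates
  \<open>\<pi>0\<close> of the central quotient. \<open>T\<close> has the same order as
  \<open>\<phi>\<close>, so it becomes multiplication by a primitive element after a further
  additive bijection \<open>\<pi>1\<close>.\<close>

lemma singer_automorphism:
  fixes \<phi> :: "'a \<Rightarrow> 'a"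
  assumes k: "CARD('k :: {field, finite}) = p ^ n"
    and card: "card (rcosets (center G)) = p ^ n"
    and \<phi>: "\<phi> \<in> hom G G" "\<phi> ` carrier G = carrier G"
    and id_ball: "\<forall>x\<in>carrier G. (\<phi> ^^ (p ^ n - 1)) x = x"
    and not_id_all: "\<forall>j. 0 < j \<longrightarrow> j < p ^ n - 1 \<longrightarrow> (\<exists>x\<in>carrier G. (\<phi> ^^ j) x \<noteq> x)"
    and n: "n > 1"
  shows "\<exists>(\<zeta> :: 'k) \<pi>. prim_field p n \<zeta> \<and> (\<forall>x\<in>carrier G. \<forall>y\<in>carrier G. \<pi> (x \<otimes> y) = \<pi> x + \<pi> y)
    \<and> (\<forall>x\<in>carrier G. \<pi> x = 0 \<longleftrightarrow> x \<in> center G) \<and> \<pi> ` carrier G = UNIV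
    \<and> (\<forall>x\<in>carrier G. \<pi> (\<phi> x) = \<zeta> * \<pi> x)"
proof -
  note id = id_ball[rule_format] and not_id = not_id_all[rule_format]
  obtain \<zeta>0 :: 'k where "prim_field p n \<zeta>0"
    using ex_prim_field[OF prime_p k] by blast
  then interpret K: prim_field p n \<zeta>0 .
  obtain \<pi>0 :: "'a \<Rightarrow> 'k" where
    add: "\<And>x y. x \<in> carrier G \<Longrightarrow> y \<in> carrier G \<Longrightarrow> \<pi>0 (x \<otimes> y) = \<pi>0 x + \<pi>0 y" and
    ker: "\<And>x. x \<in> carrier G \<Longrightarrow> \<pi>0 x = 0 \<longleftrightarrow> x \<in> center G" and
    img: "card (\<pi>0 ` carrier G) = p ^ n"
    using K.quotient_embedding[OF is_group finite_carrier normal_center comm_central pow_p_central] card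
    by auto
  have surj: "\<pi>0 ` carrier G = UNIV"
    using img k by (intro card_seteq) auto
  have one: "\<pi>0 \<one> = 0" using ker[of \<one>] subgroup.one_closed[OF subgroup_center] by simp
  have inv: "\<pi>0 (inv x) = - \<pi>0 x" if "x \<in> carrier G" for x
    using add[of "inv x" x] that one by (simp add: eq_neg_iff_add_eq_0)
  have pow_closed: "(\<phi> ^^ i) x \<in> carrier G" if "x \<in> carrier G" for x i
    using hom_in_carrier[OF hom_funpow[OF \<phi>(1)] that] .
  define rep where "rep v = inv_into (carrier G) \<pi>0 v" for v
  have rep: "rep v \<in> carrier G" "\<pi>0 (rep v) = v" for v
    using surj by (simp_all add: rep_def inv_into_into f_inv_into_f)
  define T where "T v = \<pi>0 (\<phi> (rep v))" for v
  \<comment> \<open>Independence of the representative: two of them differ by a central factor,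
    which \<open>\<phi>\<close> maps into the centre.\<close>
  have T: "T (\<pi>0 x) = \<pi>0 (\<phi> x)" if x: "x \<in> carrier G" for x
  proof -
    let ?r = "rep (\<pi>0 x)"
    have "\<pi>0 (inv ?r \<otimes> x) = 0" using x rep add inv by simp
    then have c: "inv ?r \<otimes> x \<in> center G" using ker x rep by simp
    then obtain c where "c \<in> center G" "x = ?r \<otimes> c" using coset_split[OF rep(1) x] by blast
    then have "\<pi>0 (\<phi> x) = \<pi>0 (\<phi> ?r) + \<pi>0 (\<phi> c)"
      using hom_mult[OF \<phi>(1)] add rep(1) hom_in_carrier[OF \<phi>(1)] center_carrier by metis
    also have "\<pi>0 (\<phi> c) = 0"
      using hom_center[OF \<phi>(1) \<open>c \<in> center G\<close>] ker center_carrier by blast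
    finally show ?thesis by (simp add: T_def)
  qed
  have addT: "additive T"
  proof
    fix v w
    have "T (v + w) = T (\<pi>0 (rep v \<otimes> rep w))"
      using add rep by simp
    also have "\<dots> = \<pi>0 (\<phi> (rep v) \<otimes> \<phi> (rep w))"
      using T rep(1) hom_mult[OF \<phi>(1)] by simp
    also have "\<dots> = T v + T w"
      using add rep(1) hom_in_carrier[OF \<phi>(1)] by (simp add: T_def)
    finally show "T (v + w) = T v + T w" .
  qed
  have T_pow: "(T ^^ i) (\<pi>0 x) = \<pi>0 ((\<phi> ^^ i) x)" if "x \<in> carrier G" for x i
    by (induction i) (use T pow_closed[OF that] in auto)
  have 1: "T ^^ (p ^ n - 1) = id"
  proof
    fix v show "(T ^^ (p ^ n - 1)) v = id v"
      using T_pow[OF rep(1)[of v]] rep id by simp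
  qed
  have 2: "T ^^ j \<noteq> id" if j: "0 < j" "j < p ^ n - 1" for j
  proof
    \<comment> \<open>The iterates of \<open>\<psi>\<close> with exponents \<open>p\<close> and
      \<open>p ^ n - 1\<close> are both trivial. As \<open>p ^ n\<close> exceeds
      \<open>p ^ n - 1\<close> by one and is a multiple of \<open>p\<close>, \<open>\<psi>\<close>
      is trivial itself.\<close>
    assume Tj: "T ^^ j = id"
    define \<psi> where "\<psi> = \<phi> ^^ j"
    have \<psi>: "\<psi> \<in> hom G G" unfolding \<psi>_def by (rule hom_funpow[OF \<phi>(1)])
    have "inv x \<otimes> \<psi> x \<in> center G" if x: "x \<in> carrier G" for x
    proof -
      have "\<pi>0 (\<psi> x) = \<pi>0 x" using T_pow[OF x, of j] Tj by (simp add: \<psi>_def)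
      then show ?thesis
        using x add inv hom_in_carrier[OF \<psi> x] ker[of "inv x \<otimes> \<psi> x"] by simp
    qed
    then have psi_p: "(\<psi> ^^ p) x = x" if "x \<in> carrier G" for x
      using hom_pow_p_id[OF \<psi>] that by blast
    have psi_pm: "(\<psi> ^^ (p * m)) x = x" if "x \<in> carrier G" for x m
    proof -
      have "((\<psi> ^^ p) ^^ m) x = x"
        by (induction m) (use psi_p[OF that] in auto)
      then show ?thesis by (simp add: funpow_mult mult.commute)
    qed
    have psi_N: "(\<psi> ^^ (p ^ n - 1)) x = x" if "x \<in> carrier G" for x
    proof -
      have "((\<phi> ^^ (p ^ n - 1)) ^^ j) x = x"
        by (induction j) (use id[OF that] in auto)
      then show ?thesis by (simp add: \<psi>_def funpow_mult mult.commute)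
    qed
    have "\<psi> x = x" if x: "x \<in> carrier G" for x
    proof -
      have "p * p ^ (n - 1) = Suc (p ^ n - 1)"
        using n prime_gt_0_nat[OF prime_p] by (cases n) simp_all
      then have "(\<psi> ^^ Suc (p ^ n - 1)) x = x"
        using psi_pm[OF x, of "p ^ (n - 1)"] by simp
      then show ?thesis using psi_N[OF x] by simp
    qed
    then show False using not_id[OF j] by (auto simp: \<psi>_def)
  qed
  have "p ^ n > p ^ 1"
    using n K.p_gt_1 by (intro power_strict_increasing) auto
  then have "p ^ n - 1 > 1" using K.p_gt_1 by simp
  from K.singer_cycle[OF addT 1 2 this]
  obtain \<pi>1 and \<zeta> :: 'k where s: "bij \<pi>1" "additive \<pi>1" "\<And>v. \<pi>1 (T v) = \<zeta> * \<pi>1 v" "prim_field p n \<zeta>"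
    by blast
  define \<pi> where "\<pi> x = \<pi>1 (\<pi>0 x)" for x
  have "\<pi> x = 0 \<longleftrightarrow> x \<in> center G" if "x \<in> carrier G" for x
    using ker[OF that] additive.zero[OF s(2)] bij_is_inj[OF s(1)] unfolding \<pi>_def by (metis injD)
  moreover have "\<pi> ` carrier G = UNIV"
    using surj bij_is_surj[OF s(1)] unfolding \<pi>_def by (metis image_image)
  moreover have "\<pi> (\<phi> x) = \<zeta> * \<pi> x" if "x \<in> carrier G" for x
    using T[OF that] s(3)[of "\<pi>0 x"] by (simp add: \<pi>_def)
  moreover have "\<pi> (x \<otimes> y) = \<pi> x + \<pi> y" if "x \<in> carrier G" "y \<in> carrier G" for x y
    using add that additive.add[OF s(2)] by (simp add: \<pi>_def)
  ultimately show ?thesis using s(4) by blast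
qed

end

section \<open>Reconstruction of the group\<close>

locale singer_group = semi_extraspecial_group G p + unitary_field p a \<zeta> q
  for G (structure) and p a q :: nat and \<zeta> :: "'k :: {field, finite}" +
  fixes \<phi> :: "'a \<Rightarrow> 'a" and \<pi> :: "'a \<Rightarrow> 'k"
  assumes \<phi>_hom: "\<phi> \<in> hom G G"
    and \<pi>_mult: "x \<in> carrier G \<Longrightarrow> y \<in> carrier G \<Longrightarrow> \<pi> (x \<otimes> y) = \<pi> x + \<pi> y"
    and \<pi>_ker: "x \<in> carrier G \<Longrightarrow> \<pi> x = 0 \<longleftrightarrow> x \<in> center G"
    and \<pi>_surj: "\<pi> ` carrier G = UNIV"
    and \<pi>_\<phi>: "x \<in> carrier G \<Longrightarrow> \<pi> (\<phi> x) = \<zeta> * \<pi> x"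
begin

definition rep :: "'k \<Rightarrow> 'a" where "rep v = inv_into (carrier G) \<pi> v"

lemma rep [simp]: "rep v \<in> carrier G" "\<pi> (rep v) = v"
  using \<pi>_surj by (simp_all add: rep_def inv_into_into f_inv_into_f)

lemma \<pi>_one [simp]: "\<pi> \<one> = 0"
  using \<pi>_ker[of \<one>] subgroup.one_closed[OF subgroup_center] by simp

lemma \<pi>_inv [simp]: "x \<in> carrier G \<Longrightarrow> \<pi> (inv x) = - \<pi> x"
  using \<pi>_mult[of "inv x" x] by (simp add: eq_neg_iff_add_eq_0)

lemma \<pi>_eq_split:
  assumes "x \<in> carrier G" "y \<in> carrier G" "\<pi> x = \<pi> y"
  shows "\<exists>c. c \<in> center G \<and> y = x \<otimes> c"
  using assms by (intro coset_split) (simp_all add: \<pi>_ker[symmetric] \<pi>_mult)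

lemma comm_cong:
  assumes "x \<in> carrier G" "y \<in> carrier G" "x' \<in> carrier G" "y' \<in> carrier G" "\<pi> x = \<pi> x'" "\<pi> y = \<pi> y'"
  shows "comm x' y' = comm x y"
  using \<pi>_eq_split[of x x'] \<pi>_eq_split[of y y'] assms comm_mult_center by auto

lemma rep_one_noncentral: "rep 1 \<notin> center G"
  using \<pi>_ker[of "rep 1"] by simp

lemma center_comm:
  assumes "z \<in> center G"
  shows "\<exists>v. z = comm (rep 1) (rep v)"
proof -
  obtain y where "y \<in> carrier G" "comm (rep 1) y = z"
    using ex_comm_eq[OF rep(1) rep_one_noncentral assms] by blast
  then show ?thesis using comm_cong[of "rep 1" "rep (\<pi> y)" "rep 1" y] by auto
qed

text \<open>Commutators with \<open>rep 1\<close> exhaust the centre and depend only on the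
  \<open>q ^ 2\<close> values of \<open>\<pi>\<close>, but the values 0 and 1 both give the
  identity.\<close>

lemma card_center: "card (center G) < p ^ (2 * a)"
proof -
  have "center G \<subseteq> (\<lambda>v. comm (rep 1) (rep v)) ` UNIV"
    using center_comm by blast
  moreover have "\<dots> \<subseteq> (\<lambda>v. comm (rep 1) (rep v)) ` (UNIV - {1})"
  proof -
    have "comm (rep 1) (rep 1) = comm (rep 1) (rep 0)"
      using comm_center(2)[of "rep 0" "rep 1"] \<pi>_ker[of "rep 0"] by simp
    then have "comm (rep 1) (rep v) = comm (rep 1) (rep (if v = 1 then 0 else v))" for v
      by simp
    then have "comm (rep 1) (rep v) \<in> (\<lambda>v. comm (rep 1) (rep v)) ` (UNIV - {1})" for v
      by (rule image_eqI) auto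
    then show ?thesis by blast
  qed
  ultimately have "card (center G) \<le> card (UNIV - {1 :: 'k})"
    by (intro surj_card_le) auto
  also have "\<dots> < CARD('k)" using card_gt_1 by simp
  finally show ?thesis using card_k by simp
qed

text \<open>An arbitrary embedding \<open>\<kappa>\<close> of the centre is adjusted. Adjointness
  turns \<open>B x y\<close> into \<open>B 1 (x ^ q * y)\<close>, and \<open>B 1\<close> has the
  same kernel as \<open>v - v ^ q\<close>; so sending \<open>B 1 v\<close> to
  \<open>v - v ^ q\<close> is well defined and injective, and places the centre among the elements
  of trace zero.\<close>

lemma ex_commutator_form:
  "\<exists>\<tau> :: 'a \<Rightarrow> 'k. (\<forall>z\<in>center G. \<forall>w\<in>center G. \<tau> (z \<otimes> w) = \<tau> z + \<tau> w) \<and> inj_on \<tau> (center G)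
     \<and> (\<forall>x\<in>carrier G. \<forall>y\<in>carrier G. \<tau> (comm x y) = \<pi> x ^ q * \<pi> y - (\<pi> x ^ q * \<pi> y) ^ q)"
proof -
  let ?Z = "G\<lparr>carrier := center G\<rparr>"
  interpret Z: group ?Z by (rule subgroup_imp_group[OF subgroup_center])
  have "comm_group ?Z"
    by (rule Z.group_comm_groupI) (simp add: center_commutes center_carrier)
  moreover have "finite (carrier ?Z)"
    using finite_carrier by (auto intro: finite_subset[of _ "carrier G"] simp: center_carrier)
  moreover have "v [^]\<^bsub>?Z\<^esub> p = \<one>\<^bsub>?Z\<^esub>" if "v \<in> carrier ?Z" for v
    using that center_pow_p[of v] by (simp add: nat_pow_def)
  ultimately obtain \<kappa> :: "'a \<Rightarrow> 'k" where \<kappa>_inj: "inj_on \<kappa> (center G)"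
    and \<kappa>_mult: "\<And>z w. z \<in> center G \<Longrightarrow> w \<in> center G \<Longrightarrow> \<kappa> (z \<otimes> w) = \<kappa> z + \<kappa> w"
    using elementary_abelian_embedding[of ?Z] card_center by auto
  have one: "\<one> \<in> center G" by (rule subgroup.one_closed[OF subgroup_center])
  then have "\<kappa> \<one> = \<kappa> \<one> + \<kappa> \<one>" using \<kappa>_mult[of \<one> \<one>] by (metis one_closed r_one)
  then have \<kappa>_one: "\<kappa> \<one> = 0" by (metis add_cancel_right_right)
  define B where "B u v = \<kappa> (comm (rep u) (rep v))" for u v
  have B: "\<kappa> (comm x y) = B (\<pi> x) (\<pi> y)" if "x \<in> carrier G" "y \<in> carrier G" for x y
    using comm_cong[of "rep (\<pi> x)" "rep (\<pi> y)" x y] that by (simp add: B_def)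
  have addl: "additive (\<lambda>u. B u v)" for v
  proof
    fix u w
    have "B (u + w) v = \<kappa> (comm (rep u \<otimes> rep w) (rep v))"
      using B[of "rep u \<otimes> rep w" "rep v"] by (simp add: \<pi>_mult)
    then show "B (u + w) v = B u v + B w v"
      by (simp add: comm_mult_left \<kappa>_mult comm_central B_def)
  qed
  have addr: "additive (B u)" for u
  proof
    fix v w
    have "B u (v + w) = \<kappa> (comm (rep u) (rep v \<otimes> rep w))"
      using B[of "rep u" "rep v \<otimes> rep w"] by (simp add: \<pi>_mult)
    then show "B u (v + w) = B u v + B u w"
      by (simp add: comm_mult_right \<kappa>_mult comm_central B_def)
  qed
  have alt: "B u u = 0" for u
    by (simp add: B_def \<kappa>_one)
  \<comment> \<open>The action of \<open>\<phi>\<close> on the centre, transported by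
    \<open>\<kappa>\<close>; it is meaningful on the image of \<open>\<kappa>\<close> only.\<close>
  define \<Phi> where "\<Phi> s = \<kappa> (\<phi> (inv_into (center G) \<kappa> s))" for s
  have \<Phi>: "\<Phi> (\<kappa> z) = \<kappa> (\<phi> z)" if "z \<in> center G" for z
    using \<kappa>_inj that by (simp add: \<Phi>_def)
  have \<Phi>_B: "\<Phi> (B u v) = B (\<zeta> * u) (\<zeta> * v)" for u v
  proof -
    have "\<Phi> (B u v) = \<kappa> (comm (\<phi> (rep u)) (\<phi> (rep v)))"
      by (simp add: B_def \<Phi> comm_central hom_comm[OF \<phi>_hom])
    also have "\<dots> = B (\<zeta> * u) (\<zeta> * v)"
      by (subst B) (simp_all add: hom_in_carrier[OF \<phi>_hom] \<pi>_\<phi>)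
    finally show ?thesis .
  qed
  have adj: "B (w * x) y = B x (w ^ q * y)" for w x y
  proof (rule biadditive_adjoint[OF addl addr, where S = "\<kappa> ` center G" and \<Phi> = \<Phi>])
    show "B x y \<in> \<kappa> ` center G" for x y
      by (simp add: B_def comm_central)
    show "0 \<in> \<kappa> ` center G" using \<kappa>_one one by force
    show "x + y \<in> \<kappa> ` center G" if "x \<in> \<kappa> ` center G" "y \<in> \<kappa> ` center G" for x y
      using that \<kappa>_mult subgroup.m_closed[OF subgroup_center] by (auto simp: image_iff) metis
    show "card (\<kappa> ` center G) < p ^ (2 * a)"
      using card_center by (simp add: card_image[OF \<kappa>_inj])
    show "\<Phi> (x + y) = \<Phi> x + \<Phi> y" if xy: "x \<in> \<kappa> ` center G" "y \<in> \<kappa> ` center G" for x y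
    proof -
      obtain z w where zw: "z \<in> center G" "w \<in> center G" "x = \<kappa> z" "y = \<kappa> w" using xy by blast
      have "\<Phi> (x + y) = \<Phi> (\<kappa> (z \<otimes> w))" using zw \<kappa>_mult by simp
      also have "\<dots> = \<kappa> (\<phi> z \<otimes> \<phi> w)"
        using zw \<Phi> subgroup.m_closed[OF subgroup_center] hom_mult[OF \<phi>_hom] center_carrier by metis
      also have "\<dots> = \<Phi> x + \<Phi> y"
        using zw \<kappa>_mult hom_center[OF \<phi>_hom] \<Phi> by simp
      finally show ?thesis .
    qed
  qed (rule \<Phi>_B)
  have nz: "B 1 v = 0 \<longleftrightarrow> v ^ q = v" for v
  proof -
    obtain z where z: "z \<in> center G" "z \<noteq> \<one>"
      using center_nontrivial one by blast
    obtain v0 where "z = comm (rep 1) (rep v0)"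
      using center_comm[OF z(1)] by blast
    then have "B 1 v0 \<noteq> 0"
      using z one \<kappa>_inj \<kappa>_one by (metis B_def inj_onD)
    then show ?thesis
      by (rule alternating_kernel[OF addr alt adj _ \<Phi>_B])
  qed
  \<comment> \<open>Any \<open>v\<close> with \<open>\<kappa> z = B 1 v\<close> may be chosen: two
    choices differ by an element fixed by the \<open>q\<close>-th power, which
    \<open>v - v ^ q\<close> does not see.\<close>
  define \<tau> where "\<tau> z = (let v = (SOME v. \<kappa> z = B 1 v) in v - v ^ q)" for z
  have \<tau>: "\<tau> z = v - v ^ q" if "\<kappa> z = B 1 v" for z v
  proof -
    define w where "w = (SOME v. \<kappa> z = B 1 v)"
    have "\<kappa> z = B 1 w" unfolding w_def using that by (rule someI)
    then have "B 1 (w - v) = 0" using that additive.diff[OF addr] by simp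
    then have "w ^ q - v ^ q = w - v" using nz q_diff by metis
    moreover have "\<tau> z = w - w ^ q" by (simp add: \<tau>_def w_def Let_def)
    moreover have "(w - w ^ q) - (v - v ^ q) = (w - v) - (w ^ q - v ^ q)"
      by (simp add: algebra_simps)
    ultimately show ?thesis by simp
  qed
  have ex: "\<exists>v. \<kappa> z = B 1 v" if "z \<in> center G" for z
    using center_comm[OF that] by (auto simp: B_def)
  show ?thesis
  proof (intro exI[of _ \<tau>] conjI ballI)
    fix z w assume zw: "z \<in> center G" "w \<in> center G"
    obtain u v where uv: "\<kappa> z = B 1 u" "\<kappa> w = B 1 v" using ex zw by blast
    then have "\<kappa> (z \<otimes> w) = B 1 (u + v)"
      using zw by (simp add: \<kappa>_mult additive.add[OF addr])
    from \<tau>[OF this] show "\<tau> (z \<otimes> w) = \<tau> z + \<tau> w"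
      using \<tau>[OF uv(1)] \<tau>[OF uv(2)] by (simp add: q_add)
  next
    show "inj_on \<tau> (center G)"
    proof (rule inj_onI)
      fix z w assume zw: "z \<in> center G" "w \<in> center G" "\<tau> z = \<tau> w"
      obtain u v where uv: "\<kappa> z = B 1 u" "\<kappa> w = B 1 v" using ex zw by blast
      have "(u - v) ^ q = u - v"
        using zw(3) \<tau>[OF uv(1)] \<tau>[OF uv(2)] by (simp add: q_diff algebra_simps)
      then have "B 1 (u - v) = 0" using nz by simp
      then have "\<kappa> z = \<kappa> w" using uv additive.diff[OF addr] by simp
      then show "z = w" using zw \<kappa>_inj by (metis inj_onD)
    qed
  next
    fix x y assume xy: "x \<in> carrier G" "y \<in> carrier G"
    have "\<kappa> (comm x y) = B 1 (\<pi> x ^ q * \<pi> y)"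
      using B[OF xy] adj[of "\<pi> x" 1 "\<pi> y"] by simp
    then show "\<tau> (comm x y) = \<pi> x ^ q * \<pi> y - (\<pi> x ^ q * \<pi> y) ^ q"
      by (rule \<tau>)
  qed
qed

end

section \<open>An element of norm 1 and an element of trace -1\<close>

context unitary_field
begin

text \<open>The factor by which the automorphism \<open>\<phi> ^^ (q - 1)\<close> acts on the
  central quotient.\<close>

definition omega :: 'k where "omega = \<zeta> ^ (q - 1)"

text \<open>The value is dictated by the section: its cocycle involves the commutator of a lift of
  \<open>x / (omega - 1)\<close> with a lift of \<open>y\<close>, and the form raises the first
  argument to the power \<open>q\<close>.\<close>

definition kappa :: 'k where "kappa = inverse ((omega - 1) ^ q)"

lemma omega_norm: "omega ^ q * omega = 1"
proof -
  have "omega ^ q * omega = omega ^ (q + 1)" by simp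
  also have "\<dots> = \<zeta> ^ ((q - 1) * (q + 1))"
    by (simp only: omega_def power_mult)
  finally have "omega ^ q * omega = \<zeta> ^ ((q + 1) * (q - 1))"
    by (simp only: mult.commute)
  then show ?thesis
    using zeta_power_eq_1_iff[of "(q + 1) * (q - 1)"] q_squared_minus_1 by simp
qed

lemma omega_neq_1: "omega \<noteq> 1"
proof
  assume "omega = 1"
  then have "(q + 1) * (q - 1) dvd 1 * (q - 1)"
    using zeta_power_eq_1_iff[of "q - 1"] q_squared_minus_1 by (simp add: omega_def)
  then have "q + 1 dvd 1"
    using dvd_times_right_cancel_iff[of "q - 1" "q + 1" 1] q_gt_1 by simp
  then show False using q_gt_1 by simp
qed

text \<open>Norm 1 means \<open>omega ^ q = inverse omega\<close>, whence
  \<open>kappa = omega / (1 - omega)\<close> and \<open>kappa ^ q = - (1 / (1 - omega))\<close>.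
  With such an element \<open>- kappa * c\<close> has trace \<open>c\<close> for every
  \<open>c\<close> in the subfield, in any characteristic.\<close>

lemma kappa_trace: "kappa + kappa ^ q = - 1"
proof -
  have omega_q: "omega ^ q = inverse omega"
    using omega_norm by (metis inverse_unique mult.commute)
  have omega_0: "omega \<noteq> 0" using omega_norm by auto
  have "kappa = inverse (inverse omega - 1)"
    by (simp add: kappa_def q_diff omega_q)
  also have "\<dots> = omega / (1 - omega)"
    using omega_0 by (simp add: field_simps)
  finally have 1: "kappa = omega / (1 - omega)" .
  have "kappa ^ q = inverse (omega - 1)"
    by (simp add: kappa_def q_q flip: power_inverse)
  also have "\<dots> = - (1 / (1 - omega))"
    by (metis inverse_eq_divide minus_diff_eq minus_divide_right)
  finally have 2: "kappa ^ q = - (1 / (1 - omega))" .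
  have "kappa + kappa ^ q = (omega - 1) / (1 - omega)"
    by (subst 2) (simp add: 1 diff_divide_distrib)
  also have "\<dots> = - 1"
    using omega_neq_1 by (simp add: field_simps)
  finally show ?thesis .
qed

end

text \<open>Each \<open>g\<close> is \<open>s (\<pi> g)\<close> times a central \<open>d g\<close>,
  so \<open>G\<close> is known once the cocycle of \<open>s\<close> is. The cocycle is
  \<open>kappa * x ^ q * y\<close> minus its \<open>q\<close>-th power, and the coboundary of
  \<open>kappa * x ^ (q + 1)\<close> turns it into \<open>x * y ^ q\<close>.\<close>

lemma (in singer_group) iso_heis: "G \<cong> (heis q :: ('k \<times> 'k) monoid)"
proof -
  obtain \<tau> :: "'a \<Rightarrow> 'k" where
    \<tau>_mult: "\<And>z w. z \<in> center G \<Longrightarrow> w \<in> center G \<Longrightarrow> \<tau> (z \<otimes> w) = \<tau> z + \<tau> w" and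
    \<tau>_inj: "inj_on \<tau> (center G)" and
    \<tau>_comm: "\<And>x y. x \<in> carrier G \<Longrightarrow> y \<in> carrier G \<Longrightarrow>
      \<tau> (comm x y) = \<pi> x ^ q * \<pi> y - (\<pi> x ^ q * \<pi> y) ^ q"
    using ex_commutator_form by blast
  have one: "\<one> \<in> center G" by (rule subgroup.one_closed[OF subgroup_center])
  have mc: "z \<otimes> w \<in> center G" if "z \<in> center G" "w \<in> center G" for z w
    using subgroup.m_closed[OF subgroup_center that] .
  have ic: "inv z \<in> center G" if "z \<in> center G" for z
    using subgroup.m_inv_closed[OF subgroup_center that] .
  have "\<tau> \<one> = \<tau> \<one> + \<tau> \<one>" using \<tau>_mult[OF one one] by (metis one_closed r_one)
  then have \<tau>_one: "\<tau> \<one> = 0" by (metis add_cancel_right_right)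
  have \<tau>_inv: "\<tau> (inv z) = - \<tau> z" if "z \<in> center G" for z
    using \<tau>_mult[OF ic[OF that] that] \<tau>_one center_carrier[OF that] by (simp add: eq_neg_iff_add_eq_0)
  have \<tau>_q: "\<tau> z ^ q = - \<tau> z" if z: "z \<in> center G" for z
  proof -
    obtain v where "z = comm (rep 1) (rep v)" using center_comm[OF z] by blast
    then have "\<tau> z = v - v ^ q" using \<tau>_comm[of "rep 1" "rep v"] by simp
    then show ?thesis by (simp add: q_diff q_q)
  qed
  define \<psi> where "\<psi> = \<phi> ^^ (q - 1)"
  have \<psi>: "\<psi> \<in> hom G G" unfolding \<psi>_def by (rule hom_funpow[OF \<phi>_hom])
  have \<psi>_closed [simp]: "\<psi> x \<in> carrier G" if "x \<in> carrier G" for x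
    using hom_in_carrier[OF \<psi> that] .
  have \<pi>_\<psi>: "\<pi> (\<psi> x) = omega * \<pi> x" if "x \<in> carrier G" for x
  proof -
    have "\<pi> ((\<phi> ^^ i) x) = \<zeta> ^ i * \<pi> x" for i
      by (induction i) (use that \<pi>_\<phi> hom_in_carrier[OF hom_funpow[OF \<phi>_hom]] in auto)
    then show ?thesis by (simp add: \<psi>_def omega_def)
  qed
  \<comment> \<open>\<open>\<psi>\<close> multiplies both arguments of the commutator form by
    \<open>omega\<close>, and the form sees this only through
    \<open>omega ^ q * omega = 1\<close>.\<close>
  have \<psi>_center: "\<psi> z = z" if z: "z \<in> center G" for z
  proof -
    obtain v where v: "z = comm (rep 1) (rep v)" using center_comm[OF z] by blast
    have "\<tau> (\<psi> z) = \<tau> (comm (\<psi> (rep 1)) (\<psi> (rep v)))"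
      using v hom_comm[OF \<psi>] by simp
    also have "\<dots> = omega ^ q * omega * v - (omega ^ q * omega * v) ^ q"
      by (subst \<tau>_comm) (simp_all add: \<pi>_\<psi> mult.assoc)
    also have "\<dots> = \<tau> z"
      using v \<tau>_comm[of "rep 1" "rep v"] by (simp add: omega_norm)
    finally show ?thesis
      using \<tau>_inj hom_center[OF \<psi> z] z by (metis inj_onD)
  qed
  \<comment> \<open>As \<open>\<psi>\<close> is trivial on the centre, \<open>\<psi> g \<otimes> inv g\<close> depends only on \<open>\<pi> g\<close>, and it lies over \<open>(omega - 1) * \<pi> g\<close>.\<close>
  define s where "s x = \<psi> (rep (x / (omega - 1))) \<otimes> inv (rep (x / (omega - 1)))" for x
  have s_closed [simp]: "s x \<in> carrier G" for x
    by (simp add: s_def)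
  have s_eq: "s ((omega - 1) * \<pi> g) = \<psi> g \<otimes> inv g" if g: "g \<in> carrier G" for g
  proof -
    obtain c where c: "c \<in> center G" "g = rep (\<pi> g) \<otimes> c"
      using \<pi>_eq_split[of "rep (\<pi> g)" g] g by auto
    let ?r = "rep (\<pi> g)"
    note cc = center_carrier[OF c(1)]
    have "\<psi> g \<otimes> inv g = \<psi> ?r \<otimes> (c \<otimes> inv c) \<otimes> inv ?r"
      by (subst (1 2) c(2)) (simp add: hom_mult[OF \<psi>] cc \<psi>_center[OF c(1)] inv_mult_group m_assoc inv_mult_cancel)
    then show ?thesis using omega_neq_1 cc by (simp add: s_def)
  qed
  have \<pi>_s [simp]: "\<pi> (s x) = x" for x
  proof -
    have "\<pi> (s x) = omega * (x / (omega - 1)) - x / (omega - 1)"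
      by (simp add: s_def \<pi>_mult \<pi>_\<psi>)
    also have "\<dots> = (omega - 1) * (x / (omega - 1))"
      by (simp only: left_diff_distrib mult_1_left)
    finally show ?thesis using omega_neq_1 by simp
  qed
  \<comment> \<open>Evaluated at the product of \<open>g\<close> and \<open>h\<close>, the
    expression that defines \<open>s\<close> is \<open>s x\<close> times the conjugate of
    \<open>s y\<close> by \<open>g\<close>; undoing the conjugation costs one commutator.\<close>
  have s_add: "s (x + y) = comm (rep (x / (omega - 1))) (s y) \<otimes> s x \<otimes> s y" for x y
  proof -
    define g h where "g = rep (x / (omega - 1))" and "h = rep (y / (omega - 1))"
    have gh: "g \<in> carrier G" "h \<in> carrier G" by (simp_all add: g_def h_def)
    have sx: "s x = \<psi> g \<otimes> inv g" and sy: "s y = \<psi> h \<otimes> inv h"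
      by (simp_all add: s_def g_def h_def)
    have "(omega - 1) * \<pi> (g \<otimes> h) = x + y"
      using omega_neq_1 by (simp add: g_def h_def \<pi>_mult distrib_left)
    then have "s (x + y) = \<psi> (g \<otimes> h) \<otimes> inv (g \<otimes> h)"
      using s_eq[of "g \<otimes> h"] gh by simp
    also have "\<dots> = \<psi> g \<otimes> inv g \<otimes> (g \<otimes> s y \<otimes> inv g)"
      using gh by (simp add: sy hom_mult[OF \<psi>] inv_mult_group m_assoc inv_mult_cancel)
    also have "\<dots> = s x \<otimes> (comm g (s y) \<otimes> s y)"
      unfolding sx using gh by (subst comm_conj) simp_all
    also have "\<dots> = (comm g (s y) \<otimes> s x) \<otimes> s y"
      using center_commutes[OF comm_central[of g "s y"], of "s x"] gh by (simp add: m_assoc[symmetric])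
    finally show ?thesis by (simp add: g_def)
  qed
  define d where "d g = inv (s (\<pi> g)) \<otimes> g" for g
  have d_center: "d g \<in> center G" if "g \<in> carrier G" for g
    using that \<pi>_ker[of "d g"] by (simp add: d_def \<pi>_mult)
  have d_eq: "g = s (\<pi> g) \<otimes> d g" if "g \<in> carrier G" for g
    using that by (simp add: d_def m_assoc[symmetric])
  have \<tau>_d_mult: "\<tau> (d (g \<otimes> h)) = \<tau> (d g) + \<tau> (d h) - (kappa * \<pi> g ^ q * \<pi> h - kappa ^ q * \<pi> g * \<pi> h ^ q)"
    if gh: "g \<in> carrier G" "h \<in> carrier G" for g h
  proof -
    let ?x = "\<pi> g" and ?y = "\<pi> h"
    define c where "c = comm (rep (?x / (omega - 1))) (s ?y)"
    have c: "c \<in> center G" by (simp add: c_def comm_central)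
    note dg = d_center[OF gh(1)] and dh = d_center[OF gh(2)]
    note car = center_carrier[OF c] center_carrier[OF dg] center_carrier[OF dh]
    define e where "e = d (g \<otimes> h)"
    have "e = inv (c \<otimes> s ?x \<otimes> s ?y) \<otimes> (g \<otimes> h)"
      using gh s_add by (simp add: e_def d_def \<pi>_mult c_def)
    also have "g \<otimes> h = (s ?x \<otimes> d g) \<otimes> (s ?y \<otimes> d h)"
      using d_eq gh by simp
    also have "\<dots> = s ?x \<otimes> (d g \<otimes> s ?y) \<otimes> d h"
      using car by (simp add: m_assoc)
    also have "\<dots> = s ?x \<otimes> s ?y \<otimes> (d g \<otimes> d h)"
      using car center_commutes[OF dg, of "s ?y"] by (simp add: m_assoc)
    also have "inv (c \<otimes> s ?x \<otimes> s ?y) = inv (s ?x \<otimes> s ?y) \<otimes> inv c"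
      using car by (simp add: inv_mult_group m_assoc)
    also have "\<dots> = inv c \<otimes> inv (s ?x \<otimes> s ?y)"
      using center_commutes[OF ic[OF c], of "inv (s ?x \<otimes> s ?y)"] by simp
    also have "inv c \<otimes> inv (s ?x \<otimes> s ?y) \<otimes> (s ?x \<otimes> s ?y \<otimes> (d g \<otimes> d h)) = inv c \<otimes> (d g \<otimes> d h)"
      using car by (simp add: m_assoc inv_mult_group inv_mult_cancel)
    finally have "\<tau> (d (g \<otimes> h)) = - \<tau> c + (\<tau> (d g) + \<tau> (d h))"
      unfolding e_def using \<tau>_mult ic[OF c] \<tau>_inv[OF c] dg dh mc by simp
    \<comment> \<open>The denominator \<open>omega - 1\<close> of the first argument is raised to
      the power \<open>q\<close> by the form; its inverse is \<open>kappa\<close>.\<close>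
    moreover have "\<tau> c = kappa * ?x ^ q * ?y - (kappa * ?x ^ q * ?y) ^ q"
      using \<tau>_comm[of "rep (?x / (omega - 1))" "s ?y"] omega_neq_1
      by (simp add: c_def kappa_def divide_inverse power_mult_distrib power_inverse mult_ac)
    moreover have "(kappa * ?x ^ q * ?y) ^ q = kappa ^ q * ?x * ?y ^ q"
      by (simp add: power_mult_distrib q_q)
    ultimately show ?thesis by simp
  qed
  \<comment> \<open>\<open>\<tau> (d g)\<close> has trace zero, so the correction by
    \<open>kappa * \<pi> g ^ (q + 1)\<close> is what gives the second coordinate the trace
    \<open>\<pi> g ^ (q + 1)\<close> demanded by \<open>heis\<close>.\<close>
  define F where "F g = (\<pi> g, - \<tau> (d g) - kappa * \<pi> g ^ (q + 1))" for g
  have "F \<in> hom G (heis q)"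
  proof (rule homI)
    fix g assume g: "g \<in> carrier G"
    have "(- \<tau> (d g) - kappa * \<pi> g ^ (q + 1)) ^ q = \<tau> (d g) - kappa ^ q * \<pi> g ^ (q + 1)"
      using \<tau>_q[OF d_center[OF g]] by (simp add: q_diff q_minus power_mult_distrib q_q mult.commute)
    then have "(- \<tau> (d g) - kappa * \<pi> g ^ (q + 1)) + (- \<tau> (d g) - kappa * \<pi> g ^ (q + 1)) ^ q = - ((kappa + kappa ^ q) * \<pi> g ^ (q + 1))"
      by (simp add: algebra_simps)
    then show "F g \<in> carrier (heis q)"
      by (simp add: F_def heis_def kappa_trace)
  next
    fix g h assume gh: "g \<in> carrier G" "h \<in> carrier G"
    have "- (kappa * \<pi> h * \<pi> g ^ q) + (kappa * \<pi> g ^ q * \<pi> h - kappa ^ q * \<pi> g * \<pi> h ^ q) - kappa * \<pi> g * \<pi> h ^ q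
        = - ((kappa + kappa ^ q) * (\<pi> g * \<pi> h ^ q))"
      by (simp add: algebra_simps)
    then have 1: "- (kappa * \<pi> h * \<pi> g ^ q) + (kappa * \<pi> g ^ q * \<pi> h - kappa ^ q * \<pi> g * \<pi> h ^ q) - kappa * \<pi> g * \<pi> h ^ q
        = \<pi> g * \<pi> h ^ q"
      by (simp add: kappa_trace)
    have "(\<pi> g + \<pi> h) ^ (q + 1) = (\<pi> g ^ q + \<pi> h ^ q) * (\<pi> g + \<pi> h)"
      by (simp add: q_add mult.commute)
    then have "- \<tau> (d (g \<otimes> h)) - kappa * \<pi> (g \<otimes> h) ^ (q + 1)
       = (- \<tau> (d g) - kappa * \<pi> g ^ (q + 1)) + (- \<tau> (d h) - kappa * \<pi> h ^ (q + 1)) + \<pi> g * \<pi> h ^ q"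
      using \<tau>_d_mult[OF gh] by (subst 1[symmetric]) (simp add: \<pi>_mult gh algebra_simps)
    then show "F (g \<otimes> h) = F g \<otimes>\<^bsub>heis q\<^esub> F h"
      using gh by (simp add: F_def heis_def \<pi>_mult)
  qed
  moreover have "bij_betw F (carrier G) (carrier (heis q :: ('k \<times> 'k) monoid))"
    unfolding bij_betw_def
  proof
    show "inj_on F (carrier G)"
    proof (rule inj_onI)
      fix g h assume gh: "g \<in> carrier G" "h \<in> carrier G" "F g = F h"
      then have \<pi>: "\<pi> g = \<pi> h" by (simp add: F_def)
      with gh(3) have "\<tau> (d g) = \<tau> (d h)" by (simp add: F_def)
      then have "d g = d h" using \<tau>_inj d_center gh by (metis inj_onD)
      then show "g = h" using d_eq gh \<pi> by metis
    qed
    have "F ` carrier G \<subseteq> carrier (heis q)"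
      using \<open>F \<in> hom G (heis q)\<close> by (auto simp: hom_def)
    moreover have "carrier (heis q) \<subseteq> F ` carrier G"
    proof (clarsimp simp: heis_def)
      fix x t :: 'k assume xt: "t + t ^ q = x * x ^ q"
      define t' where "t' = - t - kappa * x ^ (q + 1)"
      have "t' + t' ^ q = - (t + t ^ q) - (kappa + kappa ^ q) * x ^ (q + 1)"
        by (simp add: t'_def q_diff q_minus power_mult_distrib q_q algebra_simps)
      then have t'q: "t' + t' ^ q = 0" using xt by (simp add: kappa_trace)
      then have t'q: "t' ^ q = - t'" by (simp add: eq_neg_iff_add_eq_0 add.commute)
      \<comment> \<open>Additive Hilbert 90 made explicit: for \<open>t'\<close> of trace zero,
        \<open>y - y ^ q\<close> is \<open>- (kappa + kappa ^ q) * t'\<close>, that is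
        \<open>t'\<close>.\<close>
      define y where "y = - (kappa * t')"
      have "y - y ^ q = - ((kappa + kappa ^ q) * t')"
        by (simp add: y_def q_minus power_mult_distrib t'q algebra_simps)
      then have y: "y - y ^ q = t'" by (simp add: kappa_trace)
      define z where "z = comm (rep 1) (rep y)"
      have z: "z \<in> center G" by (simp add: z_def comm_central)
      have \<tau>z: "\<tau> z = t'" using \<tau>_comm[of "rep 1" "rep y"] y by (simp add: z_def)
      have zc: "z \<in> carrier G" using center_carrier[OF z] .
      have \<pi>: "\<pi> (s x \<otimes> z) = x" using \<pi>_ker[OF zc] z zc by (simp add: \<pi>_mult)
      have "d (s x \<otimes> z) = z" using zc by (simp add: d_def \<pi> m_assoc[symmetric])
      then have "F (s x \<otimes> z) = (x, t)" by (simp add: F_def \<pi> \<tau>z t'_def)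
      then show "(x, t) \<in> F ` carrier G" using zc by (metis image_eqI m_closed s_closed)
    qed
    ultimately show "F ` carrier G = carrier (heis q)" by blast
  qed
  ultimately show ?thesis by (auto simp: is_iso_def iso_def)
qed

section \<open>The unitary group\<close>

context unitary_field
begin

definition ct :: "'k ^ 3 ^ 3 \<Rightarrow> 'k ^ 3 ^ 3" where
  "ct U = transpose (map_matrix (\<lambda>x. x ^ q) U)"

definition herm :: "'k ^ 3 \<Rightarrow> 'k ^ 3 \<Rightarrow> 'k" where
  "herm v w = (\<Sum>i\<in>UNIV. v $ i ^ q * w $ i)"

lemma q_sum: "(sum f A :: 'k) ^ q = (\<Sum>i\<in>A. f i ^ q)"
  unfolding q_def by (rule frob_sum)

lemma zero_q [simp]: "(0 :: 'k) ^ q = 0"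
  using q_gt_1 by (simp add: power_0_left)

lemma ct_nth: "ct U $ i $ j = (U $ j $ i) ^ q"
  by (simp add: ct_def transpose_def)

lemma ct_mult: "ct (A ** B) = ct B ** ct A"
  by (simp add: vec_eq_iff ct_nth matrix_matrix_mult_def q_sum power_mult_distrib mult.commute)

lemma ct_ct [simp]: "ct (ct A) = A"
  by (simp add: vec_eq_iff ct_nth q_q)

lemma ct_one [simp]: "ct (mat 1) = mat 1"
  by (auto simp: vec_eq_iff ct_nth mat_def)

lemma SU_iff: "U \<in> carrier (SU q :: ('k ^ 3 ^ 3) monoid) \<longleftrightarrow> det U = 1 \<and> ct U ** U = mat 1"
proof -
  have "matrix_inv U = ct U \<longleftrightarrow> ct U ** U = mat 1" if "det U = 1"
  proof -
    have "invertible U" using that by (simp add: invertible_det_nz)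
    then have inv: "U ** matrix_inv U = mat 1" "matrix_inv U ** U = mat 1"
      unfolding invertible_def matrix_inv_def by (metis (mono_tags, lifting) someI_ex)+
    show ?thesis
    proof
      assume "ct U ** U = mat 1"
      then show "matrix_inv U = ct U"
        using inv(1) by (metis matrix_mul_assoc matrix_mul_lid matrix_mul_rid)
    qed (use inv in auto)
  qed
  then show ?thesis by (auto simp: SU_def ct_def)
qed

lemma SU_mult: "x \<otimes>\<^bsub>SU q\<^esub> y = x ** (y :: 'k ^ 3 ^ 3)" and SU_one: "\<one>\<^bsub>SU q\<^esub> = (mat 1 :: 'k ^ 3 ^ 3)"
  by (simp_all add: SU_def)

lemma group_SU: "group (SU q :: ('k ^ 3 ^ 3) monoid)"
proof (rule groupI; unfold SU_mult SU_one)
  fix U W :: "'k ^ 3 ^ 3"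
  assume U: "U \<in> carrier (SU q)" and W: "W \<in> carrier (SU q)"
  have "ct (U ** W) ** (U ** W) = ct W ** (ct U ** U) ** W"
    by (simp add: ct_mult matrix_mul_assoc)
  then show "U ** W \<in> carrier (SU q)"
    using U W by (simp add: SU_iff det_mul)
next
  show "mat 1 \<in> carrier (SU q :: ('k ^ 3 ^ 3) monoid)"
    by (simp add: SU_iff)
next
  fix U :: "'k ^ 3 ^ 3" assume U: "U \<in> carrier (SU q)"
  then have 1: "ct U ** U = mat 1" and d: "det U = 1" by (simp_all add: SU_iff)
  have "det (ct U) * det U = 1" using 1 by (metis det_I det_mul)
  then have "det (ct U) = 1" using d by simp
  moreover have "U ** ct U = mat 1" using 1 by (simp add: matrix_left_right_inverse)
  ultimately have "ct U \<in> carrier (SU q)" by (simp add: SU_iff)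
  then show "\<exists>W\<in>carrier (SU q). W ** U = mat 1" using 1 by blast
qed (simp_all add: matrix_mul_assoc)

lemma herm_mult: "herm (A *v v) w = herm v (ct A *v w)"
proof -
  have "herm (A *v v) w = (\<Sum>i\<in>UNIV. \<Sum>j\<in>UNIV. (A $ i $ j) ^ q * v $ j ^ q * w $ i)"
    by (simp add: herm_def matrix_vector_mult_def q_sum power_mult_distrib sum_distrib_right)
  also have "\<dots> = (\<Sum>j\<in>UNIV. \<Sum>i\<in>UNIV. (A $ i $ j) ^ q * v $ j ^ q * w $ i)"
    by (rule sum.swap)
  also have "\<dots> = herm v (ct A *v w)"
    by (simp add: herm_def matrix_vector_mult_def ct_nth sum_distrib_left mult_ac)
  finally show ?thesis .
qed

lemma SU_herm:
  assumes "U \<in> carrier (SU q)"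
  shows "herm (U *v v) (U *v w) = herm v w"
  using assms by (simp add: herm_mult matrix_vector_mul_assoc SU_iff)

text \<open>The fibre over 0 is a single point; any other fibre is a coset of the
  \<open>q + 1\<close> elements of norm 1, and \<open>q\<close> is divisible by
  \<open>p\<close>.\<close>

lemma card_norm_fibre:
  assumes "c ^ q = c"
  shows "[card {z :: 'k. z ^ (q + 1) = c} = 1] (mod p)"
proof (cases "c = 0")
  case True
  then have "{z :: 'k. z ^ (q + 1) = c} = {0}" by auto
  then show ?thesis by simp
next
  case False
  obtain j where j: "c = (\<zeta> ^ (q + 1)) ^ j" using norm_surj[OF assms False] by metis
  \<comment> \<open>The powers of \<open>\<zeta> ^ (q - 1)\<close> run through the elements of norm
    1; the shift by \<open>j\<close> makes the norm \<open>c\<close>.\<close>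
  define f where "f i = \<zeta> ^ ((q - 1) * i + j)" for i
  have "{z :: 'k. z ^ (q + 1) = c} = f ` {..<q + 1}"
  proof (intro equalityI subsetI)
    fix z assume "z \<in> f ` {..<q + 1}"
    then obtain i where z: "z = f i" by blast
    have "z ^ (q + 1) = \<zeta> ^ ((q + 1) * (q - 1) * i + (q + 1) * j)"
      unfolding z f_def power_mult[symmetric] by (simp add: algebra_simps)
    also have "\<dots> = (\<zeta> ^ ((q + 1) * (q - 1))) ^ i * c"
      unfolding power_add power_mult j ..
    also have "\<zeta> ^ ((q + 1) * (q - 1)) = 1"
      using zeta_power_eq_1_iff q_squared_minus_1 by simp
    finally show "z \<in> {z. z ^ (q + 1) = c}" by simp
  next
    fix z assume z: "z \<in> {z :: 'k. z ^ (q + 1) = c}"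
    define y where "y = z / \<zeta> ^ j"
    have "y ^ (q + 1) = 1"
    proof -
      have "y ^ (q + 1) = z ^ (q + 1) / (\<zeta> ^ j) ^ (q + 1)"
        unfolding y_def by (rule power_divide)
      also have "(\<zeta> ^ j) ^ (q + 1) = c"
        unfolding j by (simp only: power_mult[symmetric] mult.commute)
      finally show ?thesis using z False by simp
    qed
    moreover have "y \<noteq> 0" using calculation by auto
    then obtain i where i: "y = \<zeta> ^ i" using zeta_gen by blast
    ultimately have "(q + 1) * (q - 1) dvd i * (q + 1)"
      unfolding i power_mult[symmetric] using zeta_power_eq_1_iff q_squared_minus_1 by metis
    then have "(q - 1) * (q + 1) dvd i * (q + 1)" by (simp only: mult.commute)
    then have "q - 1 dvd i"
      by (subst (asm) dvd_times_right_cancel_iff) auto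
    then obtain k where k: "i = (q - 1) * k" ..
    define r where "r = k mod (q + 1)"
    have "\<zeta> ^ i = \<zeta> ^ ((q - 1) * ((q + 1) * (k div (q + 1)) + r))"
      unfolding k r_def by (simp only: mult_div_mod_eq)
    also have "\<dots> = (\<zeta> ^ ((q + 1) * (q - 1))) ^ (k div (q + 1)) * \<zeta> ^ ((q - 1) * r)"
      unfolding power_mult[symmetric] power_add[symmetric] by (simp only: algebra_simps)
    also have "\<zeta> ^ ((q + 1) * (q - 1)) = 1"
      using zeta_power_eq_1_iff q_squared_minus_1 by simp
    finally have "y = \<zeta> ^ ((q - 1) * r)" using i by simp
    then have "z = f r"
      using zeta_nz by (simp add: y_def f_def power_add field_simps)
    moreover have "r < q + 1" by (simp add: r_def)
    ultimately show "z \<in> f ` {..<q + 1}" by blast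
  qed
  moreover have "inj_on f {..<q + 1}"
  proof (rule linorder_inj_onI)
    fix x y :: nat assume xy: "x < y" "x \<in> {..<q + 1}" "y \<in> {..<q + 1}"
    show "f x \<noteq> f y"
    proof
      assume "f x = f y"
      then have "\<zeta> ^ ((q - 1) * x) = \<zeta> ^ ((q - 1) * y)"
        using zeta_nz by (simp add: f_def power_add)
      also have "(q - 1) * y = (q - 1) * x + (q - 1) * (y - x)"
        using xy by (simp flip: distrib_left)
      finally have "\<zeta> ^ ((q - 1) * x) * 1 = \<zeta> ^ ((q - 1) * x) * \<zeta> ^ ((q - 1) * (y - x))"
        by (simp only: power_add mult_1_right)
      then have "\<zeta> ^ ((q - 1) * (y - x)) = 1"
        using zeta_nz by simp
      then have "(q - 1) * (q + 1) dvd (q - 1) * (y - x)"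
        using zeta_power_eq_1_iff q_squared_minus_1 by (simp only: mult.commute)
      then have "q + 1 dvd y - x"
        using q_gt_1 by (subst (asm) dvd_times_left_cancel_iff) auto
      then show False using xy by (auto dest!: dvd_imp_le)
    qed
  qed auto
  ultimately have "card {z :: 'k. z ^ (q + 1) = c} = q + 1"
    by (simp only: card_image card_lessThan)
  moreover have "[q = 0] (mod p)" using a_pos by (simp add: q_def cong_0_iff)
  then have "[q + 1 = 0 + 1] (mod p)" by (intro cong_add) auto
  ultimately show ?thesis by simp
qed

lemma norm_fixed: "(x ^ (q + 1)) ^ q = (x ^ (q + 1) :: 'k)"
  by (simp add: power_mult_distrib q_q mult.commute)

text \<open>For given first and second coordinates the admissible third ones form a norm fibre,
  whose size is 1 modulo \<open>p\<close>; so the number of isotropic vectors is congruent to that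
  of pairs, a power of \<open>p\<close>.\<close>

lemma isotropic_count: "p dvd card {w :: 'k ^ 3. herm w w = 0}"
proof -
  define S where "S x y = {z :: 'k. z ^ (q + 1) = - (x ^ (q + 1) + y ^ (q + 1))}" for x y
  have bij: "bij_betw (\<lambda>w :: 'k ^ 3. ((w $ 1, w $ 2), w $ 3)) {w. herm w w = 0} (SIGMA v:UNIV. S (fst v) (snd v))"
  proof (rule bij_betw_byWitness[where f' = "\<lambda>((x, y), z). vector [x, y, z]"])
    have h: "herm w w = w $ 1 ^ (q + 1) + w $ 2 ^ (q + 1) + w $ 3 ^ (q + 1)" for w
      by (simp add: herm_def sum_3 mult.commute)
    have eq: "a + b + c = 0 \<longleftrightarrow> c = - (a + b)" for a b c :: 'k
      by (metis add.commute eq_neg_iff_add_eq_0)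
    show "(\<lambda>w :: 'k ^ 3. ((w $ 1, w $ 2), w $ 3)) ` {w. herm w w = 0} \<subseteq> (SIGMA v:UNIV. S (fst v) (snd v))"
      unfolding S_def h eq by auto
    show "(\<lambda>((x, y), z). vector [x, y, z]) ` (SIGMA v:UNIV. S (fst v) (snd v)) \<subseteq> {w :: 'k ^ 3. herm w w = 0}"
      unfolding S_def h eq by auto
  qed (auto simp: vec_eq_iff forall_3)
  have "card {w :: 'k ^ 3. herm w w = 0} = card (SIGMA v:UNIV. S (fst v) (snd v))"
    by (rule bij_betw_same_card[OF bij])
  also have "\<dots> = (\<Sum>v\<in>UNIV. card (S (fst v) (snd v)))"
    by (rule card_SigmaI) auto
  also have "[\<dots> = (\<Sum>v\<in>(UNIV :: ('k \<times> 'k) set). 1)] (mod p)"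
  proof (rule cong_sum)
    fix v :: "'k \<times> 'k"
    show "[card (S (fst v) (snd v)) = 1] (mod p)"
      unfolding S_def by (rule card_norm_fibre) (simp only: q_minus q_add norm_fixed)
  qed
  also have "(\<Sum>v\<in>(UNIV :: ('k \<times> 'k) set). 1 :: nat) = p ^ (2 * a) * p ^ (2 * a)"
    using card_k by (simp add: card_cartesian_product flip: UNIV_Times_UNIV)
  finally have "[card {w :: 'k ^ 3. herm w w = 0} = p ^ (2 * a) * p ^ (2 * a)] (mod p)" .
  moreover have "p dvd p ^ (2 * a) * p ^ (2 * a)" using a_pos by simp
  ultimately show ?thesis by (simp add: cong_dvd_iff)
qed

text \<open>The Gram matrix of a hyperbolic pair with a vector of norm -1 in the middle. With this
  sign the second row of a stabilising matrix ends in \<open>x ^ q\<close> and the corner satisfies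
  \<open>t + t ^ q = x ^ (q + 1)\<close>.\<close>

definition hyperbolic :: "'k ^ 3 ^ 3" where
  "hyperbolic = vector [vector [0, 0, 1], vector [0, -1, 0], vector [1, 0, 0]]"

definition heis_matrix :: "'k \<times> 'k \<Rightarrow> 'k ^ 3 ^ 3" where
  "heis_matrix h = vector [vector [1, fst h, snd h], vector [0, 1, fst h ^ q], vector [0, 0, 1]]"

lemma heis_matrix_mult: "heis_matrix (g \<otimes>\<^bsub>heis q\<^esub> h) = heis_matrix g ** heis_matrix h"
  by (cases g; cases h)
     (simp add: heis_matrix_def heis_def vec_eq_iff forall_3 matrix_matrix_mult_def sum_3 q_add algebra_simps)

lemma heis_matrix_inj: "heis_matrix g = heis_matrix h \<Longrightarrow> g = h"
  by (cases g; cases h) (simp add: heis_matrix_def vec_eq_iff forall_3)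

lemma hyperbolic_sq: "hyperbolic ** hyperbolic = mat 1"
  by (simp add: hyperbolic_def vec_eq_iff forall_3 matrix_matrix_mult_def sum_3 mat_def)

lemma heis_matrix_form:
  assumes "h \<in> carrier (heis q)"
  shows "ct (heis_matrix h) ** hyperbolic ** heis_matrix h = hyperbolic"
proof -
  obtain x t where h: "h = (x, t)" by (cases h)
  then have "t + t ^ q = x ^ q * x" using assms by (simp add: heis_def mult.commute)
  then have "t ^ q = x ^ q * x - t" by (metis add_diff_cancel_left')
  then show ?thesis
    by (simp add: h hyperbolic_def heis_matrix_def vec_eq_iff forall_3 matrix_matrix_mult_def sum_3 ct_nth q_q algebra_simps)
qed

lemma det_heis_matrix: "det (heis_matrix h) = 1"
  by (simp add: heis_matrix_def det_3)

text \<open>Pairing with the fixed first basis vector forces the last row to be (0, 0, 1). The form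
  alone would allow any middle entry of norm 1; the determinant makes it 1, and the form then gives
  the remaining relations.\<close>

lemma form_stabilizer_is_heis:
  assumes form: "ct A ** hyperbolic ** A = hyperbolic" and det: "det A = 1"
    and e1: "A $ 1 $ 1 = 1" "A $ 2 $ 1 = 0" "A $ 3 $ 1 = 0"
  shows "\<exists>h\<in>carrier (heis q). A = heis_matrix h"
proof -
  have entry: "(A $ 1 $ i) ^ q * A $ 3 $ j - (A $ 2 $ i) ^ q * A $ 2 $ j + (A $ 3 $ i) ^ q * A $ 1 $ j
      = hyperbolic $ i $ j" for i j
    by (subst form[symmetric]) (simp add: hyperbolic_def matrix_matrix_mult_def sum_3 ct_nth algebra_simps)
  have 32: "A $ 3 $ 2 = 0" and 33: "A $ 3 $ 3 = 1"
    using entry[of 1 2] entry[of 1 3] by (simp_all add: e1 hyperbolic_def)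
  have 22: "A $ 2 $ 2 = 1"
    using det by (simp add: det_3 e1 32 33)
  have 23: "A $ 2 $ 3 = (A $ 1 $ 2) ^ q"
    using entry[of 2 3] by (simp add: 32 33 22 hyperbolic_def)
  have 13: "A $ 1 $ 3 + (A $ 1 $ 3) ^ q = (A $ 1 $ 2) ^ (q + 1)"
    using entry[of 3 3] by (simp add: 33 23 q_q hyperbolic_def algebra_simps)
  show ?thesis
  proof
    show "(A $ 1 $ 2, A $ 1 $ 3) \<in> carrier (heis q)" using 13 by (simp add: heis_def)
    show "A = heis_matrix (A $ 1 $ 2, A $ 1 $ 3)"
      by (simp add: heis_matrix_def vec_eq_iff forall_3 e1 32 33 22 23)
  qed
qed

lemma herm_add_left: "herm (u + v) w = herm u w + herm v w"
  and herm_add_right: "herm w (u + v) = herm w u + herm w v"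
  and herm_smult_left: "herm (c *s u) w = c ^ q * herm u w"
  and herm_smult_right: "herm w (c *s u) = c * herm w u"
  by (simp_all add: herm_def q_add power_mult_distrib sum.distrib sum_distrib_left algebra_simps)

lemma herm_sym: "herm w v = herm v w ^ q"
  by (simp add: herm_def q_sum power_mult_distrib q_q mult.commute)

text \<open>Every isotropic vector extends to a hyperbolic basis \<open>w, u, w'\<close>; here \<open>u\<close> is
  the conjugate of the cross product of \<open>w\<close> and \<open>w'\<close>, and \<open>herm u u = - 1\<close> is Lagrange's identity.\<close>

lemma hyperbolic_basis:
  assumes w: "w \<noteq> 0" "herm w w = 0"
  shows "\<exists>T. ct T ** T = hyperbolic \<and> (\<forall>i. T $ i $ 1 = w $ i)"
proof -
  obtain i where i: "w $ i \<noteq> 0" using w(1) by (auto simp: vec_eq_iff)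
  \<comment> \<open>A multiple of a basis vector at which \<open>w\<close> does not vanish; the
    \<open>q\<close>-th power is there because \<open>herm\<close> is conjugate-linear in its first
    argument.\<close>
  define v where "v = axis i (inverse (w $ i ^ q))"
  have wv: "herm w v = 1"
  proof -
    have "herm w v = (\<Sum>j\<in>UNIV. if j = i then w $ i ^ q * inverse (w $ i ^ q) else 0)"
      unfolding herm_def v_def axis_def by (intro sum.cong) auto
    then show ?thesis using i by simp
  qed
  \<comment> \<open>Adding \<open>d *s w\<close> to \<open>v\<close> changes \<open>herm v v\<close>
    by the trace of \<open>d\<close>, so trace -1 of \<open>kappa\<close> cancels it without a
    division by 2.\<close>
  define d where "d = kappa * herm v v"
  define w' where "w' = v + d *s w"
  have ww': "herm w w' = 1"
    by (simp add: w'_def herm_add_right herm_smult_right wv w(2))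
  have w'w: "herm w' w = 1"
    using herm_sym[of w' w] ww' by simp
  have vv: "herm v v ^ q = herm v v" using herm_sym[of v v] by simp
  have vw: "herm v w = 1" using herm_sym[of v w] wv by simp
  have "herm w' w' = herm v v + (kappa + kappa ^ q) * herm v v"
    by (simp add: w'_def herm_add_right herm_add_left herm_smult_right herm_smult_left wv vw w(2) d_def
        power_mult_distrib vv distrib_right)
  then have w'w': "herm w' w' = 0" by (simp add: kappa_trace)
  let ?a = "w $ 1" and ?b = "w $ 2" and ?c = "w $ 3" and ?x = "w' $ 1" and ?y = "w' $ 2" and ?z = "w' $ 3"
  define u :: "'k ^ 3" where
    "u = vector [(?b * ?z - ?c * ?y) ^ q, (?c * ?x - ?a * ?z) ^ q, (?a * ?y - ?b * ?x) ^ q]"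
  have wu: "herm w u = 0"
    by (simp add: herm_def sum_3 u_def q_diff power_mult_distrib algebra_simps)
  have w'u: "herm w' u = 0"
    by (simp add: herm_def sum_3 u_def q_diff power_mult_distrib algebra_simps)
  have uw: "herm u w = 0" using herm_sym[of u w] wu by simp
  have uw': "herm u w' = 0" using herm_sym[of u w'] w'u by simp
  have "herm u u = herm w w * herm w' w' - herm w w' * herm w' w"
    by (simp add: herm_def sum_3 u_def q_diff power_mult_distrib q_q algebra_simps)
  then have uu: "herm u u = - 1" by (simp add: w(2) ww' w'w)
  define T :: "'k ^ 3 ^ 3" where "T = transpose (vector [w, u, w'])"
  have "(ct T ** T) $ i $ j = herm (column i T) (column j T)" for i j
    by (simp add: matrix_matrix_mult_def ct_nth herm_def column_def)
  note entry = this
  have cols: "column 1 T = w" "column 2 T = u" "column 3 T = w'"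
    by (simp_all add: T_def column_def transpose_def vec_eq_iff)
  have "ct T ** T = hyperbolic"
    by (simp only: vec_eq_iff forall_3 entry cols w(2) wu ww' uw uu uw' w'w w'u w'w') (simp add: hyperbolic_def)
  moreover have "T $ i $ 1 = w $ i" for i
    by (simp add: T_def transpose_def)
  ultimately show ?thesis by blast
qed

definition stab :: "'k ^ 3 \<Rightarrow> ('k ^ 3 ^ 3) set" where
  "stab w = {U \<in> carrier (SU q). U *v w = w}"

text \<open>Conjugation by the basis matrix \<open>T\<close> turns the standard form into
  \<open>hyperbolic\<close> and \<open>w\<close> into the first basis vector; there the stabiliser
  is the group of the matrices \<open>heis_matrix\<close>.\<close>

lemma heis_iso_stab:
  assumes w: "w \<noteq> 0" "herm w w = 0"
  shows "(heis q :: ('k \<times> 'k) monoid) \<cong> (SU q :: ('k ^ 3 ^ 3) monoid)\<lparr>carrier := stab w\<rparr>"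
proof -
  let ?e = "axis 1 1 :: 'k ^ 3"
  obtain T where T: "ct T ** T = hyperbolic" "\<And>i. T $ i $ 1 = w $ i"
    using hyperbolic_basis[OF w] by blast
  \<comment> \<open>The inverse of \<open>T\<close>, read off from
    \<open>ct T ** T = hyperbolic\<close>, as \<open>hyperbolic\<close> is its own inverse.\<close>
  define S where "S = hyperbolic ** ct T"
  have ST: "S ** T = mat 1"
    by (simp add: S_def T(1) hyperbolic_sq flip: matrix_mul_assoc)
  then have TS: "T ** S = mat 1" by (simp add: matrix_left_right_inverse)
  have dets: "det T * det S = 1" using TS by (metis det_I det_mul)
  have S_form: "ct S ** hyperbolic ** S = mat 1"
  proof -
    have "ct S ** hyperbolic ** S = ct (T ** S) ** (T ** S)"
      by (simp add: ct_mult T(1)[symmetric] matrix_mul_assoc)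
    then show ?thesis by (simp add: TS)
  qed
  have Te: "T *v ?e = w"
    by (simp add: vec_eq_iff matrix_vector_mult_def axis_def sum_3 T(2) if_distrib cong: if_cong)
  have Sw: "S *v w = ?e"
    using Te ST by (metis matrix_vector_mul_assoc matrix_vector_mul_lid)
  define f where "f h = T ** heis_matrix h ** S" for h
  have hom: "f (g \<otimes>\<^bsub>heis q\<^esub> h) = f g ** f h" for g h
  proof -
    have "f g ** f h = T ** heis_matrix g ** (S ** T) ** heis_matrix h ** S"
      by (simp add: f_def matrix_mul_assoc)
    then show ?thesis by (simp add: ST heis_matrix_mult f_def matrix_mul_assoc)
  qed
  have mem: "f h \<in> stab w" if h: "h \<in> carrier (heis q)" for h
  proof -
    have "det (f h) = 1" using dets by (simp add: f_def det_mul det_heis_matrix)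
    moreover have "ct (f h) ** f h = ct S ** (ct (heis_matrix h) ** (ct T ** T) ** heis_matrix h) ** S"
      by (simp add: f_def ct_mult matrix_mul_assoc)
    then have "ct (f h) ** f h = mat 1"
      by (simp add: T(1) heis_matrix_form[OF h] S_form)
    moreover have "heis_matrix h *v ?e = ?e"
      by (simp add: vec_eq_iff forall_3 matrix_vector_mult_def axis_def sum_3 heis_matrix_def)
    then have "f h *v w = w"
      by (simp add: f_def Sw Te flip: matrix_vector_mul_assoc)
    ultimately show ?thesis by (simp add: stab_def SU_iff)
  qed
  have "inj_on f (carrier (heis q))"
  proof (rule inj_onI)
    fix g h assume "f g = f h"
    then have "S ** f g ** T = S ** f h ** T" by simp
    moreover have "S ** f h ** T = heis_matrix h" for h
    proof -
      have "S ** f h ** T = (S ** T) ** heis_matrix h ** (S ** T)"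
        by (simp add: f_def matrix_mul_assoc)
      then show ?thesis by (simp add: ST)
    qed
    ultimately show "g = h" using heis_matrix_inj by simp
  qed
  moreover have "stab w \<subseteq> f ` carrier (heis q)"
  proof
    fix U assume "U \<in> stab w"
    then have U: "det U = 1" "ct U ** U = mat 1" "U *v w = w"
      by (simp_all add: stab_def SU_iff)
    define A where "A = S ** U ** T"
    have "ct A ** hyperbolic ** A = ct T ** (ct U ** (ct S ** hyperbolic ** S) ** U) ** T"
      by (simp add: A_def ct_mult matrix_mul_assoc)
    then have 1: "ct A ** hyperbolic ** A = hyperbolic"
      by (simp add: S_form U T(1))
    have 2: "det A = 1" using dets U(1) by (simp add: A_def det_mul mult.commute)
    have "A *v ?e = ?e"
      by (simp add: A_def Te U Sw flip: matrix_vector_mul_assoc)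
    then have "\<forall>i. A $ i $ 1 = ?e $ i"
      by (simp add: vec_eq_iff matrix_vector_mult_def axis_def sum_3)
    then have "A $ 1 $ 1 = 1" "A $ 2 $ 1 = 0" "A $ 3 $ 1 = 0"
      by (simp_all add: axis_def)
    then obtain h where h: "h \<in> carrier (heis q)" "A = heis_matrix h"
      using form_stabilizer_is_heis[OF 1 2] by blast
    have "f h = (T ** S) ** U ** (T ** S)"
      unfolding f_def h(2)[symmetric] A_def by (simp add: matrix_mul_assoc)
    then have "U = f h" by (simp add: TS)
    then show "U \<in> f ` carrier (heis q)" using h(1) by blast
  qed
  ultimately have "bij_betw f (carrier (heis q)) (stab w)"
    using mem by (auto simp: bij_betw_def)
  moreover have "f \<in> hom (heis q) ((SU q)\<lparr>carrier := stab w\<rparr>)"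
    using mem hom by (auto simp: hom_def SU_mult)
  ultimately show ?thesis by (auto simp: is_iso_def iso_def)
qed

end

section \<open>The order of the model group and the Sylow subgroups\<close>

context unitary_field
begin

lemma heis_mem: "(x, t) \<in> carrier (heis q) \<longleftrightarrow> t + t ^ q = x ^ (q + 1)"
  by (simp add: heis_def)

lemma group_heis: "group (heis q :: ('k \<times> 'k) monoid)"
proof (rule groupI)
  fix g h :: "'k \<times> 'k" assume gh: "g \<in> carrier (heis q)" "h \<in> carrier (heis q)"
  obtain x t y s where eq: "g = (x, t)" "h = (y, s)" by (metis surj_pair)
  have "t + s + x * y ^ q + (t + s + x * y ^ q) ^ q = (t + t ^ q) + (s + s ^ q) + x * y ^ q + y * x ^ q"
    by (simp add: q_add power_mult_distrib q_q algebra_simps)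
  also have "\<dots> = x ^ (q + 1) + y ^ (q + 1) + x * y ^ q + y * x ^ q"
    using gh eq by (simp add: heis_mem)
  also have "\<dots> = (x + y) ^ (q + 1)"
    by (simp add: q_add algebra_simps)
  finally show "g \<otimes>\<^bsub>heis q\<^esub> h \<in> carrier (heis q)"
    by (simp add: heis_def eq)
next
  fix g :: "'k \<times> 'k" assume g: "g \<in> carrier (heis q)"
  obtain x t where xt: "g = (x, t)" by (metis surj_pair)
  have "(- x, t ^ q) \<in> carrier (heis q)"
    using g xt by (simp add: heis_def q_minus q_q add.commute)
  moreover have "(- x, t ^ q) \<otimes>\<^bsub>heis q\<^esub> g = \<one>\<^bsub>heis q\<^esub>"
    using g xt by (simp add: heis_def add.commute)
  ultimately show "\<exists>h\<in>carrier (heis q). h \<otimes>\<^bsub>heis q\<^esub> g = \<one>\<^bsub>heis q\<^esub>" by blast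
next
  fix g h l :: "'k \<times> 'k"
  show "g \<otimes>\<^bsub>heis q\<^esub> h \<otimes>\<^bsub>heis q\<^esub> l = g \<otimes>\<^bsub>heis q\<^esub> (h \<otimes>\<^bsub>heis q\<^esub> l)"
    by (cases g; cases h; cases l) (simp add: heis_def q_add algebra_simps)
qed (auto simp: heis_def)

text \<open>The nonzero elements are the powers of \<open>\<zeta> ^ (q + 1)\<close>, which has order
  \<open>q - 1\<close>.\<close>

lemma card_fixed_field: "card {c :: 'k. c ^ q = c} = q"
proof -
  let ?f = "\<lambda>j. (\<zeta> ^ (q + 1)) ^ j"
  have f_eq: "?f j = 1 \<longleftrightarrow> q - 1 dvd j" for j
  proof -
    have "?f j = 1 \<longleftrightarrow> (q + 1) * (q - 1) dvd (q + 1) * j"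
      unfolding power_mult[symmetric] zeta_power_eq_1_iff q_squared_minus_1 ..
    also have "\<dots> \<longleftrightarrow> q - 1 dvd j"
      by (subst dvd_times_left_cancel_iff) auto
    finally show ?thesis .
  qed
  have fixed: "?f j ^ q = ?f j" for j
    by (simp add: power_mult_distrib q_q mult.commute flip: power_mult)
       (metis mult.commute power_mult q_q)
  have "{c :: 'k. c ^ q = c} = insert 0 (?f ` {..<q - 1})"
  proof (intro equalityI subsetI)
    fix c assume c: "c \<in> {c :: 'k. c ^ q = c}"
    show "c \<in> insert 0 (?f ` {..<q - 1})"
    proof (cases "c = 0")
      case False
      obtain j where j: "c = ?f j" using norm_surj[of c] c False by blast
      have "?f j = ?f (q - 1) ^ (j div (q - 1)) * ?f (j mod (q - 1))"
        by (metis mult_div_mod_eq power_add power_mult)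
      also have "?f (q - 1) = 1" using f_eq by simp
      finally have "c = ?f (j mod (q - 1))" using j by simp
      then show ?thesis using q_gt_1 by simp
    qed simp
  qed (use fixed in auto)
  moreover have "inj_on ?f {..<q - 1}"
  proof (rule linorder_inj_onI)
    fix x y :: nat assume xy: "x < y" "x \<in> {..<q - 1}" "y \<in> {..<q - 1}"
    show "?f x \<noteq> ?f y"
    proof
      assume eq: "?f x = ?f y"
      have "?f y = ?f x * ?f (y - x)" using xy by (simp flip: power_add)
      then have "?f (y - x) = 1" using eq zeta_nz by simp
      then have "q - 1 dvd y - x" using f_eq by blast
      then show False using xy by (auto dest!: dvd_imp_le)
    qed
  qed auto
  moreover have "0 \<notin> ?f ` {..<q - 1}" using zeta_nz by auto
  ultimately show ?thesis
    using q_gt_1 by (simp add: card_image)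
qed

text \<open>For given \<open>x\<close> the solutions \<open>t\<close> are the particular one
  \<open>- kappa * x ^ (q + 1)\<close> plus the elements of trace zero, which are the multiples of
  one nonzero \<open>\<epsilon>\<close> by the subfield.\<close>

lemma card_heis: "card (carrier (heis q :: ('k \<times> 'k) monoid)) = p ^ (3 * a)"
proof -
  define \<epsilon> where "\<epsilon> = \<zeta> - \<zeta> ^ q"
  have \<epsilon>q: "\<epsilon> ^ q = - \<epsilon>" by (simp add: \<epsilon>_def q_diff q_q)
  have \<epsilon>: "\<epsilon> \<noteq> 0"
  proof
    assume "\<epsilon> = 0"
    then have "\<zeta> * \<zeta> ^ (q - 1) = \<zeta> * 1"
      using q_gt_1 by (simp add: \<epsilon>_def flip: power_Suc)
    then have "\<zeta> ^ (q - 1) = 1" using zeta_nz by simp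
    then show False using omega_neq_1 by (simp add: omega_def)
  qed
  let ?F = "{c :: 'k. c ^ q = c}"
  have tr: "kappa ^ q = - 1 - kappa" using kappa_trace by (metis add_diff_cancel_left')
  have "bij_betw (\<lambda>(x, t). (x, (t + kappa * x ^ (q + 1)) / \<epsilon>)) (carrier (heis q)) (UNIV \<times> ?F)"
  proof (rule bij_betw_byWitness[where f' = "\<lambda>(x, c). (x, \<epsilon> * c - kappa * x ^ (q + 1))"])
    show "(\<lambda>(x, t). (x, (t + kappa * x ^ (q + 1)) / \<epsilon>)) ` carrier (heis q) \<subseteq> UNIV \<times> ?F"
    proof (clarsimp simp del: power_Suc)
      fix x t :: 'k assume "(x, t) \<in> carrier (heis q)"
      then have "t ^ q = x * x ^ q - t" by (metis heis_mem add_diff_cancel_left' Suc_eq_plus1 power_Suc)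
      then have "(t + kappa * x ^ Suc q) ^ q = - (t + kappa * x ^ Suc q)"
        by (simp add: q_add power_mult_distrib q_q tr algebra_simps)
      then show "((t + kappa * x ^ Suc q) / \<epsilon>) ^ q = (t + kappa * x ^ Suc q) / \<epsilon>"
        by (simp only: power_divide \<epsilon>q minus_divide_divide)
    qed
    show "(\<lambda>(x, c). (x, \<epsilon> * c - kappa * x ^ (q + 1))) ` (UNIV \<times> ?F) \<subseteq> carrier (heis q)"
      by (auto simp: heis_mem q_diff power_mult_distrib \<epsilon>q q_q tr algebra_simps)
  qed (use \<epsilon> in auto)
  then have "card (carrier (heis q :: ('k \<times> 'k) monoid)) = card ((UNIV :: 'k set) \<times> ?F)"
    by (rule bij_betw_same_card)
  also have "\<dots> = p ^ (2 * a) * q"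
    by (simp add: card_cartesian_product card_fixed_field card_k)
  also have "\<dots> = p ^ (3 * a)"
    by (simp add: q_def flip: power_add)
  finally show ?thesis .
qed

lemma subgroup_stab: "subgroup (stab w) (SU q)"
proof (rule group.subgroupI[OF group_SU])
  interpret group "SU q :: ('k ^ 3 ^ 3) monoid" by (rule group_SU)
  show "stab w \<subseteq> carrier (SU q)" by (auto simp: stab_def)
  have "mat 1 \<in> stab w"
    using one_closed by (simp add: stab_def SU_one)
  then show "stab w \<noteq> {}" by blast
  show "inv\<^bsub>SU q\<^esub> U \<in> stab w" if "U \<in> stab w" for U
  proof -
    have U: "U \<in> carrier (SU q)" "U *v w = w" using that by (simp_all add: stab_def)
    have "inv\<^bsub>SU q\<^esub> U *v (U *v w) = w"
      using l_inv[OF U(1)] by (simp add: matrix_vector_mul_assoc SU_mult SU_one)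
    then show ?thesis using U by (simp add: stab_def)
  qed
  show "U \<otimes>\<^bsub>SU q\<^esub> W \<in> stab w" if "U \<in> stab w" "W \<in> stab w" for U W
    using that m_closed[of U W] by (simp add: stab_def SU_mult flip: matrix_vector_mul_assoc)
qed

text \<open>Besides 0, \<open>P\<close> fixes another isotropic vector \<open>w\<close>, the number
  of fixed ones being a multiple of \<open>p\<close>. The order of \<open>stab w\<close> is a power
  of \<open>p\<close> that divides the group order, hence at most that of \<open>P\<close>, which is
  contained in \<open>stab w\<close>.\<close>

lemma sylow_SU_stab:
  assumes P: "sylow_subgroup p P (SU q :: ('k ^ 3 ^ 3) monoid)"
  shows "\<exists>w. w \<noteq> 0 \<and> herm w w = 0 \<and> P = stab w"
proof -
  let ?S = "SU q :: ('k ^ 3 ^ 3) monoid"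
  interpret S: group ?S by (rule group_SU)
  have sub: "subgroup P ?S" and card_P: "card P = p ^ multiplicity p (Coset.order ?S)"
    using P by (auto simp: sylow_subgroup_def)
  have P_carrier: "P \<subseteq> carrier ?S" using sub by (rule subgroup.subset)
  let ?E = "{w :: 'k ^ 3. herm w w = 0}"
  let ?F = "{w \<in> ?E. \<forall>U\<in>carrier (?S\<lparr>carrier := P\<rparr>). U *v w = w}"
  have "[card ?F = card ?E] (mod p)"
  proof (rule p_group_fixed_points[OF S.subgroup_imp_group[OF sub] _ prime_p])
    show "Coset.order (?S\<lparr>carrier := P\<rparr>) = p ^ multiplicity p (Coset.order ?S)"
      using card_P by (simp add: Coset.order_def)
    show "U *v w \<in> ?E" if "U \<in> carrier (?S\<lparr>carrier := P\<rparr>)" "w \<in> ?E" for U w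
      using that P_carrier SU_herm[of U w w] by auto
  qed (auto simp: SU_one SU_mult matrix_vector_mul_assoc)
  then have dvd: "p dvd card ?F"
    using isotropic_count by (simp add: cong_dvd_iff)
  have "0 \<in> ?F" by (simp add: herm_def)
  have "?F \<noteq> {0}"
  proof
    assume "?F = {0}"
    then have "card ?F = 1" by simp
    then show False using dvd p_gt_1 by simp
  qed
  then obtain w where w: "w \<in> ?F" "w \<noteq> 0" using \<open>0 \<in> ?F\<close> by blast
  have sub_stab: "P \<subseteq> stab w" using w P_carrier by (auto simp: stab_def)
  have "card (stab w) = card (carrier (heis q :: ('k \<times> 'k) monoid))"
    using iso_same_card[OF heis_iso_stab[of w]] w by simp
  then have card_stab: "card (stab w) = p ^ (3 * a)" by (simp add: card_heis)
  moreover have "card (stab w) dvd Coset.order ?S"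
    using S.card_subgroup_dvd[OF subgroup_stab S.subgroup_self] by (auto simp: Coset.order_def stab_def)
  moreover have "Coset.order ?S \<noteq> 0"
    using S.order_gt_0_iff_finite by simp
  ultimately have "3 * a \<le> multiplicity p (Coset.order ?S)"
    using p_gt_1 by (intro multiplicity_geI) auto
  then have "card (stab w) \<le> card P"
    using p_gt_1 by (simp add: card_stab card_P)
  then have "P = stab w" by (intro card_seteq sub_stab) auto
  then show ?thesis using w by auto
qed

lemma sylow_SU_iso:
  assumes P: "sylow_subgroup p P (SU q :: ('k ^ 3 ^ 3) monoid)"
  shows "(heis q :: ('k \<times> 'k) monoid) \<cong> (SU q :: ('k ^ 3 ^ 3) monoid)\<lparr>carrier := P\<rparr>"
  using sylow_SU_stab[OF P] heis_iso_stab by blast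

lemma ex_sylow_SU: "\<exists>P. sylow_subgroup p P (SU q :: ('k ^ 3 ^ 3) monoid)"
proof -
  let ?S = "SU q :: ('k ^ 3 ^ 3) monoid"
  obtain m where "Coset.order ?S = p ^ multiplicity p (Coset.order ?S) * m"
    using multiplicity_dvd[of p "Coset.order ?S"] by (elim dvdE)
  from sylow_thm[OF prime_p group_SU this] show ?thesis
    by (auto simp: sylow_subgroup_def)
qed

end

section \<open>Automorphisms\<close>

context group
begin

text \<open>Elements of \<open>AutoGroup G\<close> are \<open>undefined\<close> outside the carrier,
  so a power is an iterate restricted to the carrier; this covers exponent 0 as well.\<close>

lemma AutoGroup_pow:
  assumes "\<phi> \<in> carrier (AutoGroup G)"
  shows "\<phi> [^]\<^bsub>AutoGroup G\<^esub> (n::nat) = restrict (\<phi> ^^ n) (carrier G)"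
proof -
  have \<phi>: "\<phi> \<in> Bij (carrier G)" using assms by (simp add: AutoGroup_def auto_def)
  show ?thesis
  proof (induction n)
    case (Suc n)
    have closed: "\<phi> x \<in> carrier G" if "x \<in> carrier G" for x
      using Bij_imp_funcset[OF \<phi>] that by auto
    interpret A: group "AutoGroup G" by (rule AutoGroup)
    have "carrier (AutoGroup G) \<subseteq> Bij (carrier G)"
      by (auto simp: AutoGroup_def auto_def)
    then have "restrict (\<phi> ^^ n) (carrier G) \<in> Bij (carrier G)"
      using A.nat_pow_closed[OF assms, of n] unfolding Suc by (rule subsetD)
    then have "restrict (\<phi> ^^ n) (carrier G) \<otimes>\<^bsub>AutoGroup G\<^esub> \<phi> = compose (carrier G) (restrict (\<phi> ^^ n) (carrier G)) \<phi>"
      using \<phi> by (simp add: AutoGroup_def BijGroup_def)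
    also have "\<dots> = restrict (\<phi> ^^ Suc n) (carrier G)"
      by (rule ext) (simp add: compose_def closed funpow_swap1)
    finally show ?case by (simp only: A.nat_pow_Suc Suc)
  qed (auto simp: AutoGroup_def BijGroup_def fun_eq_iff)
qed

lemma AutoGroup_ord_dvd_iff:
  assumes "\<phi> \<in> carrier (AutoGroup G)"
  shows "group.ord (AutoGroup G) \<phi> dvd n \<longleftrightarrow> (\<forall>x\<in>carrier G. (\<phi> ^^ n) x = x)"
proof -
  interpret A: group "AutoGroup G" by (rule AutoGroup)
  have "group.ord (AutoGroup G) \<phi> dvd n \<longleftrightarrow> \<phi> [^]\<^bsub>AutoGroup G\<^esub> n = \<one>\<^bsub>AutoGroup G\<^esub>"
    using A.pow_eq_id[OF assms] by simp
  also have "\<dots> \<longleftrightarrow> (\<forall>x\<in>carrier G. (\<phi> ^^ n) x = x)"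
    unfolding AutoGroup_pow[OF assms]
    by (auto simp: AutoGroup_def BijGroup_def fun_eq_iff restrict_def)
  finally show ?thesis .
qed

text \<open>Conjugation with the isomorphism commutes with iteration, so both maps have the same
  trivial iterates. Stating the order by divisibility makes it determined by antisymmetry.\<close>

lemma ex_AutoGroup_ord:
  assumes iso: "G \<cong> H" and H: "group H"
    and \<alpha>: "\<alpha> \<in> hom H H" "bij_betw \<alpha> (carrier H) (carrier H)"
    and pow: "\<And>n. (\<forall>y\<in>carrier H. (\<alpha> ^^ n) y = y) \<longleftrightarrow> N dvd n"
  shows "\<exists>\<phi>\<in>carrier (AutoGroup G). group.ord (AutoGroup G) \<phi> = N"
proof -
  interpret H: group H by (rule H)
  obtain f where f: "f \<in> hom G H" "bij_betw f (carrier G) (carrier H)"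
    using iso by (auto simp: is_iso_def iso_def)
  define g where "g = inv_into (carrier G) f"
  have g: "g \<in> hom H G" "bij_betw g (carrier H) (carrier G)"
    using iso_set_sym[of f H] f by (auto simp: iso_def g_def)
  have fg: "f (g y) = y" if "y \<in> carrier H" for y
    using f(2) that by (simp add: g_def bij_betw_def f_inv_into_f)
  have gf: "g (f x) = x" if "x \<in> carrier G" for x
    using f(2) that by (simp add: g_def bij_betw_def)
  have fc: "f x \<in> carrier H" if "x \<in> carrier G" for x using hom_in_carrier[OF f(1) that] .
  have gc: "g y \<in> carrier G" if "y \<in> carrier H" for y using hom_in_carrier[OF g(1) that] .
  have \<alpha>c: "\<alpha> y \<in> carrier H" if "y \<in> carrier H" for y using hom_in_carrier[OF \<alpha>(1) that] .
  have \<alpha>nc: "(\<alpha> ^^ n) y \<in> carrier H" if "y \<in> carrier H" for y n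
    using hom_in_carrier[OF H.hom_funpow[OF \<alpha>(1)] that] .
  define \<phi> where "\<phi> = restrict (\<lambda>x. g (\<alpha> (f x))) (carrier G)"
  have bij: "bij_betw (\<lambda>x. g (\<alpha> (f x))) (carrier G) (carrier G)"
    using bij_betw_trans[OF bij_betw_trans[OF f(2) \<alpha>(2)] g(2)] by (simp add: comp_def)
  have "\<phi> \<in> hom G G"
  proof (rule homI)
    fix x y assume "x \<in> carrier G" "y \<in> carrier G"
    then show "\<phi> (x \<otimes> y) = \<phi> x \<otimes> \<phi> y"
      by (simp add: \<phi>_def hom_mult[OF f(1)] hom_mult[OF \<alpha>(1)] hom_mult[OF g(1)] fc \<alpha>c)
  qed (simp add: \<phi>_def gc \<alpha>c fc)
  moreover have "\<phi> \<in> Bij (carrier G)"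
    using bij by (auto simp: Bij_def \<phi>_def)
  ultimately have \<phi>: "\<phi> \<in> carrier (AutoGroup G)"
    by (simp add: AutoGroup_def auto_def)
  have \<phi>n: "(\<phi> ^^ n) x = g ((\<alpha> ^^ n) (f x))" if x: "x \<in> carrier G" for x n
  proof (induction n)
    case (Suc n)
    have "g ((\<alpha> ^^ n) (f x)) \<in> carrier G" by (intro gc \<alpha>nc fc x)
    then show ?case using Suc x by (simp add: \<phi>_def fg \<alpha>nc fc)
  qed (simp add: gf x)
  have "group.ord (AutoGroup G) \<phi> dvd n \<longleftrightarrow> N dvd n" for n
  proof -
    have "(\<forall>x\<in>carrier G. (\<phi> ^^ n) x = x) \<longleftrightarrow> (\<forall>y\<in>carrier H. (\<alpha> ^^ n) y = y)"
    proof
      assume L: "\<forall>x\<in>carrier G. (\<phi> ^^ n) x = x"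
      show "\<forall>y\<in>carrier H. (\<alpha> ^^ n) y = y"
      proof
        fix y assume y: "y \<in> carrier H"
        have "g ((\<alpha> ^^ n) y) = g y"
          using bspec[OF L gc[OF y]] \<phi>n[OF gc[OF y], of n] fg[OF y] by simp
        then show "(\<alpha> ^^ n) y = y" using fg[OF y] fg[OF \<alpha>nc[OF y]] by metis
      qed
    next
      assume "\<forall>y\<in>carrier H. (\<alpha> ^^ n) y = y"
      then show "\<forall>x\<in>carrier G. (\<phi> ^^ n) x = x" using \<phi>n fc gf by simp
    qed
    then show ?thesis using AutoGroup_ord_dvd_iff[OF \<phi>] pow by simp
  qed
  then have "group.ord (AutoGroup G) \<phi> = N" by (meson dvd_antisym dvd_refl)
  then show ?thesis using \<phi> by blast
qed

end

context unitary_field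
begin

lemma heis_automorphism:
  defines "\<alpha> \<equiv> \<lambda>(x, t). (\<zeta> * x, \<zeta> ^ (q + 1) * t)"
  shows "\<alpha> \<in> hom (heis q) (heis q)" "bij_betw \<alpha> (carrier (heis q)) (carrier (heis q))"
    and "(\<forall>y\<in>carrier (heis q). (\<alpha> ^^ n) y = y) \<longleftrightarrow> p ^ (2 * a) - 1 dvd n"
proof -
  have zq: "(\<zeta> ^ (q + 1)) ^ q = \<zeta> ^ (q + 1)" by (rule norm_fixed)
  have mem: "\<alpha> h \<in> carrier (heis q)" if "h \<in> carrier (heis q)" for h
  proof -
    obtain x t where h: "h = (x, t)" by (metis surj_pair)
    have "\<zeta> ^ (q + 1) * t + (\<zeta> ^ (q + 1) * t) ^ q = \<zeta> ^ (q + 1) * (t + t ^ q)"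
      by (simp only: power_mult_distrib zq distrib_left)
    also have "\<dots> = (\<zeta> * x) ^ (q + 1)"
      using that h by (simp only: heis_mem power_mult_distrib)
    finally show ?thesis by (simp only: \<alpha>_def h heis_mem prod.case)
  qed
  show "\<alpha> \<in> hom (heis q) (heis q)"
  proof (rule homI)
    fix g h :: "'k \<times> 'k"
    show "\<alpha> (g \<otimes>\<^bsub>heis q\<^esub> h) = \<alpha> g \<otimes>\<^bsub>heis q\<^esub> \<alpha> h"
      by (cases g; cases h) (simp add: \<alpha>_def heis_def power_mult_distrib algebra_simps)
  qed (rule mem)
  have inj: "inj_on \<alpha> (carrier (heis q))"
    using zeta_nz by (auto simp: inj_on_def \<alpha>_def)
  then have "\<alpha> ` carrier (heis q) = carrier (heis q)"
    using mem by (intro endo_inj_surj) auto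
  then show "bij_betw \<alpha> (carrier (heis q)) (carrier (heis q))"
    using inj by (simp add: bij_betw_def)
  have pow: "(\<alpha> ^^ n) (x, t) = (\<zeta> ^ n * x, (\<zeta> ^ n) ^ (q + 1) * t)" for x t
    by (induction n) (simp_all add: \<alpha>_def power_mult_distrib mult_ac)
  show "(\<forall>y\<in>carrier (heis q). (\<alpha> ^^ n) y = y) \<longleftrightarrow> p ^ (2 * a) - 1 dvd n"
    unfolding zeta_power_eq_1_iff[symmetric]
  proof
    assume all: "\<forall>y\<in>carrier (heis q). (\<alpha> ^^ n) y = y"
    \<comment> \<open>An element of the group with first coordinate 1 is wanted, so that the first
      coordinate of its image is \<open>\<zeta> ^ n\<close>; its second coordinate must have trace
      1.\<close>
    have "- kappa + (- kappa) ^ q = - (kappa + kappa ^ q)"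
      by (simp add: q_minus)
    then have "- kappa + (- kappa) ^ q = 1"
      by (simp add: kappa_trace)
    then have "(1, - kappa) \<in> carrier (heis q)" by (simp add: heis_mem)
    then have "(\<alpha> ^^ n) (1, - kappa) = (1, - kappa)" using all by blast
    then show "\<zeta> ^ n = 1" by (simp add: pow)
  qed (auto simp: pow)
qed

end

theorem theorem1:
  fixes p a :: nat and G :: "('g, 'b) monoid_scheme"
  assumes "Factorial_Ring.prime p"
    and "semi_extraspecial p G"
    and "a > 0"
    and "card (rcosets\<^bsub>G\<^esub> (commutator_subgroup G)) = p ^ (2 * a)"
    and "CARD('k :: {field, finite}) = p ^ (2 * a)"
  shows "(\<exists>\<phi> \<in> carrier (AutoGroup G).
            group.ord (AutoGroup G) \<phi> = card (rcosets\<^bsub>G\<^esub> (commutator_subgroup G)) - 1) \<longleftrightarrow>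
         (\<exists>P. sylow_subgroup p P (SU (p ^ a) :: ('k ^ 3 ^ 3) monoid) \<and>
              G \<cong> (SU (p ^ a) :: ('k ^ 3 ^ 3) monoid)\<lparr>carrier := P\<rparr>)"
proof -
  have "group G" using assms(2) by (simp add: semi_extraspecial_def p_group_def)
  then interpret semi_extraspecial_group G p
    using assms(1,2) by (simp add: semi_extraspecial_group_def semi_extraspecial_group_axioms_def)
  \<comment> \<open>An arbitrary primitive element, good enough for the unitary group; the one by
    which \<open>\<phi>\<close> acts is obtained separately from \<open>\<phi>\<close>.\<close>
  obtain \<zeta>0 :: 'k where "prim_field p (2 * a) \<zeta>0"
    using ex_prim_field[OF assms(1,5)] by blast
  then interpret K: unitary_field p a \<zeta>0 "p ^ a"
    using assms(3) by (simp add: unitary_field_def unitary_field_axioms_def)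
  obtain P0 where P0: "sylow_subgroup p P0 (SU (p ^ a) :: ('k ^ 3 ^ 3) monoid)"
    using K.ex_sylow_SU by blast
  show ?thesis
    unfolding assms(4)
  proof
    assume "\<exists>\<phi> \<in> carrier (AutoGroup G). group.ord (AutoGroup G) \<phi> = p ^ (2 * a) - 1"
    then obtain \<phi> where \<phi>: "\<phi> \<in> carrier (AutoGroup G)" "group.ord (AutoGroup G) \<phi> = p ^ (2 * a) - 1"
      by blast
    have hom: "\<phi> \<in> hom G G" "\<phi> ` carrier G = carrier G"
      using \<phi>(1) by (auto simp: AutoGroup_def auto_def Bij_def bij_betw_def)
    have id: "\<forall>x\<in>carrier G. (\<phi> ^^ (p ^ (2 * a) - 1)) x = x"
      using AutoGroup_ord_dvd_iff[OF \<phi>(1), of "p ^ (2 * a) - 1"] \<phi>(2) by simp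
    have not_id: "\<forall>j. 0 < j \<longrightarrow> j < p ^ (2 * a) - 1 \<longrightarrow> (\<exists>x\<in>carrier G. (\<phi> ^^ j) x \<noteq> x)"
    proof (intro allI impI)
      fix j assume "0 < j" "j < p ^ (2 * a) - 1"
      then have "\<not> group.ord (AutoGroup G) \<phi> dvd j"
        unfolding \<phi>(2) by (auto dest: dvd_imp_le)
      then show "\<exists>x\<in>carrier G. (\<phi> ^^ j) x \<noteq> x"
        unfolding AutoGroup_ord_dvd_iff[OF \<phi>(1)] by blast
    qed
    have "1 < 2 * a" using assms(3) by simp
    note singer = singer_automorphism[OF assms(5) _ hom id not_id this]
    have card: "card (rcosets\<^bsub>G\<^esub> (center G)) = p ^ (2 * a)"
      using assms(4) by (simp add: commutator_subgroup_eq_center)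
    obtain \<zeta> :: 'k and \<pi> where "prim_field p (2 * a) \<zeta>"
      and \<pi>: "\<forall>x\<in>carrier G. \<forall>y\<in>carrier G. \<pi> (x \<otimes>\<^bsub>G\<^esub> y) = \<pi> x + \<pi> y"
        "\<forall>x\<in>carrier G. \<pi> x = 0 \<longleftrightarrow> x \<in> center G" "\<pi> ` carrier G = UNIV"
        "\<forall>x\<in>carrier G. \<pi> (\<phi> x) = \<zeta> * \<pi> x"
      using singer[OF card] by blast
    then interpret S: singer_group G p a "p ^ a" \<zeta> \<phi> \<pi>
      using hom(1) assms(3)
      by (intro singer_group.intro singer_group_axioms.intro semi_extraspecial_group_axioms
          unitary_field.intro unitary_field_axioms.intro) auto
    show "\<exists>P. sylow_subgroup p P (SU (p ^ a) :: ('k ^ 3 ^ 3) monoid) \<and>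
              G \<cong> (SU (p ^ a) :: ('k ^ 3 ^ 3) monoid)\<lparr>carrier := P\<rparr>"
      \<comment> \<open>Every Sylow subgroup is isomorphic to the model \<open>heis\<close>, so any
        existing one can serve as witness.\<close>
      using P0 iso_trans[OF S.iso_heis K.sylow_SU_iso[OF P0]] by blast
  next
    assume "\<exists>P. sylow_subgroup p P (SU (p ^ a) :: ('k ^ 3 ^ 3) monoid) \<and>
              G \<cong> (SU (p ^ a) :: ('k ^ 3 ^ 3) monoid)\<lparr>carrier := P\<rparr>"
    then obtain P where P: "sylow_subgroup p P (SU (p ^ a) :: ('k ^ 3 ^ 3) monoid)"
      and iso: "G \<cong> (SU (p ^ a) :: ('k ^ 3 ^ 3) monoid)\<lparr>carrier := P\<rparr>" by blast
    have "G \<cong> (heis (p ^ a) :: ('k \<times> 'k) monoid)"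
      by (rule iso_trans[OF iso group.iso_sym[OF K.group_heis K.sylow_SU_iso[OF P]]])
    then show "\<exists>\<phi> \<in> carrier (AutoGroup G). group.ord (AutoGroup G) \<phi> = p ^ (2 * a) - 1"
      by (rule ex_AutoGroup_ord[OF _ K.group_heis K.heis_automorphism])
  qed
qed

end
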